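(* Let $X$ be a non-empty, locally compact space with Borel $\sigma$-algebra $\mathfrak B$. For $\mu\in\mathrm{M}_{\mathrm r}(X,\mathfrak B,\mathbb R)$, set $$\langle\varphi_\mu,f\rangle:=\int_X f\,d\mu$$ for $f\in\mathrm{C}_{\mathrm c}(X,\mathbb R)$. Then $\varphi_\mu\in\mathrm{C}_{\mathrm c}(X,\mathbb R)^\sim$, and the map $\Phi:\mu\mapsto\varphi_\mu$ defines an injective lattice homomorphism $\Phi:\mathrm{M}_{\mathrm r}(X,\mathfrak B,\mathbb R)\to\mathrm{C}_{\mathrm c}(X,\mathbb R)^\sim$. Suppose that $h$ is a bounded Borel measurable function on $X$. Then $\varphi_{h\mu}=h\varphi_\mu$. For $\mu\in\mathrm{M}_{\mathrm r}(X,\mathfrak B,\mathbb R)$, set $\|\varphi_\mu\|:=\|\mu\|$, thus making $\Phi(\mathrm{M}_{\mathrm r}(X,\mathfrak B,\mathbb R))$ into a Dedekind complete Banach lattice. Then the set $$\{\varphi\in\Phi(\mathrm{M}_{\mathrm r}(X,\mathfrak B,\mathbb R)): \operatorname{supp}\varphi\text{ is compact and }\operatorname{supp}\varphi^+\cap\operatorname{supp}\varphi^-=\emptyset\}$$ is a dense subset of the Banach lattice $\Phi(\mathrm{M}_{\mathrm r}(X,\mathfrak B,\mathbb R))$.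
   Context: All topological spaces are Hausdorff; functions are real-valued. A positive regular Borel measure on $X$ is a measure $\mu:\mathfrak B\to[0,\infty]$ that is finite on compact sets, outer regular on all Borel sets ($\mu(A)=\inf\{\mu(V):V\text{ open},A\subseteq V\}$), and inner regular on all open sets ($\mu(V)=\sup\{\mu(K):K\text{ compact},K\subseteq V\}$). $\mathrm{M}_{\mathrm r}(X,\mathfrak B,\mathbb R)$ is the real-linear span of the finite positive regular Borel measures on $X$, ordered by $\mu\ge\nu$ iff $\mu(A)\ge\nu(A)$ for all $A\in\mathfrak B$; it is a Dedekind complete Banach lattice, with $|\mu|$ the total variation measure and $\|\mu\|=|\mu|(X)$. $h\mu$ is the measure $A\mapsto\int_A h\,d\mu$. $\mathrm{C}_{\mathrm c}(X,\mathbb R)$ is the vector lattice of continuous, real-valued functions on $X$ with compact support, with pointwise ordering. Its order dual $\mathrm{C}_{\mathrm c}(X,\mathbb R)^\sim$ is the space of linear functionals on it that map order bounded sets to bounded sets (equivalently, differences of two positive functionals), with $\varphi\ge\psi$ iff $\langle\varphi,f\rangle\ge\langle\psi,f\rangle$ for all $f\ge0$; it is a Dedekind complete vector lattice. In a vector lattice, $x^+=x\vee0$, $x^-=(-x)\vee0$, $|x|=x\vee(-x)$; a linear map $L$ between vector lattices is a lattice homomorphism if $|Lx|=L|x|$ for all $x$. A Banach lattice is a vector lattice with a complete norm such that $|x|\le|y|$ implies $\|x\|\le\|y\|$. Support: $\varphi\in\mathrm{C}_{\mathrm c}(X,\mathbb R)^\sim$ vanishes on an open set $U\subseteq X$ if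 $\langle\varphi,f\rangle=0$ for all $f\in \mathrm{C}_{\mathrm c}(X,\mathbb R)$ with $\operatorname{supp} f\subseteq U$; $\operatorname{supp}\varphi$ is the complement of the union of all open sets on which $\varphi$ vanishes. Product with bounded Borel functions: for $\varphi\in \mathrm{C}_{\mathrm c}(X,\mathbb R)^\sim$ and a non-empty, open, relatively compact $U\subseteq X$, there is a unique finite signed regular Borel measure $\mu_U$ on $U$ with $\langle\varphi,k\rangle=\int_U k\,d\mu_U$ for all $k\in\mathrm{C}_{\mathrm c}(X,\mathbb R)$ with $\operatorname{supp}k\subseteq U$. For a bounded Borel measurable $h:X\to\mathbb R$, the element $h\varphi$ of $\mathrm{C}_{\mathrm c}(X,\mathbb R)^\sim$ is defined by $\langle h\varphi,f\rangle:=\int_U fh\,d\mu_U$, where $U$ is any open relatively compact neighbourhood of $\operatorname{supp}f$ (this is independent of $U$). *)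

theory Defs
  imports
    "HOL-Analysis.Analysis"
    "HOL-Library.Function_Algebras"
    "HOL-Library.Disjoint_Sets"
    "HOL-Algebra.Lattice"
begin

instantiation "fun" :: (type, real_vector) real_vector
begin

definition scaleR_fun :: "real \<Rightarrow> ('a \<Rightarrow> 'b) \<Rightarrow> 'a \<Rightarrow> 'b"
  where "scaleR_fun c f = (\<lambda>x. c *\<^sub>R f x)"

instance
  by standard (simp_all add: scaleR_fun_def plus_fun_def fun_eq_iff scaleR_add_right scaleR_add_left)

end

text \<open>The carrier of a vector lattice is a linear subspace of an ambient real vector space;
  the order lives on the carrier only.\<close>

locale vector_lattice = lattice L
  for L :: "'v::real_vector gorder" (structure) +
  assumes subspace_carrier: "subspace (carrier L)"
    and add_mono: "\<lbrakk>x \<in> carrier L; y \<in> carrier L; z \<in> carrier L; x \<sqsubseteq> y\<rbrakk> \<Longrightarrow> x + z \<sqsubseteq> y + z"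
    and scale_mono: "\<lbrakk>x \<in> carrier L; y \<in> carrier L; 0 \<le> c; x \<sqsubseteq> y\<rbrakk> \<Longrightarrow> c *\<^sub>R x \<sqsubseteq> c *\<^sub>R y"

definition vl_abs :: "'v::real_vector gorder \<Rightarrow> 'v \<Rightarrow> 'v"
  where "vl_abs L x = x \<squnion>\<^bsub>L\<^esub> (- x)"

definition vl_pos :: "'v::real_vector gorder \<Rightarrow> 'v \<Rightarrow> 'v"
  where "vl_pos L x = x \<squnion>\<^bsub>L\<^esub> 0"

definition vl_neg :: "'v::real_vector gorder \<Rightarrow> 'v \<Rightarrow> 'v"
  where "vl_neg L x = (- x) \<squnion>\<^bsub>L\<^esub> 0"

definition dedekind_complete :: "'v gorder \<Rightarrow> bool"
  where "dedekind_complete L \<longleftrightarrow>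
    (\<forall>A \<subseteq> carrier L. A \<noteq> {} \<and> Upper L A \<noteq> {} \<longrightarrow> (\<exists>s. is_lub L s A))"

definition lattice_homomorphism ::
    "'v::real_vector gorder \<Rightarrow> 'w::real_vector gorder \<Rightarrow> ('v \<Rightarrow> 'w) \<Rightarrow> bool"
  where "lattice_homomorphism L M T \<longleftrightarrow>
    vector_lattice L \<and> vector_lattice M \<and> T \<in> carrier L \<rightarrow> carrier M \<and>
    (\<forall>x \<in> carrier L. \<forall>y \<in> carrier L. T (x + y) = T x + T y) \<and>
    (\<forall>c. \<forall>x \<in> carrier L. T (c *\<^sub>R x) = c *\<^sub>R T x) \<and>
    (\<forall>x \<in> carrier L. vl_abs M (T x) = T (vl_abs L x))"

text \<open>The case distinction is needed because the locale \<^locale>\<open>Metric_space\<close> asks for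
  nonnegativity and symmetry also off the carrier.\<close>

definition norm_metric :: "'v::real_vector set \<Rightarrow> ('v \<Rightarrow> real) \<Rightarrow> 'v \<Rightarrow> 'v \<Rightarrow> real"
  where "norm_metric V N x y = (if x \<in> V \<and> y \<in> V then N (x - y) else 0)"

locale banach_lattice = vector_lattice L
  for L :: "'v::real_vector gorder" (structure) +
  fixes N :: "'v \<Rightarrow> real"
  assumes norm_nonneg: "x \<in> carrier L \<Longrightarrow> 0 \<le> N x"
    and norm_eq_zero: "x \<in> carrier L \<Longrightarrow> N x = 0 \<longleftrightarrow> x = 0"
    and norm_triangle: "\<lbrakk>x \<in> carrier L; y \<in> carrier L\<rbrakk> \<Longrightarrow> N (x + y) \<le> N x + N y"
    and norm_scale: "x \<in> carrier L \<Longrightarrow> N (c *\<^sub>R x) = \<bar>c\<bar> * N x"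
    and norm_lattice: "\<lbrakk>x \<in> carrier L; y \<in> carrier L; vl_abs L x \<sqsubseteq> vl_abs L y\<rbrakk> \<Longrightarrow> N x \<le> N y"
    and norm_complete: "Metric_space.mcomplete (carrier L) (norm_metric (carrier L) N)"

text \<open>Signed measures are set functions that are zero off the Borel sets (as is
  \<^term>\<open>measure M\<close> off \<^term>\<open>sets M\<close>). Everything is parametrised by a subset \<open>S\<close> of the ambient
  space, equipped with the subspace topology; \<open>S = UNIV\<close> is the space \<open>X\<close> itself.\<close>

definition regular_borel_measure :: "'a::topological_space set \<Rightarrow> 'a measure \<Rightarrow> bool"
  where "regular_borel_measure S M \<longleftrightarrow>
    sets M = sets (restrict_space borel S) \<and>
    (\<forall>K. compact K \<and> K \<subseteq> S \<longrightarrow> emeasure M K < \<infinity>) \<and>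
    (\<forall>A \<in> sets M. emeasure M A =
      (INF V \<in> {V. openin (top_of_set S) V \<and> A \<subseteq> V}. emeasure M V)) \<and>
    (\<forall>V. openin (top_of_set S) V \<longrightarrow> emeasure M V =
      (SUP K \<in> {K. compact K \<and> K \<subseteq> V}. emeasure M K))"

definition signed_regular_measures :: "'a::topological_space set \<Rightarrow> ('a set \<Rightarrow> real) set"
  where "signed_regular_measures S =
    span {measure M |M. regular_borel_measure S M \<and> finite_measure M}"

definition measure_lattice :: "('a::topological_space set \<Rightarrow> real) gorder"
  where "measure_lattice =
    \<lparr>carrier = signed_regular_measures UNIV, eq = (=),
     le = (\<lambda>\<mu> \<nu>. \<forall>A \<in> sets borel. \<mu> A \<le> \<nu> A)\<rparr>"

definition total_variation ::
    "'a::topological_space set \<Rightarrow> ('a set \<Rightarrow> real) \<Rightarrow> 'a set \<Rightarrow> real"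
  where "total_variation S \<mu> A =
    Sup {(\<Sum>E\<in>P. \<bar>\<mu> E\<bar>) |P. finite P \<and> P \<subseteq> sets (restrict_space borel S) \<and> partition_on A P}"

text \<open>The integral against a signed measure is defined through the Jordan decomposition
  \<open>\<mu> = (\<bar>\<mu>\<bar> + \<mu>) / 2 - (\<bar>\<mu>\<bar> - \<mu>) / 2\<close>.\<close>

definition jordan_pos :: "'a::topological_space set \<Rightarrow> ('a set \<Rightarrow> real) \<Rightarrow> 'a measure"
  where "jordan_pos S \<mu> = measure_of S (sets (restrict_space borel S))
    (\<lambda>A. ennreal ((total_variation S \<mu> A + \<mu> A) / 2))"

definition jordan_neg :: "'a::topological_space set \<Rightarrow> ('a set \<Rightarrow> real) \<Rightarrow> 'a measure"
  where "jordan_neg S \<mu> = measure_of S (sets (restrict_space borel S))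
    (\<lambda>A. ennreal ((total_variation S \<mu> A - \<mu> A) / 2))"

definition signed_integral ::
    "'a::topological_space set \<Rightarrow> ('a set \<Rightarrow> real) \<Rightarrow> ('a \<Rightarrow> real) \<Rightarrow> real"
  where "signed_integral S \<mu> f = (LINT x|jordan_pos S \<mu>. f x) - (LINT x|jordan_neg S \<mu>. f x)"

definition density_measure ::
    "('a::topological_space \<Rightarrow> real) \<Rightarrow> ('a set \<Rightarrow> real) \<Rightarrow> 'a set \<Rightarrow> real"
  where "density_measure h \<mu> A =
    (if A \<in> sets borel then signed_integral UNIV \<mu> (\<lambda>x. indicator A x * h x) else 0)"

definition fsupp :: "('a::topological_space \<Rightarrow> real) \<Rightarrow> 'a set"
  where "fsupp f = closure {x. f x \<noteq> 0}"

definition Cc :: "('a::topological_space \<Rightarrow> real) set"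
  where "Cc = {f. continuous_on UNIV f \<and> compact (fsupp f)}"

text \<open>A functional on \<^term>\<open>Cc\<close> is represented by its extension by zero to all functions. The
  relation \<open>\<le>\<close> between functions is the pointwise one.\<close>

definition order_bounded_functionals :: "(('a::topological_space \<Rightarrow> real) \<Rightarrow> real) set"
  where "order_bounded_functionals = {\<phi>.
    (\<forall>f. f \<notin> Cc \<longrightarrow> \<phi> f = 0) \<and>
    (\<forall>f \<in> Cc. \<forall>g \<in> Cc. \<phi> (f + g) = \<phi> f + \<phi> g) \<and>
    (\<forall>c. \<forall>f \<in> Cc. \<phi> (c *\<^sub>R f) = c * \<phi> f) \<and>
    (\<forall>B \<subseteq> Cc. (\<exists>l \<in> Cc. \<exists>u \<in> Cc. \<forall>f \<in> B. l \<le> f \<and> f \<le> u) \<longrightarrow> bounded (\<phi> ` B))}"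

definition order_dual :: "(('a::topological_space \<Rightarrow> real) \<Rightarrow> real) gorder"
  where "order_dual =
    \<lparr>carrier = order_bounded_functionals, eq = (=),
     le = (\<lambda>\<phi> \<psi>. \<forall>f \<in> Cc. 0 \<le> f \<longrightarrow> \<phi> f \<le> \<psi> f)\<rparr>"

definition vanishes_on :: "(('a::topological_space \<Rightarrow> real) \<Rightarrow> real) \<Rightarrow> 'a set \<Rightarrow> bool"
  where "vanishes_on \<phi> U \<longleftrightarrow> (\<forall>f \<in> Cc. fsupp f \<subseteq> U \<longrightarrow> \<phi> f = 0)"

definition supp :: "(('a::topological_space \<Rightarrow> real) \<Rightarrow> real) \<Rightarrow> 'a set"
  where "supp \<phi> = - \<Union>{U. open U \<and> vanishes_on \<phi> U}"

definition local_measure ::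
    "(('a::topological_space \<Rightarrow> real) \<Rightarrow> real) \<Rightarrow> 'a set \<Rightarrow> 'a set \<Rightarrow> real"
  where "local_measure \<phi> U = (THE \<nu>. \<nu> \<in> signed_regular_measures U \<and>
    (\<forall>k \<in> Cc. fsupp k \<subseteq> U \<longrightarrow> \<phi> k = signed_integral U \<nu> k))"

text \<open>The integral below does not depend on the neighbourhood \<open>U\<close> of the support of \<open>f\<close> picked
  by \<open>SOME\<close>.\<close>

definition functional_mult ::
    "('a::topological_space \<Rightarrow> real) \<Rightarrow> (('a \<Rightarrow> real) \<Rightarrow> real) \<Rightarrow> ('a \<Rightarrow> real) \<Rightarrow> real"
  where "functional_mult h \<phi> f =
    (if f \<in> Cc then
       let U = (SOME U. open U \<and> U \<noteq> {} \<and> compact (closure U) \<and> fsupp f \<subseteq> U)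
       in signed_integral U (local_measure \<phi> U) (\<lambda>x. f x * h x)
     else 0)"

definition Phi :: "('a::topological_space set \<Rightarrow> real) \<Rightarrow> ('a \<Rightarrow> real) \<Rightarrow> real"
  where "Phi \<mu> f = (if f \<in> Cc then signed_integral UNIV \<mu> f else 0)"

definition Phi_lattice :: "(('a::topological_space \<Rightarrow> real) \<Rightarrow> real) gorder"
  where "Phi_lattice = order_dual\<lparr>carrier := Phi ` signed_regular_measures UNIV\<rparr>"

definition Phi_norm :: "(('a::topological_space \<Rightarrow> real) \<Rightarrow> real) \<Rightarrow> real"
  where "Phi_norm \<phi> =
    total_variation UNIV (inv_into (signed_regular_measures UNIV) Phi \<phi>) UNIV"

end

theory Submission
  imports Defs
begin

text \<open>A signed regular measure is a difference of two finite regular measures, so it has a Hahn set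
  \<open>Y\<close>, and its Jordan parts \<open>A \<mapsto> \<mu> (A \<inter> Y)\<close> and \<open>A \<mapsto> - \<mu> (A - Y)\<close> are dominated by regular
  measures, hence regular. By regularity and Urysohn's lemma, indicator functions of Borel sets are
  limits in the mean of functions in \<^term>\<open>Cc\<close> with values between 0 and 1. Applied to \<open>Y\<close>, this
  shows that \<^term>\<open>Phi\<close> maps the positive part of \<open>\<mu>\<close> to that of \<open>Phi \<mu>\<close>; applied to all Borel
  subsets of an open set, it shows that \<^term>\<open>Phi\<close> is an order embedding and that the measures
  representing a functional locally are unique. Completeness of the norm comes from uniform limits
  of the Jordan parts, Dedekind completeness from suprema in the complete lattice of all measures,
  and density from approximating \<open>Y\<close> and its complement from inside by compact sets.\<close>

subsection \<open>Finite regular measures and the Jordan decomposition\<close>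

text \<open>For a finite measure, both regularity conditions say that some difference set
  \<open>V - A\<close> or \<open>V - K\<close> has small measure. In this form regularity passes to
  dominated measures, to sums and to uniform limits, and nearly all new measures below arise in one
  of these ways. Signed integrals are defined through the Jordan parts, and these are not additive
  in the measure. What makes the integral linear is that any difference of finite regular measures
  representing \<open>\<mu>\<close> computes it, see \<open>signed_integral_eq\<close>. Measures
  live on an arbitrary open set \<open>S\<close> because the product of a functional with a bounded
  Borel function is defined by measures on open sets \<open>U\<close>. On both sides of
  \<open>Phi\<close> the lattice structure is reduced to suprema of \<open>x\<close> and 0:
  translations turn these into all binary suprema, negation gives the infima, and the modulus of
  \<open>x\<close> is twice the positive part minus \<open>x\<close>. Since \<open>Phi\<close> is an
  order embedding and its image carries the transported norm, the completeness statements are proved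
  for measures and then moved to the image.\<close>

abbreviation borel_on :: "'a::topological_space set \<Rightarrow> 'a set set"
  where "borel_on S \<equiv> sets (restrict_space borel S)"

lemma space_restrict_borel [simp]: "space (restrict_space borel S) = S"
  by (simp add: space_restrict_space)

lemma borel_on_iff: "open S \<Longrightarrow> A \<in> borel_on S \<longleftrightarrow> A \<in> sets borel \<and> A \<subseteq> S"
  by (auto simp: sets_restrict_space_iff)

lemma borel_on_top [simp]: "S \<in> borel_on S"
  using sets.top[of "restrict_space borel S"] by (simp add: space_restrict_space)

section \<open>Measures from additive set functions that are continuous at the empty set\<close>

definition setfun_measure :: "'a::topological_space set \<Rightarrow> ('a set \<Rightarrow> real) \<Rightarrow> 'a measure"
  where "setfun_measure S m = measure_of S (borel_on S) (\<lambda>A. ennreal (m A))"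

lemma borel_on_sigma_algebra: "sigma_algebra S (borel_on S)"
  using sets.sigma_algebra_axioms[of "restrict_space borel S"] by simp

lemma sets_setfun_measure [simp]: "sets (setfun_measure S m) = borel_on S"
  by (simp add: setfun_measure_def sigma_algebra.sets_measure_of_eq[OF borel_on_sigma_algebra])

lemma space_setfun_measure [simp]: "space (setfun_measure S m) = S"
  by (simp add: setfun_measure_def sigma_algebra.space_measure_of_eq[OF borel_on_sigma_algebra])

text \<open>For a finite nonnegative additive set function, continuity at the empty set amounts to
  countable additivity. This is the form in which the property is inherited from a dominating
  measure and by uniform limits.\<close>

locale continuous_setfun =
  fixes S :: "'a::topological_space set" and m :: "'a set \<Rightarrow> real"
  assumes nonneg: "A \<in> borel_on S \<Longrightarrow> 0 \<le> m A"
    and additive: "\<lbrakk>A \<in> borel_on S; B \<in> borel_on S; A \<inter> B = {}\<rbrakk> \<Longrightarrow> m (A \<union> B) = m A + m B"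
    and continuous: "\<lbrakk>range C \<subseteq> borel_on S; decseq C; (\<Inter>i. C i) = {}\<rbrakk> \<Longrightarrow> (\<lambda>i. m (C i)) \<longlonglongrightarrow> 0"
begin

lemma emeasure_eq:
  assumes "A \<in> borel_on S" shows "emeasure (setfun_measure S m) A = ennreal (m A)"
proof -
  interpret sigma_algebra S "borel_on S" by (rule borel_on_sigma_algebra)
  have m0: "m {} = 0" using additive[of "{}" "{}"] by simp
  have pos: "positive (borel_on S) (\<lambda>A. ennreal (m A))" by (simp add: positive_def m0)
  have "countably_additive (borel_on S) (\<lambda>A. ennreal (m A))"
  proof (rule empty_continuous_imp_countably_additive[OF pos])
    show "Measure_Space.additive (borel_on S) (\<lambda>A. ennreal (m A))"
      by (auto simp: Measure_Space.additive_def additive nonneg)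
    show "(\<lambda>i. ennreal (m (A i))) \<longlonglongrightarrow> 0"
      if "range A \<subseteq> borel_on S" "decseq A" "(\<Inter>i. A i) = {}" for A
      using tendsto_ennrealI[OF continuous[OF that]] by simp
  qed auto
  then show ?thesis
    unfolding setfun_measure_def
    by (intro emeasure_measure_of_sigma assms pos borel_on_sigma_algebra)
qed

lemma measure_eq: "A \<in> borel_on S \<Longrightarrow> measure (setfun_measure S m) A = m A"
  by (simp add: measure_def emeasure_eq nonneg)

lemma finite: "finite_measure (setfun_measure S m)"
  by (rule finite_measureI) (simp add: emeasure_eq)

end

lemma dominated_continuous_setfun:
  assumes "finite_measure M" "sets M = borel_on S"
    and nonneg: "\<And>A. A \<in> borel_on S \<Longrightarrow> 0 \<le> m A"
    and add: "\<And>A B. \<lbrakk>A \<in> borel_on S; B \<in> borel_on S; A \<inter> B = {}\<rbrakk> \<Longrightarrow> m (A \<union> B) = m A + m B"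
    and le: "\<And>A. A \<in> borel_on S \<Longrightarrow> m A \<le> measure M A"
  shows "continuous_setfun S m"
proof
  interpret finite_measure M by fact
  show "(\<lambda>i. m (B i)) \<longlonglongrightarrow> 0"
    if B: "range B \<subseteq> borel_on S" "decseq B" "(\<Inter>i. B i) = {}" for B
  proof (rule tendsto_sandwich[OF _ _ tendsto_const])
    show "(\<lambda>i. measure M (B i)) \<longlonglongrightarrow> 0"
      using finite_Lim_measure_decseq[of B] B assms(2) by simp
  qed (use nonneg le B in auto)
qed (use nonneg add in auto)

section \<open>Regularity of finite measures in epsilon form\<close>

definition fin_regular :: "'a::topological_space set \<Rightarrow> 'a measure \<Rightarrow> bool"
  where "fin_regular S M \<longleftrightarrow> regular_borel_measure S M \<and> finite_measure M"

lemma openin_top_of_open_set: "open S \<Longrightarrow> openin (top_of_set S) V \<longleftrightarrow> open V \<and> V \<subseteq> S"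
  by (metis openin_open_eq)

lemma compact_in_borel_on:
  fixes K :: "'a::t2_space set"
  assumes "open S" "compact K" "K \<subseteq> S" shows "K \<in> borel_on S"
  using assms by (simp add: borel_on_iff compact_imp_closed)

text \<open>Values of a finite measure can be subtracted, so the infimum and the supremum in the
  definition become difference sets of small measure. As \<open>S\<close> is open, its relatively
  open subsets are the open sets contained in it.\<close>

lemma fin_regular_iff:
  fixes S :: "'a::t2_space set"
  assumes S: "open S"
  shows "fin_regular S M \<longleftrightarrow> sets M = borel_on S \<and> finite_measure M \<and>
    (\<forall>A \<in> borel_on S. \<forall>e>0. \<exists>V. open V \<and> A \<subseteq> V \<and> V \<subseteq> S \<and> measure M (V - A) < e) \<and>
    (\<forall>V. \<forall>e>0. open V \<and> V \<subseteq> S \<longrightarrow> (\<exists>K. compact K \<and> K \<subseteq> V \<and> measure M (V - K) < e))"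
proof (cases "sets M = borel_on S \<and> finite_measure M")
  case False
  then show ?thesis by (auto simp: fin_regular_def regular_borel_measure_def)
next
  case True
  then interpret finite_measure M by simp
  have sets: "sets M = borel_on S" using True by simp
  have ob: "V \<in> borel_on S" if "open V" "V \<subseteq> S" for V
    using S that by (simp add: borel_on_iff)
  note cb = compact_in_borel_on[OF S]
  have diff: "measure M (V - A) < e \<longleftrightarrow> emeasure M V < emeasure M A + ennreal e"
    if "A \<in> borel_on S" "V \<in> borel_on S" "A \<subseteq> V" "e > 0" for A V and e :: real
  proof -
    have "measure M (V - A) = measure M V - measure M A"
      using that by (intro finite_measure_Diff) (auto simp: sets)
    moreover have "emeasure M V < emeasure M A + ennreal e \<longleftrightarrow> measure M V < measure M A + e"
      using that by (simp add: emeasure_eq_measure less_imp_le ennreal_less_iff flip: ennreal_plus)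
    ultimately show ?thesis by auto
  qed
  have outer: "(emeasure M A = (INF V \<in> {V. openin (top_of_set S) V \<and> A \<subseteq> V}. emeasure M V)) \<longleftrightarrow>
    (\<forall>e>0. \<exists>V. open V \<and> A \<subseteq> V \<and> V \<subseteq> S \<and> measure M (V - A) < e)" (is "_ = ?I \<longleftrightarrow> ?E")
    if A: "A \<in> borel_on S" for A
  proof
    assume eq: "emeasure M A = ?I"
    show ?E
    proof (intro allI impI)
      fix e :: real assume e: "e > 0"
      have "?I < emeasure M A + ennreal e"
        unfolding eq[symmetric] using e by (simp add: emeasure_eq_measure less_imp_le ennreal_less_iff flip: ennreal_plus)
      then obtain V where "open V" "A \<subseteq> V" "V \<subseteq> S" "emeasure M V < emeasure M A + ennreal e"
        by (auto simp: INF_less_iff openin_top_of_open_set[OF S])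
      then show "\<exists>V. open V \<and> A \<subseteq> V \<and> V \<subseteq> S \<and> measure M (V - A) < e"
        using diff[OF A ob] e by blast
    qed
  next
    assume E: ?E
    show "emeasure M A = ?I"
    proof (rule antisym)
      show "emeasure M A \<le> ?I"
        by (intro INF_greatest emeasure_mono)
          (auto simp: openin_top_of_open_set[OF S] sets ob)
      show "?I \<le> emeasure M A"
      proof (rule ennreal_le_epsilon)
        fix e :: real assume e: "e > 0"
        then obtain V where V: "open V" "A \<subseteq> V" "V \<subseteq> S" "measure M (V - A) < e" using E by blast
        then have "emeasure M V < emeasure M A + ennreal e" using diff[OF A ob] e by blast
        then show "?I \<le> emeasure M A + ennreal e"
          by (intro INF_lower2[of V]) (use V in \<open>auto simp: openin_top_of_open_set[OF S]\<close>)
      qed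
    qed
  qed
  have inner: "(emeasure M V = (SUP K \<in> {K. compact K \<and> K \<subseteq> V}. emeasure M K)) \<longleftrightarrow>
    (\<forall>e>0. \<exists>K. compact K \<and> K \<subseteq> V \<and> measure M (V - K) < e)" (is "_ = ?I \<longleftrightarrow> ?E")
    if V: "open V" "V \<subseteq> S" for V
  proof
    assume eq: "emeasure M V = ?I"
    show ?E
    proof (intro allI impI)
      fix e :: real assume e: "e > 0"
      have "\<exists>K. compact K \<and> K \<subseteq> V \<and> emeasure M V < emeasure M K + ennreal e"
      \<comment> \<open>If \<open>V\<close> has measure below \<open>e\<close>, the empty set
        serves. Otherwise the truncated subtraction of \<open>e\<close> in \<open>ennreal\<close> is
        an honest one.\<close>
      proof (cases "emeasure M V < ennreal e")
        case True
        then show ?thesis by (intro exI[of _ "{}"]) auto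
      next
        case False
        then have "measure M V \<ge> e" by (simp add: emeasure_eq_measure ennreal_less_iff e less_imp_le not_less)
        then have "emeasure M V - ennreal e < ?I"
          unfolding eq[symmetric] using e
          by (simp add: emeasure_eq_measure ennreal_minus ennreal_less_iff less_imp_le)
        then obtain K where "compact K" "K \<subseteq> V" "emeasure M V - ennreal e < emeasure M K"
          by (auto simp: less_SUP_iff)
        moreover from this have "emeasure M V < emeasure M K + ennreal e"
          using \<open>measure M V \<ge> e\<close> e
          by (simp add: emeasure_eq_measure ennreal_minus ennreal_less_iff less_imp_le
              flip: ennreal_plus)
        ultimately show ?thesis by blast
      qed
      then obtain K where K: "compact K" "K \<subseteq> V" "emeasure M V < emeasure M K + ennreal e" by blast
      then show "\<exists>K. compact K \<and> K \<subseteq> V \<and> measure M (V - K) < e"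
        using diff[OF cb[of K] ob[OF V]] V e by (intro exI[of _ K]) auto
    qed
  next
    assume E: ?E
    show "emeasure M V = ?I"
    proof (rule antisym)
      show "?I \<le> emeasure M V"
        by (intro SUP_least emeasure_mono) (auto simp: sets ob V)
      show "emeasure M V \<le> ?I"
      proof (rule ennreal_le_epsilon)
        fix e :: real assume e: "e > 0"
        then obtain K where K: "compact K" "K \<subseteq> V" "measure M (V - K) < e" using E by blast
        then have "emeasure M V < emeasure M K + ennreal e" using diff[OF cb[of K] ob[OF V]] V e by auto
        also have "\<dots> \<le> ?I + ennreal e"
          by (intro add_right_mono SUP_upper) (use K in auto)
        finally show "emeasure M V \<le> ?I + ennreal e" by simp
      qed
    qed
  qed
  show ?thesis
    unfolding fin_regular_def regular_borel_measure_def
    using True outer inner S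
    by (auto simp: openin_top_of_open_set[OF S] emeasure_eq_measure)
qed

lemma rfmI:
  fixes S :: "'a::t2_space set"
  assumes "open S" "sets M = borel_on S" "finite_measure M"
    and "\<And>A e. \<lbrakk>A \<in> borel_on S; e > 0\<rbrakk> \<Longrightarrow> \<exists>V. open V \<and> A \<subseteq> V \<and> V \<subseteq> S \<and> measure M (V - A) < e"
    and "\<And>V e. \<lbrakk>open V; V \<subseteq> S; e > 0\<rbrakk> \<Longrightarrow> \<exists>K. compact K \<and> K \<subseteq> V \<and> measure M (V - K) < e"
  shows "fin_regular S M"
  unfolding fin_regular_iff[OF assms(1)] by (safe intro!: assms(2-5))

lemma fin_regular_sets: "fin_regular S M \<Longrightarrow> sets M = borel_on S"
  by (simp add: fin_regular_def regular_borel_measure_def)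

lemma fin_regular_space: "fin_regular S M \<Longrightarrow> space M = S"
  using fin_regular_sets[THEN sets_eq_imp_space_eq] by (simp add: space_restrict_space)

lemma fin_regular_finite: "fin_regular S M \<Longrightarrow> finite_measure M"
  by (simp add: fin_regular_def)

lemma fin_regular_outer:
  fixes S :: "'a::t2_space set"
  assumes "fin_regular S M" "open S" "A \<in> borel_on S" "e > 0"
  obtains V where "open V" "A \<subseteq> V" "V \<subseteq> S" "measure M (V - A) < e"
  using assms unfolding fin_regular_iff[OF assms(2)] by meson

lemma fin_regular_inner_open:
  fixes S :: "'a::t2_space set"
  assumes "fin_regular S M" "open S" "open V" "V \<subseteq> S" "e > 0"
  obtains K where "compact K" "K \<subseteq> V" "measure M (V - K) < e"
  using assms unfolding fin_regular_iff[OF assms(2)] by meson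

text \<open>An epsilon-delta form of absolute continuity: sets that are small for a regular measure
  are small for \<open>N\<close>. The measure \<open>M\<close> may depend on \<open>e\<close>, which
  is what uniform limits require.\<close>

lemma fin_regular_approx:
  fixes S :: "'a::t2_space set"
  assumes S: "open S" and N: "sets N = borel_on S" "finite_measure N"
    and approx: "\<And>e. e > 0 \<Longrightarrow> \<exists>M d. fin_regular S M \<and> d > 0 \<and>
      (\<forall>A \<in> borel_on S. measure M A < d \<longrightarrow> measure N A < (e::real))"
  shows "fin_regular S N"
proof (rule rfmI[OF S N])
  fix A and e :: real assume A: "A \<in> borel_on S" and e: "e > 0"
  from approx[OF e] obtain M d where M: "fin_regular S M" "d > 0"
    "\<And>A. A \<in> borel_on S \<Longrightarrow> measure M A < d \<Longrightarrow> measure N A < e" by blast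
  obtain V where V: "open V" "A \<subseteq> V" "V \<subseteq> S" "measure M (V - A) < d"
    using fin_regular_outer[OF M(1) S A M(2)] .
  have "V - A \<in> borel_on S" using A V S by (auto simp: borel_on_iff)
  then show "\<exists>V. open V \<and> A \<subseteq> V \<and> V \<subseteq> S \<and> measure N (V - A) < e"
    using M(3) V by blast
next
  fix V and e :: real assume V: "open V" "V \<subseteq> S" and e: "e > 0"
  from approx[OF e] obtain M d where M: "fin_regular S M" "d > 0"
    "\<And>A. A \<in> borel_on S \<Longrightarrow> measure M A < d \<Longrightarrow> measure N A < e" by blast
  obtain K where K: "compact K" "K \<subseteq> V" "measure M (V - K) < d"
    using fin_regular_inner_open[OF M(1) S V M(2)] .
  have "V - K \<in> borel_on S" using K V S by (auto simp: borel_on_iff compact_imp_closed)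
  then show "\<exists>K. compact K \<and> K \<subseteq> V \<and> measure N (V - K) < e"
    using M(3) K by blast
qed

lemma fin_regular_dominated:
  fixes S :: "'a::t2_space set"
  assumes S: "open S" and N: "sets N = borel_on S" "finite_measure N"
    and M: "fin_regular S M" and le: "\<And>A. A \<in> borel_on S \<Longrightarrow> measure N A \<le> c * measure M A"
  shows "fin_regular S N"
proof (rule fin_regular_approx[OF S N])
  fix e :: real assume e: "e > 0"
  \<comment> \<open>The tolerance \<open>e / c'\<close> needs a positive divisor, and enlarging
    \<open>c\<close> only weakens the bound.\<close>
  define c' where "c' = max c 1"
  have c': "c' > 0" "c \<le> c'" by (auto simp: c'_def)
  have "measure N A < e" if A: "A \<in> borel_on S" "measure M A < e / c'" for A
  proof -
    have "measure N A \<le> c' * measure M A"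
      using le[OF A(1)] c' by (smt (verit) mult_right_mono measure_nonneg)
    also have "\<dots> < e" using A(2) c' by (simp add: field_simps)
    finally show ?thesis .
  qed
  then show "\<exists>M d. fin_regular S M \<and> d > 0 \<and> (\<forall>A \<in> borel_on S. measure M A < d \<longrightarrow> measure N A < e)"
    using M c' e by (intro exI[of _ M] exI[of _ "e / c'"]) auto
qed

lemma fin_regular_dominated_setfun:
  fixes S :: "'a::t2_space set"
  assumes S: "open S" and M: "fin_regular S M"
    and nonneg: "\<And>A. A \<in> borel_on S \<Longrightarrow> 0 \<le> m A"
    and add: "\<And>A B. \<lbrakk>A \<in> borel_on S; B \<in> borel_on S; A \<inter> B = {}\<rbrakk> \<Longrightarrow> m (A \<union> B) = m A + m B"
    and le: "\<And>A. A \<in> borel_on S \<Longrightarrow> m A \<le> measure M A"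
  shows "fin_regular S (setfun_measure S m)"
    and "\<And>A. A \<in> borel_on S \<Longrightarrow> measure (setfun_measure S m) A = m A"
proof -
  interpret continuous_setfun S m
    using dominated_continuous_setfun[OF fin_regular_finite[OF M] fin_regular_sets[OF M]] nonneg add le by blast
  show "\<And>A. A \<in> borel_on S \<Longrightarrow> measure (setfun_measure S m) A = m A" by (rule measure_eq)
  then show "fin_regular S (setfun_measure S m)"
    by (intro fin_regular_dominated[OF S _ finite M, of 1]) (auto intro: le)
qed

text \<open>Intersecting the two open neighbourhoods and uniting the two compact sets only shrinks
  the difference sets. The equation holds for every \<open>A\<close>, since all three measures are 0
  off the Borel sets of \<open>S\<close>.\<close>

lemma fin_regular_sum:
  fixes S :: "'a::t2_space set"
  assumes S: "open S" and M: "fin_regular S M" and N: "fin_regular S N"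
  obtains P where "fin_regular S P" "\<And>A. measure P A = measure M A + measure N A"
proof
  interpret M: finite_measure M by (rule fin_regular_finite[OF M])
  interpret N: finite_measure N by (rule fin_regular_finite[OF N])
  note [simp] = fin_regular_sets[OF M] fin_regular_sets[OF N]
  let ?m = "\<lambda>A. measure M A + measure N A"
  interpret continuous_setfun S ?m
  proof
    fix B assume B: "range B \<subseteq> borel_on S" "decseq B" "(\<Inter>i. B i) = {}"
    then show "(\<lambda>i. ?m (B i)) \<longlonglongrightarrow> 0"
      using tendsto_add[OF M.finite_Lim_measure_decseq[of B] N.finite_Lim_measure_decseq[of B]]
      by simp
  qed (auto simp: M.finite_measure_Union N.finite_measure_Union)
  show P: "measure (setfun_measure S ?m) A = ?m A" for A
    by (cases "A \<in> borel_on S") (simp_all add: measure_eq measure_notin_sets)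
  show "fin_regular S (setfun_measure S ?m)"
  proof (rule rfmI[OF S sets_setfun_measure finite])
    fix A and e :: real assume A: "A \<in> borel_on S" and e: "e > 0"
    obtain V W where V: "open V" "A \<subseteq> V" "V \<subseteq> S" "measure M (V - A) < e / 2"
      and W: "open W" "A \<subseteq> W" "W \<subseteq> S" "measure N (W - A) < e / 2"
      using fin_regular_outer[OF M S A half_gt_zero[OF e]] fin_regular_outer[OF N S A half_gt_zero[OF e]] by metis
    have "measure M (V \<inter> W - A) \<le> measure M (V - A)" "measure N (V \<inter> W - A) \<le> measure N (W - A)"
      using A V W S by (auto intro!: M.finite_measure_mono N.finite_measure_mono simp: borel_on_iff)
    then show "\<exists>V. open V \<and> A \<subseteq> V \<and> V \<subseteq> S \<and> measure (setfun_measure S ?m) (V - A) < e"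
      using V W by (intro exI[of _ "V \<inter> W"]) (auto simp: P)
  next
    fix V and e :: real assume V: "open V" "V \<subseteq> S" and e: "e > 0"
    obtain K L where K: "compact K" "K \<subseteq> V" "measure M (V - K) < e / 2"
      and L: "compact L" "L \<subseteq> V" "measure N (V - L) < e / 2"
      using fin_regular_inner_open[OF M S V half_gt_zero[OF e]] fin_regular_inner_open[OF N S V half_gt_zero[OF e]]
      by metis
    have "measure M (V - (K \<union> L)) \<le> measure M (V - K)" "measure N (V - (K \<union> L)) \<le> measure N (V - L)"
      using K V L S
      by (auto intro!: M.finite_measure_mono N.finite_measure_mono simp: borel_on_iff compact_imp_closed)
    then show "\<exists>K. compact K \<and> K \<subseteq> V \<and> measure (setfun_measure S ?m) (V - K) < e"
      using K L by (intro exI[of _ "K \<union> L"]) (auto simp: P)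
  qed
qed

lemma fin_regular_scale:
  fixes S :: "'a::t2_space set"
  assumes S: "open S" and M: "fin_regular S M" and c: "0 \<le> c"
  obtains P where "fin_regular S P" "\<And>A. measure P A = c * measure M A"
proof
  interpret M: finite_measure M by (rule fin_regular_finite[OF M])
  let ?P = "scale_measure (ennreal c) M"
  show P: "measure ?P A = c * measure M A" for A
    using c by simp
  have "finite_measure ?P"
    by (rule finite_measureI) (simp add: space_scale_measure ennreal_mult_eq_top_iff)
  then show "fin_regular S ?P"
    by (intro fin_regular_dominated[OF S _ _ M, of _ c]) (simp_all add: fin_regular_sets[OF M] c)
qed

lemma fin_regular_null:
  fixes S :: "'a::t2_space set"
  assumes S: "open S"
  shows "fin_regular S (null_measure (restrict_space borel S))"
  by (rule rfmI[OF S]) (use S in \<open>auto simp: borel_on_iff intro!: finite_measureI\<close>)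

text \<open>The generators are closed under sums and nonnegative multiples, so their differences
  already form a subspace; a negative scalar exchanges the two measures.\<close>

lemma signed_regular_measures_eq:
  fixes S :: "'a::t2_space set"
  assumes S: "open S"
  shows "signed_regular_measures S = {measure M - measure N | M N. fin_regular S M \<and> fin_regular S N}"
    (is "_ = ?D")
proof
  have gen: "\<mu> \<in> ?D"
    if "fin_regular S M" "\<mu> = measure M" for \<mu> M
  proof -
    have "\<mu> = measure M - measure (null_measure (restrict_space borel S))"
      using that by (simp add: fun_eq_iff)
    then show ?thesis using that fin_regular_null[OF S] by blast
  qed
  have sub: "subspace ?D"
    unfolding subspace_def
  proof (intro conjI ballI allI)
    show "0 \<in> ?D"
      by (rule gen[OF fin_regular_null[OF S]]) (simp add: fun_eq_iff)
  next
    fix x y assume "x \<in> ?D" "y \<in> ?D"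
    then obtain M N M' N' where 1: "fin_regular S M" "fin_regular S N" "x = measure M - measure N"
      and 2: "fin_regular S M'" "fin_regular S N'" "y = measure M' - measure N'" by blast
    obtain P where P: "fin_regular S P" "\<And>A. measure P A = measure M A + measure M' A"
      by (rule fin_regular_sum[OF S 1(1) 2(1)]) blast
    obtain Q where Q: "fin_regular S Q" "\<And>A. measure Q A = measure N A + measure N' A"
      by (rule fin_regular_sum[OF S 1(2) 2(2)]) blast
    have "x + y = measure P - measure Q" by (auto simp: fun_eq_iff 1 2 P Q)
    then show "x + y \<in> ?D" using P Q by blast
  next
    fix x and c :: real assume "x \<in> ?D"
    then obtain M N where 1: "fin_regular S M" "fin_regular S N" "x = measure M - measure N" by blast
    obtain P where P: "fin_regular S P" "\<And>A. measure P A = \<bar>c\<bar> * measure M A"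
      by (rule fin_regular_scale[OF S 1(1) abs_ge_zero]) blast
    obtain Q where Q: "fin_regular S Q" "\<And>A. measure Q A = \<bar>c\<bar> * measure N A"
      by (rule fin_regular_scale[OF S 1(2) abs_ge_zero]) blast
    have "c *\<^sub>R x = (if c \<ge> 0 then measure P - measure Q else measure Q - measure P)"
      by (auto simp: fun_eq_iff 1 P Q scaleR_fun_def algebra_simps)
    then show "c *\<^sub>R x \<in> ?D" using P Q by auto
  qed
  show "signed_regular_measures S \<subseteq> ?D"
    unfolding signed_regular_measures_def
    using gen by (intro span_minimal sub) (auto simp: fin_regular_def)
  show "?D \<subseteq> signed_regular_measures S"
  proof clarify
    fix M N :: "'a measure" assume "fin_regular S M" "fin_regular S N"
    then show "measure M - measure N \<in> signed_regular_measures S"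
      unfolding signed_regular_measures_def by (intro span_diff span_base) (auto simp: fin_regular_def)
  qed
qed


section \<open>Hahn and Jordan decomposition of a signed regular measure\<close>

locale signed_regular =
  fixes S :: "'a::t2_space set" and \<mu> :: "'a set \<Rightarrow> real"
  assumes open_S: "open S" and signed: "\<mu> \<in> signed_regular_measures S"
begin

abbreviation "mpos \<equiv> measure (jordan_pos S \<mu>)"
abbreviation "mneg \<equiv> measure (jordan_neg S \<mu>)"

lemma borel_on_simps:
  "A \<in> borel_on S \<Longrightarrow> B \<in> borel_on S \<Longrightarrow> A - B \<in> borel_on S"
  "A \<in> borel_on S \<Longrightarrow> B \<in> borel_on S \<Longrightarrow> A \<inter> B \<in> borel_on S"
  by auto

lemma zero_off: "A \<notin> borel_on S \<Longrightarrow> \<mu> A = 0"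
  using signed unfolding signed_regular_measures_eq[OF open_S]
  by (auto simp: measure_notin_sets fin_regular_sets)

lemma additive:
  assumes "A \<in> borel_on S" "B \<in> borel_on S" "A \<inter> B = {}"
  shows "\<mu> (A \<union> B) = \<mu> A + \<mu> B"
proof -
  obtain M N where MN: "fin_regular S M" "fin_regular S N" "\<mu> = measure M - measure N"
    using signed unfolding signed_regular_measures_eq[OF open_S] by auto
  then show ?thesis
    using assms by (simp add: finite_measure.finite_measure_Union fin_regular_finite fin_regular_sets)
qed

lemma empty: "\<mu> {} = 0"
  using additive[of "{}" "{}"] by simp

lemma split:
  assumes "A \<in> borel_on S" "Y \<in> borel_on S" shows "\<mu> A = \<mu> (A \<inter> Y) + \<mu> (A - Y)"
  using additive[of "A \<inter> Y" "A - Y"] assms by (auto simp: Int_Diff_Un)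

lemma Hahn:
  obtains Y where "Y \<in> borel_on S"
    "\<And>A. A \<in> borel_on S \<Longrightarrow> A \<subseteq> Y \<Longrightarrow> 0 \<le> \<mu> A" "\<And>A. A \<in> borel_on S \<Longrightarrow> A \<inter> Y = {} \<Longrightarrow> \<mu> A \<le> 0"
proof -
  obtain M N where MN: "fin_regular S M" "fin_regular S N" "\<mu> = measure M - measure N"
    using signed unfolding signed_regular_measures_eq[OF open_S] by auto
  interpret M: finite_measure M by (rule fin_regular_finite[OF MN(1)])
  interpret N: finite_measure N by (rule fin_regular_finite[OF MN(2)])
  obtain Y where Y: "Y \<in> sets M" "\<forall>X\<in>sets M. X \<subseteq> Y \<longrightarrow> emeasure N X \<le> emeasure M X"
    "\<forall>X\<in>sets M. X \<inter> Y = {} \<longrightarrow> emeasure M X \<le> emeasure N X"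
    using finite_unsigned_Hahn_decomposition[OF fin_regular_finite[OF MN(1)] fin_regular_finite[OF MN(2)]]
    by (auto simp: fin_regular_sets[OF MN(1)] fin_regular_sets[OF MN(2)])
  show thesis
    by (rule that[of Y])
      (use Y in \<open>auto simp: MN fin_regular_sets[OF MN(1)] M.emeasure_eq_measure N.emeasure_eq_measure\<close>)
qed

text \<open>The Jordan parts are defined by the total variation, which is evaluated by means of a
  Hahn set \<open>Y\<close>; hence all facts come out together. The supremum over partitions of
  \<open>A\<close> is attained by \<open>A \<inter> Y\<close> and \<open>A - Y\<close>: for any
  \<open>E\<close> one has \<open>\<bar>\<mu> E\<bar> \<le> v E\<close>, and \<open>v\<close> is
  additive.\<close>

lemma parts_aux:
  obtains Y where "Y \<in> borel_on S" "fin_regular S (jordan_pos S \<mu>)" "fin_regular S (jordan_neg S \<mu>)"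
    "\<And>A. A \<in> borel_on S \<Longrightarrow> mpos A = \<mu> (A \<inter> Y)"
    "\<And>A. A \<in> borel_on S \<Longrightarrow> mneg A = - \<mu> (A - Y)"
    "\<And>A. A \<in> borel_on S \<Longrightarrow> total_variation S \<mu> A = \<mu> (A \<inter> Y) - \<mu> (A - Y)"
proof -
  obtain Y where Y: "Y \<in> borel_on S"
    "\<And>A. A \<in> borel_on S \<Longrightarrow> A \<subseteq> Y \<Longrightarrow> 0 \<le> \<mu> A" "\<And>A. A \<in> borel_on S \<Longrightarrow> A \<inter> Y = {} \<Longrightarrow> \<mu> A \<le> 0"
    by (rule Hahn) blast
  define v where "v A = \<mu> (A \<inter> Y) - \<mu> (A - Y)" for A
  have v_add: "v (A \<union> B) = v A + v B"
    if "A \<in> borel_on S" "B \<in> borel_on S" "A \<inter> B = {}" for A B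
  proof -
    have "\<mu> ((A \<union> B) \<inter> Y) = \<mu> (A \<inter> Y) + \<mu> (B \<inter> Y)"
      unfolding Int_Un_distrib2 using that Y(1) by (intro additive) auto
    moreover have "\<mu> ((A \<union> B) - Y) = \<mu> (A - Y) + \<mu> (B - Y)"
      unfolding Un_Diff using that Y(1) by (intro additive) auto
    ultimately show ?thesis by (simp add: v_def)
  qed
  have abs_v: "\<bar>\<mu> E\<bar> \<le> v E" if "E \<in> borel_on S" for E
  proof -
    have "\<mu> (E \<inter> Y) \<ge> 0" "\<mu> (E - Y) \<le> 0" using that Y(1) by (auto intro!: Y(2,3))
    then show ?thesis unfolding v_def split[OF that Y(1)] by linarith
  qed
  have v_sum: "(\<Sum>E\<in>P. v E) = v (\<Union>P)" if "finite P" "P \<subseteq> borel_on S" "disjoint P" for P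
    using that
  proof (induction P)
    case empty
    then show ?case by (simp add: v_def)
  next
    case (insert E P)
    have "v (E \<union> \<Union>P) = v E + v (\<Union>P)"
      using insert by (intro v_add sets.finite_Union) (auto simp: disjoint_def)
    then show ?case using insert by (simp add: pairwise_insert disjoint_def)
  qed
  have tv: "total_variation S \<mu> A = v A" if A: "A \<in> borel_on S" for A
    unfolding total_variation_def
  proof (rule cSup_eq_maximum)
    have AY: "A \<inter> Y \<in> borel_on S" "A - Y \<in> borel_on S" using A Y(1) by auto
    \<comment> \<open>Blocks of a partition are nonempty, so empty pieces are removed; they
      contribute 0 to the sum.\<close>
    define P where "P = {A \<inter> Y, A - Y} - {{}}"
    have "partition_on A P"
      by (auto simp: P_def partition_on_def disjoint_def)
    moreover have "(\<Sum>E\<in>P. \<bar>\<mu> E\<bar>) = v A"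
    proof -
      have "(\<Sum>E\<in>P. \<bar>\<mu> E\<bar>) = (\<Sum>E\<in>{A \<inter> Y, A - Y}. \<bar>\<mu> E\<bar>)"
        unfolding P_def by (rule sum.mono_neutral_left) (auto simp: empty)
      also have "\<dots> = \<bar>\<mu> (A \<inter> Y)\<bar> + \<bar>\<mu> (A - Y)\<bar>"
      \<comment> \<open>The two-element set collapses when its disjoint members coincide, that is,
        only for empty \<open>A\<close>.\<close>
      proof (cases "A \<inter> Y = A - Y")
        case True
        then have "A = {}" by blast
        then show ?thesis by (simp add: empty)
      next
        case False
        then show ?thesis by (subst sum.insert) auto
      qed
      also have "\<dots> = v A"
      proof -
        have "\<mu> (A - Y) \<le> 0" by (rule Y(3)[OF AY(2)]) blast
        then show ?thesis using Y(2)[OF AY(1)] by (auto simp: v_def)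
      qed
      finally show ?thesis .
    qed
    ultimately show "v A \<in> {\<Sum>E\<in>P. \<bar>\<mu> E\<bar> |P. finite P \<and> P \<subseteq> borel_on S \<and> partition_on A P}"
      using AY by (intro CollectI exI[of _ P]) (auto simp: P_def)
  next
    fix x assume "x \<in> {\<Sum>E\<in>P. \<bar>\<mu> E\<bar> |P. finite P \<and> P \<subseteq> borel_on S \<and> partition_on A P}"
    then obtain P where P: "finite P" "P \<subseteq> borel_on S" "partition_on A P" "x = (\<Sum>E\<in>P. \<bar>\<mu> E\<bar>)"
      by blast
    have "x \<le> (\<Sum>E\<in>P. v E)" unfolding P(4) using P(2) abs_v by (intro sum_mono) auto
    then show "x \<le> v A" using v_sum[OF P(1,2)] P(3) by (auto simp: partition_on_def)
  qed
  obtain M N where MN: "fin_regular S M" "fin_regular S N" "\<mu> = measure M - measure N"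
    using signed unfolding signed_regular_measures_eq[OF open_S] by auto
  interpret M: finite_measure M by (rule fin_regular_finite[OF MN(1)])
  interpret N: finite_measure N by (rule fin_regular_finite[OF MN(2)])
  define p where "p A = (total_variation S \<mu> A + \<mu> A) / 2" for A
  define n where "n A = (total_variation S \<mu> A - \<mu> A) / 2" for A
  have p: "p A = \<mu> (A \<inter> Y)" and n: "n A = - \<mu> (A - Y)" if "A \<in> borel_on S" for A
    using split[OF that Y(1)] tv[OF that] by (simp_all add: p_def n_def v_def)
  have jp: "jordan_pos S \<mu> = setfun_measure S p" "jordan_neg S \<mu> = setfun_measure S n"
    by (simp_all add: jordan_pos_def jordan_neg_def setfun_measure_def p_def n_def)
  have pn_nonneg: "0 \<le> p A" "0 \<le> n A" if "A \<in> borel_on S" for A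
    using that Y(1) by (auto simp: p n intro!: Y(2,3))
  have pn_add: "p (A \<union> B) = p A + p B" "n (A \<union> B) = n A + n B"
    if "A \<in> borel_on S" "B \<in> borel_on S" "A \<inter> B = {}" for A B
    using v_add[OF that] additive[OF that] tv that by (auto simp: p_def n_def field_simps)
  \<comment> \<open>On \<open>A \<inter> Y\<close> the measure \<open>\<mu>\<close> is
    \<open>M\<close> minus \<open>N\<close>; dropping \<open>N\<close> leaves the domination by
    \<open>M\<close> from which regularity follows.\<close>
  have p_le: "p A \<le> measure M A" if "A \<in> borel_on S" for A
  proof -
    have "p A \<le> measure M (A \<inter> Y)" using that by (simp add: p MN)
    also have "\<dots> \<le> measure M A"
      using that Y(1) by (intro M.finite_measure_mono) (auto simp: fin_regular_sets[OF MN(1)])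
    finally show ?thesis .
  qed
  have n_le: "n A \<le> measure N A" if "A \<in> borel_on S" for A
  proof -
    have "n A \<le> measure N (A - Y)" using that by (simp add: n MN)
    also have "\<dots> \<le> measure N A"
      using that Y(1) by (intro N.finite_measure_mono) (auto simp: fin_regular_sets[OF MN(2)])
    finally show ?thesis .
  qed
  have P: "fin_regular S (setfun_measure S p)"
    "\<And>A. A \<in> borel_on S \<Longrightarrow> measure (setfun_measure S p) A = p A"
    using fin_regular_dominated_setfun[OF open_S MN(1), of p] pn_nonneg(1) pn_add(1) p_le by blast+
  have N: "fin_regular S (setfun_measure S n)"
    "\<And>A. A \<in> borel_on S \<Longrightarrow> measure (setfun_measure S n) A = n A"
    using fin_regular_dominated_setfun[OF open_S MN(2), of n] pn_nonneg(2) pn_add(2) n_le by blast+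
  show thesis
  proof (rule that[OF Y(1)])
    show "fin_regular S (jordan_pos S \<mu>)" "fin_regular S (jordan_neg S \<mu>)"
      unfolding jp by (rule P(1) N(1))+
    fix A assume A: "A \<in> borel_on S"
    show "mpos A = \<mu> (A \<inter> Y)" "mneg A = - \<mu> (A - Y)"
      unfolding jp by (simp_all only: P(2)[OF A] N(2)[OF A] p[OF A] n[OF A])
    show "total_variation S \<mu> A = \<mu> (A \<inter> Y) - \<mu> (A - Y)"
      using tv[OF A] by (simp add: v_def)
  qed
qed

lemma fin_regular_pos: "fin_regular S (jordan_pos S \<mu>)" and fin_regular_neg: "fin_regular S (jordan_neg S \<mu>)"
  by (rule parts_aux; blast)+

lemma Hahn_parts:
  obtains Y where "Y \<in> borel_on S" "mpos (S - Y) = 0" "mneg Y = 0"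
    "\<And>A. A \<in> borel_on S \<Longrightarrow> mpos A = \<mu> (A \<inter> Y)" "\<And>A. A \<in> borel_on S \<Longrightarrow> mneg A = - \<mu> (A - Y)"
proof (rule parts_aux)
  fix Y assume Y: "Y \<in> borel_on S"
    "\<And>A. A \<in> borel_on S \<Longrightarrow> mpos A = \<mu> (A \<inter> Y)"
    "\<And>A. A \<in> borel_on S \<Longrightarrow> mneg A = - \<mu> (A - Y)"
  have "(S - Y) \<inter> Y = {}" by blast
  then show thesis
    by (intro that[OF Y(1)]) (use Y borel_on_simps(1)[OF borel_on_top Y(1)] in \<open>auto simp: empty\<close>)
qed

lemma Jordan: "\<mu> = mpos - mneg"
proof (rule ext)
  fix A
  obtain Y where Y: "Y \<in> borel_on S" "\<And>A. A \<in> borel_on S \<Longrightarrow> mpos A = \<mu> (A \<inter> Y)"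
    "\<And>A. A \<in> borel_on S \<Longrightarrow> mneg A = - \<mu> (A - Y)"
    by (rule Hahn_parts) blast
  show "\<mu> A = (mpos - mneg) A"
    using Y(2,3)[of A] split[OF _ Y(1), of A]
    by (cases "A \<in> borel_on S")
      (auto simp: zero_off measure_notin_sets fin_regular_sets[OF fin_regular_pos] fin_regular_sets[OF fin_regular_neg])
qed

lemma total_variation: "A \<in> borel_on S \<Longrightarrow> total_variation S \<mu> A = mpos A + mneg A"
  by (rule parts_aux) simp

text \<open>The minimality of the positive part: it is concentrated on the Hahn set, where it
  coincides with \<open>\<mu>\<close>. This is used to compare positive parts of different
  measures.\<close>

lemma mpos_least:
  assumes "A \<in> borel_on S" and N: "sets N = borel_on S" "finite_measure N"
    and le: "\<And>A. A \<in> borel_on S \<Longrightarrow> \<mu> A \<le> measure N A"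
  shows "mpos A \<le> measure N A"
proof -
  interpret finite_measure N by fact
  obtain Y where Y: "Y \<in> borel_on S" "\<And>A. A \<in> borel_on S \<Longrightarrow> mpos A = \<mu> (A \<inter> Y)"
    by (rule Hahn_parts) blast
  have "mpos A \<le> measure N (A \<inter> Y)" using Y assms by auto
  also have "\<dots> \<le> measure N A" using Y assms by (intro finite_measure_mono) auto
  finally show ?thesis .
qed

end

subsection \<open>Integration and approximation by compactly supported functions\<close>

definition bounded_borel :: "('a::topological_space \<Rightarrow> real) \<Rightarrow> bool"
  where "bounded_borel f \<longleftrightarrow> f \<in> borel_measurable borel \<and> bounded (range f)"

lemma bounded_borelE:
  assumes "bounded_borel f"
  obtains C where "C \<ge> 0" "\<And>x. \<bar>f x\<bar> \<le> C"
  using assms unfolding bounded_borel_def bounded_iff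
  by (metis abs_ge_zero order_trans rangeI real_norm_def)

lemma bounded_borelI:
  "f \<in> borel_measurable borel \<Longrightarrow> (\<And>x. \<bar>f x\<bar> \<le> C) \<Longrightarrow> bounded_borel f"
  by (auto simp: bounded_borel_def bounded_iff)

lemma bounded_borel_measurable: "bounded_borel f \<Longrightarrow> f \<in> borel_measurable borel"
  by (simp add: bounded_borel_def)

lemma bounded_borel_add:
  assumes "bounded_borel f" "bounded_borel g" shows "bounded_borel (\<lambda>x. f x + g x)"
proof -
  obtain C where C: "\<And>x. \<bar>f x\<bar> \<le> C" using bounded_borelE[OF assms(1)] by blast
  obtain D where D: "\<And>x. \<bar>g x\<bar> \<le> D" using bounded_borelE[OF assms(2)] by blast
  show ?thesis
    using assms[THEN bounded_borel_measurable] C D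
    by (intro bounded_borelI[of _ "C + D"]) (auto intro: abs_triangle_ineq[THEN order_trans] add_mono)
qed

lemma bounded_borel_mult:
  assumes "bounded_borel f" "bounded_borel g" shows "bounded_borel (\<lambda>x. f x * g x)"
proof -
  obtain C where C: "C \<ge> 0" "\<And>x. \<bar>f x\<bar> \<le> C" using bounded_borelE[OF assms(1)] by blast
  obtain D where D: "\<And>x. \<bar>g x\<bar> \<le> D" using bounded_borelE[OF assms(2)] by blast
  show ?thesis
    using assms[THEN bounded_borel_measurable] C D
    by (intro bounded_borelI[of _ "C * D"]) (auto intro: mult_mono simp: abs_mult)
qed

lemma bounded_borel_const: "bounded_borel (\<lambda>x. c)"
  by (rule bounded_borelI[of _ "\<bar>c\<bar>"]) auto

lemma bounded_borel_indicator: "A \<in> sets borel \<Longrightarrow> bounded_borel (indicator A)"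
  by (rule bounded_borelI[of _ 1]) (auto split: split_indicator)

lemma bounded_borel_max:
  assumes "bounded_borel f" shows "bounded_borel (\<lambda>x. max 0 (f x))"
proof -
  obtain C where "C \<ge> 0" "\<And>x. \<bar>f x\<bar> \<le> C" using bounded_borelE[OF assms] by blast
  then show ?thesis
    using bounded_borel_measurable[OF assms] by (intro bounded_borelI[of _ C]) (auto simp: abs_le_iff)
qed

lemma bounded_borel_scale: "bounded_borel f \<Longrightarrow> bounded_borel (\<lambda>x. c * f x)"
  using bounded_borel_mult[OF bounded_borel_const] by blast

lemma bounded_borel_diff: "bounded_borel f \<Longrightarrow> bounded_borel g \<Longrightarrow> bounded_borel (\<lambda>x. f x - g x)"
  using bounded_borel_add[of f "\<lambda>x. -1 * g x"] bounded_borel_scale[of g "-1"] by simp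

lemma bounded_borel_abs:
  assumes "bounded_borel f" shows "bounded_borel (\<lambda>x. \<bar>f x\<bar>)"
proof -
  obtain C where "C \<ge> 0" "\<And>x. \<bar>f x\<bar> \<le> C" using bounded_borelE[OF assms] by blast
  then show ?thesis
    using bounded_borel_measurable[OF assms] by (intro bounded_borelI[of _ C]) auto
qed

lemmas bounded_borel_intros = bounded_borel_add bounded_borel_mult bounded_borel_const
  bounded_borel_max bounded_borel_scale bounded_borel_diff bounded_borel_abs

lemma fin_regular_measurable:
  assumes M: "fin_regular S M" and f: "f \<in> borel_measurable borel"
  shows "f \<in> borel_measurable M"
  using measurable_restrict_space1[OF f, of S] measurable_cong_sets[OF fin_regular_sets[OF M] refl] by blast

lemma fin_regular_integrable:
  assumes M: "fin_regular S M" and f: "bounded_borel f"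
  shows "integrable M f"
proof -
  interpret finite_measure M by (rule fin_regular_finite[OF M])
  obtain C where "\<And>x. \<bar>f x\<bar> \<le> C" using bounded_borelE[OF f] by blast
  then show ?thesis
    by (intro integrable_const_bound[of _ C]) (auto intro: fin_regular_measurable[OF M] bounded_borel_measurable[OF f])
qed

text \<open>The hypothesis is the case of indicator functions; multiples, sums and increasing limits
  preserve the identity.\<close>

lemma nn_integral_sum_measure:
  assumes [measurable_cong]: "sets M = sets P" "sets N = sets P"
    and eq: "\<And>A. A \<in> sets P \<Longrightarrow> emeasure P A = emeasure M A + emeasure N A"
    and f: "f \<in> borel_measurable P"
  shows "(\<integral>\<^sup>+ x. f x \<partial>P) = (\<integral>\<^sup>+ x. f x \<partial>M) + (\<integral>\<^sup>+ x. f x \<partial>N)"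
  using f
proof (induction f rule: borel_measurable_induct)
  case (cong f g)
  have "space M = space P" "space N = space P" using assms(1,2) sets_eq_imp_space_eq by blast+
  then have "integral\<^sup>N P g = integral\<^sup>N P f" "integral\<^sup>N M g = integral\<^sup>N M f"
    "integral\<^sup>N N g = integral\<^sup>N N f"
    using cong(3) by (auto intro!: nn_integral_cong)
  then show ?case using cong.IH by simp
next
  case (set A)
  then show ?case using eq[of A] assms(1,2) by (simp add: nn_integral_indicator)
next
  case (mult u c)
  from mult(2)[measurable] show ?case
    using mult by (simp add: nn_integral_cmult distrib_left)
next
  case (add u v)
  from add(1,4)[measurable] show ?case
    using add by (simp add: nn_integral_add ac_simps)
next
  case (seq U)
  note [measurable] = seq(1)
  have U: "Sup (range U) = (\<lambda>x. SUP i. U i x)" by (auto simp: fun_eq_iff image_comp)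
  have "(SUP i. integral\<^sup>N P (U i)) = (SUP i. integral\<^sup>N M (U i) + integral\<^sup>N N (U i))"
    using seq by simp
  also have "\<dots> = (SUP i. integral\<^sup>N M (U i)) + (SUP i. integral\<^sup>N N (U i))"
    using seq(3) by (intro ennreal_SUP_add) (auto simp: mono_def le_fun_def intro!: nn_integral_mono)
  finally show ?case
    using seq(3) by (simp add: U nn_integral_monotone_convergence_SUP)
qed

lemma integral_sum_measure:
  assumes M: "fin_regular S M" and N: "fin_regular S N" and P: "fin_regular S P"
    and eq: "\<And>A. A \<in> borel_on S \<Longrightarrow> measure P A = measure M A + measure N A"
    and f: "bounded_borel f"
  shows "(LINT x|P. f x) = (LINT x|M. f x) + (LINT x|N. f x)"
proof -
  interpret M: finite_measure M by (rule fin_regular_finite[OF M])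
  interpret N: finite_measure N by (rule fin_regular_finite[OF N])
  interpret P: finite_measure P by (rule fin_regular_finite[OF P])
  note [simp] = fin_regular_sets[OF M] fin_regular_sets[OF N] fin_regular_sets[OF P]
  note sp = fin_regular_space[OF M] fin_regular_space[OF N] fin_regular_space[OF P]
  obtain C where C: "C \<ge> 0" "\<And>x. \<bar>f x\<bar> \<le> C" using bounded_borelE[OF f] by blast
  \<comment> \<open>The shift by a bound makes the function nonnegative. It contributes
    \<open>C\<close> times the total mass to each integral, and the total mass is additive as
    well.\<close>
  define g where "g x = f x + C" for x
  have g: "bounded_borel g" unfolding g_def by (intro bounded_borel_intros f)
  have g0: "g x \<ge> 0" for x using C(2)[of x] by (simp add: g_def)
  have nn: "(\<integral>\<^sup>+ x. ennreal (g x) \<partial>Q) = ennreal (LINT x|Q. g x)" if "fin_regular S Q" for Q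
    using fin_regular_integrable[OF that g] g0 by (intro nn_integral_eq_integral) auto
  have "(\<integral>\<^sup>+ x. ennreal (g x) \<partial>P) = (\<integral>\<^sup>+ x. ennreal (g x) \<partial>M) + (\<integral>\<^sup>+ x. ennreal (g x) \<partial>N)"
    using fin_regular_measurable[OF P bounded_borel_measurable[OF g]]
    by (intro nn_integral_sum_measure)
      (auto simp: M.emeasure_eq_measure N.emeasure_eq_measure P.emeasure_eq_measure eq)
  then have "ennreal (LINT x|P. g x) = ennreal ((LINT x|M. g x) + (LINT x|N. g x))"
    using g0 by (simp add: nn M N P)
  then have "(LINT x|P. g x) = (LINT x|M. g x) + (LINT x|N. g x)"
    using g0 by (subst (asm) ennreal_inj) (auto intro!: integral_nonneg_AE add_nonneg_nonneg)
  moreover have "(LINT x|Q. g x) = (LINT x|Q. f x) + C * measure Q S" if "fin_regular S Q" for Q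
    using fin_regular_integrable[OF that f] fin_regular_space[OF that] fin_regular_finite[OF that] unfolding g_def
    by (simp add: finite_measure.integrable_const)
  ultimately show ?thesis
    using eq[OF borel_on_top] by (simp add: M N P algebra_simps)
qed

lemma signed_regularI:
  fixes S :: "'a::t2_space set"
  assumes "open S" "fin_regular S M" "fin_regular S N" shows "measure M - measure N \<in> signed_regular_measures S"
  using assms by (auto simp: signed_regular_measures_eq)

text \<open>Since \<open>M - N\<close> and \<open>mpos - mneg\<close> are the same set function,
  \<open>M + mneg\<close> and \<open>mpos + N\<close> are the same measure. Integrating this common
  measure \<open>P\<close> in both ways shows that the decomposition does not matter.\<close>

lemma signed_integral_eq:
  fixes S :: "'a::t2_space set"
  assumes S: "open S" and M: "fin_regular S M" and N: "fin_regular S N" and \<mu>: "\<mu> = measure M - measure N"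
    and f: "bounded_borel f"
  shows "signed_integral S \<mu> f = (LINT x|M. f x) - (LINT x|N. f x)"
proof -
  interpret signed_regular S \<mu>
    using signed_regularI[OF S M N] by unfold_locales (simp_all add: S \<mu>)
  obtain P where P: "fin_regular S P" "\<And>A. measure P A = measure M A + mneg A"
    by (rule fin_regular_sum[OF S M fin_regular_neg]) blast
  have eq: "measure P A = mpos A + measure N A" for A
    using fun_cong[OF Jordan, of A] P(2)[of A] by (simp add: \<mu>)
  show ?thesis
    using integral_sum_measure[OF M fin_regular_neg P(1) P(2) f]
      integral_sum_measure[OF fin_regular_pos N P(1) eq f]
    by (simp add: signed_integral_def)
qed

lemma subspace_signed_regular: "subspace (signed_regular_measures S)"
  by (simp add: signed_regular_measures_def)

text \<open>The sums of the Jordan parts are in general not the Jordan parts of the sum, but they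
  represent it, and this suffices by \<open>signed_integral_eq\<close>.\<close>

lemma signed_integral_add_measure:
  fixes S :: "'a::t2_space set"
  assumes S: "open S" and \<mu>: "\<mu> \<in> signed_regular_measures S" and \<nu>: "\<nu> \<in> signed_regular_measures S"
    and f: "bounded_borel f"
  shows "signed_integral S (\<mu> + \<nu>) f = signed_integral S \<mu> f + signed_integral S \<nu> f"
proof -
  interpret \<mu>: signed_regular S \<mu> by unfold_locales fact+
  interpret \<nu>: signed_regular S \<nu> by unfold_locales fact+
  obtain P where P: "fin_regular S P" "\<And>A. measure P A = \<mu>.mpos A + \<nu>.mpos A"
    by (rule fin_regular_sum[OF S \<mu>.fin_regular_pos \<nu>.fin_regular_pos]) blast
  obtain N where N: "fin_regular S N" "\<And>A. measure N A = \<mu>.mneg A + \<nu>.mneg A"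
    by (rule fin_regular_sum[OF S \<mu>.fin_regular_neg \<nu>.fin_regular_neg]) blast
  have "\<mu> + \<nu> = measure P - measure N"
    using fun_cong[OF \<mu>.Jordan] fun_cong[OF \<nu>.Jordan] P N by (auto simp: fun_eq_iff)
  from signed_integral_eq[OF S P(1) N(1) this f] show ?thesis
    using integral_sum_measure[OF \<mu>.fin_regular_pos \<nu>.fin_regular_pos P f]
      integral_sum_measure[OF \<mu>.fin_regular_neg \<nu>.fin_regular_neg N f]
    by (simp add: signed_integral_def)
qed

lemma signed_integral_add:
  fixes S :: "'a::t2_space set"
  assumes S: "open S" and \<mu>: "\<mu> \<in> signed_regular_measures S"
    and f: "bounded_borel f" "bounded_borel g"
  shows "signed_integral S \<mu> (\<lambda>x. f x + g x) = signed_integral S \<mu> f + signed_integral S \<mu> g"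
proof -
  interpret \<mu>: signed_regular S \<mu> by unfold_locales fact+
  show ?thesis
    using fin_regular_integrable[OF \<mu>.fin_regular_pos] fin_regular_integrable[OF \<mu>.fin_regular_neg] f
    by (simp add: signed_integral_def)
qed

lemma signed_integral_scale: "signed_integral S \<mu> (\<lambda>x. c * f x) = c * signed_integral S \<mu> f"
  by (simp add: signed_integral_def right_diff_distrib)

lemma signed_integral_minus_measure:
  fixes S :: "'a::t2_space set"
  assumes S: "open S" and \<mu>: "\<mu> \<in> signed_regular_measures S" and f: "bounded_borel f"
  shows "signed_integral S (- \<mu>) f = - signed_integral S \<mu> f"
proof -
  have "- \<mu> \<in> signed_regular_measures S" by (rule subspace_neg[OF subspace_signed_regular \<mu>])
  from signed_integral_add_measure[OF S \<mu> this f]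
  have "signed_integral S 0 f = signed_integral S \<mu> f + signed_integral S (- \<mu>) f" by simp
  moreover have "signed_integral S 0 f = 0"
    using signed_integral_eq[OF S fin_regular_null[OF S] fin_regular_null[OF S] _ f, of 0] by (simp add: zero_fun_def fun_eq_iff)
  ultimately show ?thesis by simp
qed

lemma signed_integral_scale_measure:
  fixes S :: "'a::t2_space set"
  assumes S: "open S" and \<mu>: "\<mu> \<in> signed_regular_measures S" and f: "bounded_borel f"
  shows "signed_integral S (c *\<^sub>R \<mu>) f = c * signed_integral S \<mu> f"
proof -
  have pos: "signed_integral S (c *\<^sub>R \<mu>) f = c * signed_integral S \<mu> f"
    if c: "c \<ge> 0" and \<mu>: "\<mu> \<in> signed_regular_measures S" for c \<mu>
  proof -
    interpret \<mu>: signed_regular S \<mu> by unfold_locales fact+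
    have fin: "finite_measure (scale_measure (ennreal c) M)" if "fin_regular S M" for M
      using fin_regular_finite[OF that]
      by (intro finite_measureI) (simp add: space_scale_measure ennreal_mult_eq_top_iff finite_measure.emeasure_finite)
    have r: "fin_regular S (scale_measure (ennreal c) M)" if "fin_regular S M" for M
      by (rule fin_regular_dominated[OF S _ fin[OF that] that, of c]) (simp_all add: fin_regular_sets[OF that] c)
    have i: "(LINT x|scale_measure (ennreal c) M. f x) = c * (LINT x|M. f x)" if "fin_regular S M" for M
    proof -
      have "scale_measure (ennreal c) M = density M (\<lambda>_. ennreal c)"
        by (rule measure_eqI) (simp_all add: emeasure_density_const)
      then show ?thesis
        using c integral_density[OF fin_regular_measurable[OF that bounded_borel_measurable[OF f]], of "\<lambda>_. c"]
        by simp
    qed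
    have "c *\<^sub>R \<mu> = measure (scale_measure (ennreal c) (jordan_pos S \<mu>)) - measure (scale_measure (ennreal c) (jordan_neg S \<mu>))"
      using fun_cong[OF \<mu>.Jordan] c by (auto simp: fun_eq_iff scaleR_fun_def right_diff_distrib)
    from signed_integral_eq[OF S r[OF \<mu>.fin_regular_pos] r[OF \<mu>.fin_regular_neg] this f]
    show ?thesis by (simp add: i \<mu>.fin_regular_pos \<mu>.fin_regular_neg signed_integral_def right_diff_distrib)
  qed
  show ?thesis
  proof (cases "c \<ge> 0")
    case False
    then have "signed_integral S ((- c) *\<^sub>R - \<mu>) f = (- c) * signed_integral S (- \<mu>) f"
      by (intro pos subspace_neg[OF subspace_signed_regular] \<mu>) auto
    then show ?thesis using signed_integral_minus_measure[OF S \<mu> f] by simp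
  qed (simp add: pos \<mu>)
qed


context signed_regular
begin

lemma abs_signed_integral_le:
  assumes f: "bounded_borel f"
  shows "\<bar>signed_integral S \<mu> f\<bar> \<le> (LINT x|jordan_pos S \<mu>. \<bar>f x\<bar>) + (LINT x|jordan_neg S \<mu>. \<bar>f x\<bar>)"
  using integral_abs_bound[of "jordan_pos S \<mu>" f] integral_abs_bound[of "jordan_neg S \<mu>" f]
  unfolding signed_integral_def by linarith

lemma signed_integral_indicator:
  assumes A: "A \<in> borel_on S" shows "signed_integral S \<mu> (indicator A) = \<mu> A"
proof -
  have "A \<subseteq> S" using A open_S by (simp add: borel_on_iff)
  then show ?thesis
    using fun_cong[OF Jordan, of A]
    by (simp add: signed_integral_def fin_regular_space[OF fin_regular_pos] fin_regular_space[OF fin_regular_neg] Int_absorb2)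
qed

end

section \<open>Continuous functions with compact support and approximation in the mean\<close>

lemma fsupp_superset: "{x. f x \<noteq> 0} \<subseteq> fsupp f"
  by (simp add: fsupp_def closure_subset)

lemma fsupp_subset: "closed K \<Longrightarrow> {x. f x \<noteq> 0} \<subseteq> K \<Longrightarrow> fsupp f \<subseteq> K"
  unfolding fsupp_def by (rule closure_minimal)

lemma Cc_I:
  fixes f :: "'a::t2_space \<Rightarrow> real"
  assumes "continuous_on UNIV f" "compact K" "\<And>x. x \<notin> K \<Longrightarrow> f x = 0"
  shows "f \<in> Cc"
proof -
  have "fsupp f \<subseteq> K" using assms by (intro fsupp_subset compact_imp_closed) auto
  then have "compact (fsupp f)"
    using compact_Int_closed[OF assms(2), of "fsupp f"] by (simp add: fsupp_def Int_absorb1)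
  then show ?thesis using assms(1) by (simp add: Cc_def)
qed

lemma Cc_continuous: "f \<in> Cc \<Longrightarrow> continuous_on UNIV f"
  and Cc_compact: "f \<in> Cc \<Longrightarrow> compact (fsupp f)"
  by (simp_all add: Cc_def)

lemma Cc_zero_off: "x \<notin> fsupp f \<Longrightarrow> f x = 0"
  using fsupp_superset[of f] by auto

text \<open>A function that vanishes at the common zeros of \<open>f\<close> and \<open>g\<close>
  vanishes off the compact set \<open>fsupp f \<union> fsupp g\<close>. All closure properties below
  are instances.\<close>

lemma Cc_I2:
  fixes f g h :: "'a::t2_space \<Rightarrow> real"
  assumes "f \<in> Cc" "g \<in> Cc" "continuous_on UNIV h" "\<And>x. f x = 0 \<Longrightarrow> g x = 0 \<Longrightarrow> h x = 0"
  shows "h \<in> Cc"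
  by (rule Cc_I[OF assms(3), of "fsupp f \<union> fsupp g"])
    (use assms in \<open>auto simp: Cc_compact Cc_zero_off\<close>)

lemma Cc_zero: "(\<lambda>x::'a::t2_space. 0) \<in> Cc"
  by (rule Cc_I[of _ "{}"]) auto

lemma Cc_add: "f \<in> Cc \<Longrightarrow> g \<in> Cc \<Longrightarrow> (\<lambda>x::'a::t2_space. f x + g x) \<in> Cc"
  by (rule Cc_I2[of f g]) (auto intro!: continuous_intros intro: Cc_continuous)

lemma Cc_diff: "f \<in> Cc \<Longrightarrow> g \<in> Cc \<Longrightarrow> (\<lambda>x::'a::t2_space. f x - g x) \<in> Cc"
  by (rule Cc_I2[of f g]) (auto intro!: continuous_intros intro: Cc_continuous)

lemma Cc_mult: "f \<in> Cc \<Longrightarrow> g \<in> Cc \<Longrightarrow> (\<lambda>x::'a::t2_space. f x * g x) \<in> Cc"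
  by (rule Cc_I2[of f g]) (auto intro!: continuous_intros intro: Cc_continuous)

lemma Cc_scale: "f \<in> Cc \<Longrightarrow> (\<lambda>x::'a::t2_space. c * f x) \<in> Cc"
  by (rule Cc_I2[of f f]) (auto intro!: continuous_intros intro: Cc_continuous)

lemma Cc_max: "f \<in> Cc \<Longrightarrow> g \<in> Cc \<Longrightarrow> (\<lambda>x::'a::t2_space. max (f x) (g x)) \<in> Cc"
  by (rule Cc_I2[of f g]) (auto intro!: continuous_intros intro: Cc_continuous)

lemma Cc_min: "f \<in> Cc \<Longrightarrow> g \<in> Cc \<Longrightarrow> (\<lambda>x::'a::t2_space. min (f x) (g x)) \<in> Cc"
  by (rule Cc_I2[of f g]) (auto intro!: continuous_intros intro: Cc_continuous)

lemma Cc_abs: "f \<in> Cc \<Longrightarrow> (\<lambda>x::'a::t2_space. \<bar>f x\<bar>) \<in> Cc"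
  by (rule Cc_I2[of f f]) (auto intro!: continuous_intros intro: Cc_continuous)

lemmas Cc_intros = Cc_zero Cc_add Cc_diff Cc_mult Cc_scale Cc_max Cc_min Cc_abs

lemma Cc_bounded_borel: assumes f: "f \<in> Cc" shows "bounded_borel f"
proof -
  have "compact (f ` fsupp f)"
    using f by (intro compact_continuous_image Cc_compact)
      (auto intro: continuous_on_subset Cc_continuous)
  then obtain C where C: "\<And>x. x \<in> fsupp f \<Longrightarrow> \<bar>f x\<bar> \<le> C"
    using compact_imp_bounded bounded_iff by (metis imageI real_norm_def)
  have "\<bar>f x\<bar> \<le> max C 0" for x
    using C[of x] Cc_zero_off[of x f] by (cases "x \<in> fsupp f") auto
  then show ?thesis
    using borel_measurable_continuous_onI[OF Cc_continuous[OF f]] by (rule bounded_borelI[rotated])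
qed

lemma Hausdorff_space_t2: "Hausdorff_space (euclidean :: 'a::t2_space topology)"
  unfolding Hausdorff_space_def disjnt_def by simp (metis hausdorff)

lemma Urysohn_Cc:
  assumes lc: "locally_compact_space (euclidean :: 'a::t2_space topology)"
    and K: "compact K" and V: "open V" and KV: "K \<subseteq> (V :: 'a set)"
  obtains u where "u \<in> Cc" "\<And>x. 0 \<le> u x" "\<And>x. u x \<le> 1" "\<And>x. x \<in> K \<Longrightarrow> u x = 1" "fsupp u \<subseteq> V"
proof -
  note H = Hausdorff_space_t2[where 'a='a]
  obtain U L where UL: "open U" "compact L" "K \<subseteq> U" "U \<subseteq> L"
    using lc[unfolded locally_compact_space_compact_closed_compact[OF disjI1[OF H]]] K
    by (auto simp: compactin_euclidean_iff)
  have "completely_regular_space (euclidean :: 'a topology)"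
    using locally_compact_regular_imp_completely_regular_space[OF lc] H by blast
  then obtain f :: "'a \<Rightarrow> real" where f: "continuous_map euclidean (top_of_set {0..1}) f"
    "f ` (- (V \<inter> U)) \<subseteq> {0}" "f ` K \<subseteq> {1}"
    using Urysohn_completely_regular_compact_closed[of 0 1 euclidean K "- (V \<inter> U)"] K KV UL V
    by (auto simp: disjnt_def compactin_euclidean_iff)
  have cont: "continuous_on UNIV f" and f01: "0 \<le> f x" "f x \<le> 1" for x
    using f(1) by (auto simp: continuous_map_in_subtopology image_subset_iff)
  \<comment> \<open>The support is a closure, so that of \<open>f\<close> might leave
    \<open>V \<inter> U\<close>. Cutting off at height 1/2 confines the support of \<open>u\<close>
    to the closed set \<open>F\<close> inside \<open>V \<inter> U\<close> and keeps the value 1 on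
    \<open>K\<close>.\<close>
  define u where "u x = max 0 (2 * f x - 1)" for x
  have cu: "continuous_on UNIV u" unfolding u_def by (intro continuous_intros cont)
  define F where "F = {x. 1 / 2 \<le> f x}"
  have F: "closed F" unfolding F_def by (intro closed_Collect_le continuous_intros cont)
  have FVU: "F \<subseteq> V \<inter> U" using f(2) by (force simp: F_def)
  have off: "u x = 0" if "x \<notin> F" for x using that by (auto simp: F_def u_def)
  have supp: "fsupp u \<subseteq> F" using off by (intro fsupp_subset F) auto
  show thesis
  proof (rule that[of u])
    show "u \<in> Cc"
    proof (rule Cc_I[OF cu UL(2)])
      fix x assume "x \<notin> L"
      then show "u x = 0" using off FVU UL(4) by blast
    qed
    show "fsupp u \<subseteq> V" using supp FVU by blast
  qed (use f01 f(3) in \<open>auto simp: u_def\<close>)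
qed

text \<open>The definition provides compact sets only inside open ones. For Borel \<open>A\<close>,
  take a compact \<open>L\<close> that nearly fills \<open>S\<close> and remove an open
  \<open>V\<close> that tightly covers \<open>S - A\<close>: then \<open>L - V\<close> is compact,
  lies in \<open>A\<close>, and misses little of it.\<close>

lemma fin_regular_inner:
  fixes S :: "'a::t2_space set"
  assumes M: "fin_regular S M" and S: "open S" and A: "A \<in> borel_on S" and e: "e > 0"
  obtains K where "compact K" "K \<subseteq> A" "measure M (A - K) < e"
proof -
  interpret finite_measure M by (rule fin_regular_finite[OF M])
  have e2: "e / 2 > 0" using e by simp
  have SA: "S - A \<in> borel_on S" using A by auto
  obtain V where V: "open V" "S - A \<subseteq> V" "V \<subseteq> S" "measure M (V - (S - A)) < e / 2"
    by (rule fin_regular_outer[OF M S SA e2])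
  obtain L where L: "compact L" "L \<subseteq> S" "measure M (S - L) < e / 2"
    by (rule fin_regular_inner_open[OF M S S order_refl e2])
  have b: "V \<in> sets M" "L \<in> sets M" "S \<in> sets M" "A \<in> sets M"
    using A V L S by (auto simp: fin_regular_sets[OF M] compact_in_borel_on) (simp add: borel_on_iff)
  have AS: "A \<subseteq> S" using A S by (simp add: borel_on_iff)
  have "measure M (A - (L - V)) \<le> measure M ((V - (S - A)) \<union> (S - L))"
    using AS b by (intro finite_measure_mono) auto
  also have "\<dots> \<le> measure M (V - (S - A)) + measure M (S - L)"
    using b by (intro measure_Un_le) auto
  also have "\<dots> < e" using V L by simp
  finally show thesis
    using V L by (intro that[of "L - V"] compact_diff) auto
qed

text \<open>Between a compact \<open>K\<close> inside \<open>A\<close> and an open \<open>V\<close>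
  around \<open>A\<close> there is a Urysohn function. It differs from the indicator function of
  \<open>A\<close> only on \<open>V - K\<close>, a set of small measure, and by at most 1.\<close>

lemma fin_regular_Cc_approx:
  fixes S :: "'a::t2_space set"
  assumes lc: "locally_compact_space (euclidean :: 'a topology)"
    and M: "fin_regular S M" and S: "open S" and A: "A \<in> borel_on S" and e: "e > 0"
  obtains u where "u \<in> Cc" "\<And>x. 0 \<le> u x" "\<And>x. u x \<le> 1" "fsupp u \<subseteq> S"
    "(LINT x|M. \<bar>indicator A x - u x\<bar>) < e"
proof -
  interpret finite_measure M by (rule fin_regular_finite[OF M])
  have e2: "e / 2 > 0" using e by simp
  obtain V where V: "open V" "A \<subseteq> V" "V \<subseteq> S" "measure M (V - A) < e / 2"
    by (rule fin_regular_outer[OF M S A e2])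
  obtain K where K: "compact K" "K \<subseteq> A" "measure M (A - K) < e / 2"
    by (rule fin_regular_inner[OF M S A e2])
  have KV: "K \<subseteq> V" using K V by blast
  obtain u where u: "u \<in> Cc" "\<And>x. 0 \<le> u x" "\<And>x. u x \<le> 1" "\<And>x. x \<in> K \<Longrightarrow> u x = 1" "fsupp u \<subseteq> V"
    by (rule Urysohn_Cc[OF lc K(1) V(1) KV]) blast
  have b: "V \<in> borel_on S" "K \<in> borel_on S"
    using A V K S by (auto simp: borel_on_iff compact_imp_closed)
  then have VK: "V - K \<in> borel_on S" by auto
  have bb: "A \<in> sets borel" "V - K \<in> sets borel" using A VK S by (simp_all add: borel_on_iff)
  have le: "\<bar>indicator A x - u x\<bar> \<le> indicator (V - K) x" for x
  proof (cases "x \<in> V")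
    case True
    then show ?thesis using u(2,3,4)[of x] K by (auto split: split_indicator)
  next
    case False
    then have "u x = 0" "x \<notin> A" using Cc_zero_off[of x u] u(5) V by blast+
    then show ?thesis by simp
  qed
  have "(LINT x|M. \<bar>indicator A x - u x\<bar>) \<le> (LINT x|M. indicator (V - K) x)"
    by (intro integral_mono fin_regular_integrable[OF M] bounded_borel_intros bounded_borel_indicator bb
      Cc_bounded_borel u le)
  also have "\<dots> = measure M (V - K)"
    using V(3) by (auto simp: fin_regular_space[OF M] intro: arg_cong[where f="measure M"])
  also have "\<dots> \<le> measure M ((V - A) \<union> (A - K))"
    using b A by (intro finite_measure_mono) (auto simp: fin_regular_sets[OF M])
  also have "\<dots> \<le> measure M (V - A) + measure M (A - K)"
    using b A by (intro measure_Un_le) (auto simp: fin_regular_sets[OF M])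
  also have "\<dots> < e" using V K by simp
  finally show thesis using u V(3) by (intro that[of u]) auto
qed

context signed_regular
begin

text \<open>Approximating with respect to the sum of the Jordan parts yields a single
  \<open>u\<close> that serves both of them.\<close>

lemma Cc_approx:
  assumes lc: "locally_compact_space (euclidean :: 'a topology)"
    and A: "A \<in> borel_on S" and e: "e > 0"
  obtains u where "u \<in> Cc" "\<And>x. 0 \<le> u x" "\<And>x. u x \<le> 1" "fsupp u \<subseteq> S"
    "(LINT x|jordan_pos S \<mu>. \<bar>indicator A x - u x\<bar>)
      + (LINT x|jordan_neg S \<mu>. \<bar>indicator A x - u x\<bar>) < e"
proof -
  obtain P where P: "fin_regular S P" "\<And>A. measure P A = mpos A + mneg A"
    by (rule fin_regular_sum[OF open_S fin_regular_pos fin_regular_neg]) blast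
  obtain u where u: "u \<in> Cc" "\<And>x. 0 \<le> u x" "\<And>x. u x \<le> 1" "fsupp u \<subseteq> S"
    "(LINT x|P. \<bar>indicator A x - u x\<bar>) < e"
    by (rule fin_regular_Cc_approx[OF lc P(1) open_S A e]) blast
  have "A \<in> sets borel" using A open_S by (simp add: borel_on_iff)
  then have "bounded_borel (\<lambda>x. \<bar>indicator A x - u x\<bar>)"
    by (intro bounded_borel_intros bounded_borel_indicator Cc_bounded_borel u)
  from integral_sum_measure[OF fin_regular_pos fin_regular_neg P this] show thesis
    using u by (intro that[of u]) auto
qed

lemma measure_approx:
  assumes lc: "locally_compact_space (euclidean :: 'a topology)"
    and A: "A \<in> borel_on S" and e: "e > 0"
  obtains u where "u \<in> Cc" "\<And>x. 0 \<le> u x" "fsupp u \<subseteq> S" "\<bar>\<mu> A - signed_integral S \<mu> u\<bar> < e"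
proof -
  obtain u where u: "u \<in> Cc" "\<And>x. 0 \<le> u x" "\<And>x. u x \<le> 1" "fsupp u \<subseteq> S"
    "(LINT x|jordan_pos S \<mu>. \<bar>indicator A x - u x\<bar>)
      + (LINT x|jordan_neg S \<mu>. \<bar>indicator A x - u x\<bar>) < e"
    by (rule Cc_approx[OF lc A e]) blast
  have Ab: "A \<in> sets borel" using A open_S by (simp add: borel_on_iff)
  note bb = bounded_borel_indicator[OF Ab] Cc_bounded_borel[OF u(1)]
  have "signed_integral S \<mu> (\<lambda>x. indicator A x - u x) + signed_integral S \<mu> u = \<mu> A"
    using signed_integral_add[OF open_S signed bounded_borel_diff[OF bb] bb(2)]
      signed_integral_indicator[OF A] by simp
  then show thesis
    using abs_signed_integral_le[OF bounded_borel_diff[OF bb]] u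
    by (intro that[of u]) auto
qed

text \<open>This is the uniqueness behind the definite description in
  \<open>local_measure\<close>.\<close>

lemma eq_zero:
  assumes lc: "locally_compact_space (euclidean :: 'a topology)"
    and "\<And>k. k \<in> Cc \<Longrightarrow> fsupp k \<subseteq> S \<Longrightarrow> signed_integral S \<mu> k = 0"
  shows "\<mu> = 0"
proof (rule ext)
  fix A show "\<mu> A = 0 A"
  proof (cases "A \<in> borel_on S")
    case True
    have "\<bar>\<mu> A\<bar> < e" if "e > 0" for e
      by (rule measure_approx[OF lc True that]) (use assms(2) in auto)
    from this[of "\<bar>\<mu> A\<bar>"] show ?thesis by fastforce
  qed (simp add: zero_off)
qed

text \<open>By \<open>measure_approx\<close>, the value at a Borel set is a limit of integrals of
  nonnegative functions in \<open>Cc\<close>. Hence positivity of the functional forces positivity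
  of the measure.\<close>

lemma nonneg:
  assumes lc: "locally_compact_space (euclidean :: 'a topology)"
    and "\<And>k. k \<in> Cc \<Longrightarrow> fsupp k \<subseteq> S \<Longrightarrow> (\<And>x. 0 \<le> k x) \<Longrightarrow> 0 \<le> signed_integral S \<mu> k"
    and A: "A \<in> borel_on S"
  shows "0 \<le> \<mu> A"
proof -
  have "- e < \<mu> A" if "e > 0" for e
  proof (rule measure_approx[OF lc A that])
    fix u assume "u \<in> Cc" "\<And>x. 0 \<le> u x" "fsupp u \<subseteq> S" "\<bar>\<mu> A - signed_integral S \<mu> u\<bar> < e"
    with assms(2)[of u] show ?thesis by auto
  qed
  from this[of "- \<mu> A"] show ?thesis by fastforce
qed

lemma signed_integral_nonneg:
  assumes pos: "\<And>A. A \<in> borel_on S \<Longrightarrow> 0 \<le> \<mu> A" and f: "\<And>x. 0 \<le> f x"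
  shows "0 \<le> signed_integral S \<mu> f"
proof -
  obtain Y where Y: "Y \<in> borel_on S" "\<And>A. A \<in> borel_on S \<Longrightarrow> mneg A = - \<mu> (A - Y)"
    by (rule Hahn_parts) blast
  \<comment> \<open>The left-hand side is nonnegative and the right-hand side nonpositive, so the
    negative part is the zero measure.\<close>
  have "mneg S = - \<mu> (S - Y)" using Y by simp
  then have "mneg S = 0"
    using pos[OF borel_on_simps(1)[OF borel_on_top Y(1)]] measure_nonneg[of "jordan_neg S \<mu>" S]
    by linarith
  then have "emeasure (jordan_neg S \<mu>) (space (jordan_neg S \<mu>)) = 0"
    by (simp add: fin_regular_space[OF fin_regular_neg] finite_measure.emeasure_eq_measure[OF fin_regular_finite[OF fin_regular_neg]])
  then have "AE x in jordan_neg S \<mu>. f x = 0"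
    by (intro AE_I[of _ _ "space (jordan_neg S \<mu>)"]) auto
  then have "(LINT x|jordan_neg S \<mu>. f x) = 0"
    by (rule integral_eq_zero_AE)
  then show ?thesis by (simp add: signed_integral_def f)
qed

end

subsection \<open>Vector lattices and the Riesz-Kantorovich formula\<close>

text \<open>A vector lattice without the existence of suprema and infima. It makes least upper
  bounds available before the lattice property is established.\<close>

locale ordered_subspace =
  fixes L :: "'v::real_vector gorder" (structure)
  assumes eq_is_eq: "(.=) = (=)"
    and subspace: "subspace (carrier L)"
    and refl: "x \<in> carrier L \<Longrightarrow> x \<sqsubseteq> x"
    and antisym: "\<lbrakk>x \<in> carrier L; y \<in> carrier L; x \<sqsubseteq> y; y \<sqsubseteq> x\<rbrakk> \<Longrightarrow> x = y"
    and trans: "\<lbrakk>x \<in> carrier L; y \<in> carrier L; z \<in> carrier L; x \<sqsubseteq> y; y \<sqsubseteq> z\<rbrakk> \<Longrightarrow> x \<sqsubseteq> z"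
    and add_right_mono: "\<lbrakk>x \<in> carrier L; y \<in> carrier L; z \<in> carrier L; x \<sqsubseteq> y\<rbrakk> \<Longrightarrow> x + z \<sqsubseteq> y + z"
    and scale_left_mono: "\<lbrakk>x \<in> carrier L; y \<in> carrier L; 0 \<le> c; x \<sqsubseteq> y\<rbrakk> \<Longrightarrow> c *\<^sub>R x \<sqsubseteq> c *\<^sub>R y"
begin

lemmas closed = subspace_add[OF subspace] subspace_diff[OF subspace] subspace_neg[OF subspace]
  subspace_scale[OF subspace] subspace_0[OF subspace]

lemma partial_order: "partial_order L"
  by unfold_locales (auto simp: eq_is_eq intro: refl antisym trans)

lemma is_lub_iff:
  assumes "A \<subseteq> carrier L"
  shows "is_lub L s A \<longleftrightarrow> s \<in> carrier L \<and> (\<forall>x\<in>A. x \<sqsubseteq> s) \<and>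
    (\<forall>u\<in>carrier L. (\<forall>x\<in>A. x \<sqsubseteq> u) \<longrightarrow> s \<sqsubseteq> u)"
proof -
  have "Upper L A = {u \<in> carrier L. \<forall>x\<in>A. x \<sqsubseteq> u}" using assms by (auto simp: Upper_def)
  then show ?thesis by (auto simp: least_def)
qed

lemma is_lub_pair_iff:
  assumes "x \<in> carrier L" "y \<in> carrier L"
  shows "is_lub L s {x, y} \<longleftrightarrow> s \<in> carrier L \<and> x \<sqsubseteq> s \<and> y \<sqsubseteq> s \<and>
    (\<forall>u\<in>carrier L. x \<sqsubseteq> u \<longrightarrow> y \<sqsubseteq> u \<longrightarrow> s \<sqsubseteq> u)"
  using assms by (subst is_lub_iff) auto

lemma is_lub_unique: "is_lub L s A \<Longrightarrow> is_lub L t A \<Longrightarrow> s = t"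
  by (auto simp: least_def Upper_def intro: antisym)

text \<open>The join is a choice among least upper bounds; antisymmetry leaves only one.\<close>

lemma join_eq: assumes "is_lub L s {x, y}" shows "x \<squnion> y = s"
  unfolding join_def sup_def by (rule some_equality[where P="\<lambda>s. is_lub L s {x, y}", OF assms])
    (rule is_lub_unique[OF _ assms])

lemma neg_mono:
  assumes "x \<in> carrier L" "y \<in> carrier L" "x \<sqsubseteq> y" shows "- y \<sqsubseteq> - x"
  using add_right_mono[of x y "- x - y"] assms by (simp add: closed)

lemma is_lub_shift:
  assumes xyz: "x \<in> carrier L" "y \<in> carrier L" "z \<in> carrier L" and s: "is_lub L s {x, y}"
  shows "is_lub L (s + z) {x + z, y + z}"
proof -
  have s: "s \<in> carrier L" "x \<sqsubseteq> s" "y \<sqsubseteq> s"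
    and least: "\<And>u. u \<in> carrier L \<Longrightarrow> x \<sqsubseteq> u \<Longrightarrow> y \<sqsubseteq> u \<Longrightarrow> s \<sqsubseteq> u"
    using s xyz by (auto simp: is_lub_pair_iff)
  have "s + z \<sqsubseteq> u" if u: "u \<in> carrier L" "x + z \<sqsubseteq> u" "y + z \<sqsubseteq> u" for u
  proof -
    have "x \<sqsubseteq> u - z" "y \<sqsubseteq> u - z"
      using add_right_mono[of "x + z" u "- z"] add_right_mono[of "y + z" u "- z"] u xyz
      by (simp_all add: closed)
    then show ?thesis
      using add_right_mono[of s "u - z" z] least[of "u - z"] u xyz s by (simp add: closed)
  qed
  then show ?thesis
    using s xyz is_lub_pair_iff[OF closed(1)[OF xyz(1,3)] closed(1)[OF xyz(2,3)], of "s + z"]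
    by (simp add: closed(1) add_right_mono)
qed

text \<open>If \<open>u\<close> lies above \<open>x\<close> and \<open>- x\<close>, then half of
  \<open>u + x\<close> lies above \<open>x\<close> and 0, hence above \<open>p\<close>; solving for
  \<open>u\<close> gives the least upper bound.\<close>

lemma is_lub_abs:
  assumes x: "x \<in> carrier L" and p: "is_lub L p {x, 0}"
  shows "is_lub L (2 *\<^sub>R p - x) {x, - x}"
proof -
  have p: "p \<in> carrier L" "x \<sqsubseteq> p" "0 \<sqsubseteq> p"
    and least: "\<And>u. u \<in> carrier L \<Longrightarrow> x \<sqsubseteq> u \<Longrightarrow> 0 \<sqsubseteq> u \<Longrightarrow> p \<sqsubseteq> u"
    using p x by (auto simp: is_lub_pair_iff closed)
  have "2 *\<^sub>R x + (- x) \<sqsubseteq> 2 *\<^sub>R p + (- x)" "2 *\<^sub>R 0 + (- x) \<sqsubseteq> 2 *\<^sub>R p + (- x)"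
    using p x by (intro add_right_mono scale_left_mono closed; simp)+
  moreover have "2 *\<^sub>R p - x \<sqsubseteq> u" if u: "u \<in> carrier L" "x \<sqsubseteq> u" "- x \<sqsubseteq> u" for u
  proof -
    have "(1/2) *\<^sub>R (x + x) \<sqsubseteq> (1/2) *\<^sub>R (u + x)" "(1/2) *\<^sub>R (- x + x) \<sqsubseteq> (1/2) *\<^sub>R (u + x)"
      using u x by (intro add_right_mono scale_left_mono closed; simp)+
    then have "p \<sqsubseteq> (1/2) *\<^sub>R (u + x)"
      using u x by (intro least closed) (simp_all add: scaleR_2[symmetric])
    then have "2 *\<^sub>R p + (- x) \<sqsubseteq> 2 *\<^sub>R ((1/2) *\<^sub>R (u + x)) + (- x)"
      using u x p by (intro add_right_mono scale_left_mono closed; simp)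
    then show ?thesis by simp
  qed
  ultimately show ?thesis
    using p x by (simp add: is_lub_pair_iff closed scaleR_2)
qed

text \<open>The supremum of \<open>x\<close> and \<open>y\<close> is the positive part of
  \<open>x - y\<close> translated by \<open>y\<close>, and the infimum is the negated supremum of
  \<open>- x\<close> and \<open>- y\<close>.\<close>

lemma vector_latticeI:
  assumes pos: "\<And>x. x \<in> carrier L \<Longrightarrow> \<exists>s. is_lub L s {x, 0}"
  shows "vector_lattice L"
proof -
  interpret partial_order L by (rule partial_order)
  have lub: "\<exists>s. is_lub L s {x, y}" if xy: "x \<in> carrier L" "y \<in> carrier L" for x y
  proof -
    obtain s where s: "is_lub L s {x - y, 0}" using pos[of "x - y"] xy by (auto simp: closed)
    from is_lub_shift[OF _ _ xy(2) this] xy show ?thesis by (auto simp: closed)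
  qed
  have glb: "\<exists>s. is_glb L s {x, y}" if xy: "x \<in> carrier L" "y \<in> carrier L" for x y
  proof -
    obtain s where "is_lub L s {- x, - y}" using lub[of "- x" "- y"] xy by (auto simp: closed)
    then have s: "s \<in> carrier L" "- x \<sqsubseteq> s" "- y \<sqsubseteq> s"
      and least: "\<And>u. u \<in> carrier L \<Longrightarrow> - x \<sqsubseteq> u \<Longrightarrow> - y \<sqsubseteq> u \<Longrightarrow> s \<sqsubseteq> u"
      using xy by (auto simp: is_lub_pair_iff closed)
    have "- s \<sqsubseteq> x" "- s \<sqsubseteq> y"
      using neg_mono[OF _ _ s(2)] neg_mono[OF _ _ s(3)] s(1) xy by (auto simp: closed)
    moreover have "u \<sqsubseteq> - s" if u: "u \<in> carrier L" "u \<sqsubseteq> x" "u \<sqsubseteq> y" for u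
    proof -
      have "s \<sqsubseteq> - u" using u xy by (intro least neg_mono closed)
      from neg_mono[OF _ _ this] show ?thesis using u s by (simp add: closed)
    qed
    ultimately have "is_glb L (- s) {x, y}"
      using xy s by (auto simp: greatest_def Lower_def closed)
    then show ?thesis by blast
  qed
  show ?thesis
    by unfold_locales (auto intro: lub glb subspace add_right_mono scale_left_mono)
qed

lemma ordered_subspace_restrict:
  assumes V: "V \<subseteq> carrier L" "Real_Vector_Spaces.subspace V"
  shows "ordered_subspace (L\<lparr>carrier := V\<rparr>)"
  by unfold_locales
    (use V in \<open>auto simp: eq_is_eq intro: refl antisym trans add_right_mono scale_left_mono\<close>)

text \<open>Passing to a subspace leaves fewer upper bounds, so a supremum that belongs to the
  subspace remains one.\<close>

lemma is_lub_restrict: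
  assumes "V \<subseteq> carrier L" "A \<subseteq> V" "is_lub L s A" "s \<in> V"
  shows "is_lub (L\<lparr>carrier := V\<rparr>) s A"
proof -
  have "Upper (L\<lparr>carrier := V\<rparr>) A = {u \<in> V. \<forall>x\<in>A. x \<sqsubseteq> u}" using assms by (auto simp: Upper_def)
  moreover have "A \<subseteq> carrier L" using assms by blast
  then have "\<forall>x\<in>A. x \<sqsubseteq> s" "\<forall>u\<in>carrier L. (\<forall>x\<in>A. x \<sqsubseteq> u) \<longrightarrow> s \<sqsubseteq> u"
    using assms(3) is_lub_iff by blast+
  ultimately show ?thesis using assms(1,4) by (auto simp: least_def)
qed

end

text \<open>An order interval from \<open>l\<close> to \<open>u\<close> is contained in the
  symmetric one given by the maximum of \<open>\<bar>l\<bar>\<close> and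
  \<open>\<bar>u\<bar>\<close>, so bounds on symmetric intervals suffice.\<close>

lemma order_bounded_functionalsI:
  fixes \<phi> :: "('a::t2_space \<Rightarrow> real) \<Rightarrow> real"
  assumes off: "\<And>f. f \<notin> Cc \<Longrightarrow> \<phi> f = 0"
    and add: "\<And>f g. f \<in> Cc \<Longrightarrow> g \<in> Cc \<Longrightarrow> \<phi> (\<lambda>x. f x + g x) = \<phi> f + \<phi> g"
    and scale: "\<And>c f. f \<in> Cc \<Longrightarrow> \<phi> (\<lambda>x. c * f x) = c * \<phi> f"
    and bdd: "\<And>f. f \<in> Cc \<Longrightarrow> (\<And>x. 0 \<le> f x) \<Longrightarrow> \<exists>B. \<forall>g\<in>Cc. (\<forall>x. \<bar>g x\<bar> \<le> f x) \<longrightarrow> \<bar>\<phi> g\<bar> \<le> B"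
  shows "\<phi> \<in> order_bounded_functionals"
  unfolding order_bounded_functionals_def
proof (intro CollectI conjI allI ballI impI)
  fix B :: "('a \<Rightarrow> real) set"
  assume B: "B \<subseteq> Cc" and "\<exists>l\<in>Cc. \<exists>u\<in>Cc. \<forall>f\<in>B. l \<le> f \<and> f \<le> u"
  then obtain l u where lu: "l \<in> Cc" "u \<in> Cc" "\<And>f x. f \<in> B \<Longrightarrow> l x \<le> f x \<and> f x \<le> u x"
    by (auto simp: le_fun_def)
  define f where "f x = max \<bar>l x\<bar> \<bar>u x\<bar>" for x
  have "f \<in> Cc" unfolding f_def by (intro Cc_intros lu)
  moreover have "0 \<le> f x" for x by (simp add: f_def)
  ultimately obtain C where C: "\<And>g. g \<in> Cc \<Longrightarrow> (\<And>x. \<bar>g x\<bar> \<le> f x) \<Longrightarrow> \<bar>\<phi> g\<bar> \<le> C"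
    using bdd[of f] by blast
  have "\<bar>\<phi> g\<bar> \<le> C" if g: "g \<in> B" for g
  proof (rule C)
    fix x show "\<bar>g x\<bar> \<le> f x" using lu(3)[OF g, of x] by (auto simp: f_def)
  qed (use B g in auto)
  then show "bounded (\<phi> ` B)" by (auto simp: bounded_iff)
qed (auto simp: off plus_fun_def scaleR_fun_def add scale)

lemma functional_off: "\<phi> \<in> order_bounded_functionals \<Longrightarrow> f \<notin> Cc \<Longrightarrow> \<phi> f = 0"
  by (simp add: order_bounded_functionals_def)

lemma functional_add:
  "\<phi> \<in> order_bounded_functionals \<Longrightarrow> f \<in> Cc \<Longrightarrow> g \<in> Cc \<Longrightarrow> \<phi> (\<lambda>x. f x + g x) = \<phi> f + \<phi> g"
  by (simp add: order_bounded_functionals_def plus_fun_def)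

lemma functional_scale:
  "\<phi> \<in> order_bounded_functionals \<Longrightarrow> f \<in> Cc \<Longrightarrow> \<phi> (\<lambda>x. c * f x) = c * \<phi> f"
  by (simp add: order_bounded_functionals_def scaleR_fun_def)

lemma functional_zero: "\<phi> \<in> order_bounded_functionals \<Longrightarrow> \<phi> (\<lambda>x::'a::t2_space. 0) = 0"
  using functional_scale[OF _ Cc_zero, of \<phi> 0] by simp

lemma functional_diff:
  fixes f g :: "'a::t2_space \<Rightarrow> real"
  assumes "\<phi> \<in> order_bounded_functionals" "f \<in> Cc" "g \<in> Cc" shows "\<phi> (\<lambda>x. f x - g x) = \<phi> f - \<phi> g"
  using functional_add[OF assms(1,2) Cc_scale[OF assms(3)], of "-1"]
    functional_scale[OF assms(1,3), of "-1"] by simp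

lemma functional_bounded:
  fixes f :: "'a::t2_space \<Rightarrow> real"
  assumes \<phi>: "\<phi> \<in> order_bounded_functionals" and f: "f \<in> Cc"
  shows "\<exists>B. \<forall>g\<in>Cc. (\<forall>x. \<bar>g x\<bar> \<le> f x) \<longrightarrow> \<bar>\<phi> g\<bar> \<le> B"
proof -
  have nf: "(\<lambda>x. (-1) * f x) \<in> Cc" using f by (rule Cc_scale)
  have "bounded (\<phi> ` {g \<in> Cc. \<forall>x. \<bar>g x\<bar> \<le> f x})"
  proof -
    have "\<exists>l\<in>Cc. \<exists>u\<in>Cc. \<forall>g\<in>{g \<in> Cc. \<forall>x. \<bar>g x\<bar> \<le> f x}. l \<le> g \<and> g \<le> u"
      by (rule bexI[OF _ nf], rule bexI[OF _ f]) (auto simp: le_fun_def abs_le_iff minus_le_iff)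
    moreover have "\<And>B. B \<subseteq> Cc \<Longrightarrow> \<exists>l\<in>Cc. \<exists>u\<in>Cc. \<forall>g\<in>B. l \<le> g \<and> g \<le> u \<Longrightarrow> bounded (\<phi> ` B)"
      using \<phi> by (simp add: order_bounded_functionals_def)
    ultimately show ?thesis by simp
  qed
  then show ?thesis by (auto simp: bounded_iff)
qed

section \<open>The positive part of an order bounded functional\<close>

locale order_bounded_functional =
  fixes \<phi> :: "('a::t2_space \<Rightarrow> real) \<Rightarrow> real"
  assumes \<phi>: "\<phi> \<in> order_bounded_functionals"
begin

definition below :: "('a \<Rightarrow> real) \<Rightarrow> ('a \<Rightarrow> real) set"
  where "below f = {g \<in> Cc. \<forall>x. 0 \<le> g x \<and> g x \<le> f x}"

text \<open>The Riesz-Kantorovich formula for the positive part of \<open>\<phi>\<close>, meant for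
  nonnegative \<open>f\<close> only.\<close>

definition rk :: "('a \<Rightarrow> real) \<Rightarrow> real"
  where "rk f = (SUP g\<in>below f. \<phi> g)"

text \<open>The linear extension of \<open>rk\<close> from the positive cone, extended by zero off
  \<open>Cc\<close> as every represented functional is.\<close>

definition positive_part :: "('a \<Rightarrow> real) \<Rightarrow> real"
  where "positive_part f = (if f \<in> Cc then rk (\<lambda>x. max 0 (f x)) - rk (\<lambda>x. max 0 (- f x)) else 0)"

context
  fixes f :: "'a \<Rightarrow> real"
  assumes f: "f \<in> Cc" "\<And>x. 0 \<le> f x"
begin

lemma zero_below: "(\<lambda>x. 0) \<in> below f"
  using f Cc_zero by (auto simp: below_def)

lemma bdd_above_below: "bdd_above (\<phi> ` below f)"
proof -
  obtain B where B: "\<forall>g\<in>Cc. (\<forall>x. \<bar>g x\<bar> \<le> f x) \<longrightarrow> \<bar>\<phi> g\<bar> \<le> B"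
    using functional_bounded[OF \<phi> f(1)] by blast
  have "\<phi> g \<le> B" if "g \<in> below f" for g
    using that B[THEN bspec, of g] by (simp add: below_def abs_le_iff)
  then show ?thesis by (intro bdd_aboveI[of _ B]) auto
qed

lemma rk_upper: "g \<in> below f \<Longrightarrow> \<phi> g \<le> rk f"
  unfolding rk_def by (rule cSUP_upper[OF _ bdd_above_below])

lemma rk_least: "(\<And>g. g \<in> below f \<Longrightarrow> \<phi> g \<le> b) \<Longrightarrow> rk f \<le> b"
  unfolding rk_def using zero_below by (intro cSUP_least) auto

lemma rk_nonneg: "0 \<le> rk f"
  using rk_upper[OF zero_below] by (simp add: functional_zero[OF \<phi>])

end

lemma rk_mono:
  assumes "f \<in> Cc" "\<And>x. 0 \<le> f x" "g \<in> Cc" "\<And>x. f x \<le> g x" shows "rk f \<le> rk g"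
proof (rule rk_least[OF assms(1,2)])
  have "0 \<le> g x" for x using assms(2,4)[of x] by linarith
  moreover fix h assume "h \<in> below f"
  then have "h \<in> below g" using order_trans[OF _ assms(4)] by (simp add: below_def)
  ultimately show "\<phi> h \<le> rk g" using assms(3) by (intro rk_upper)
qed

text \<open>The inequality \<le> is the Riesz decomposition property: a function \<open>h\<close>
  between 0 and \<open>f + g\<close> is the sum of \<open>min h f\<close>, which is below
  \<open>f\<close>, and a remainder below \<open>g\<close>. The inequality \<ge> takes the two
  suprema one after the other.\<close>

lemma rk_add:
  assumes f: "f \<in> Cc" "\<And>x. 0 \<le> f x" and g: "g \<in> Cc" "\<And>x. 0 \<le> g x"
  shows "rk (\<lambda>x. f x + g x) = rk f + rk g"
proof (rule antisym)
  have fg: "(\<lambda>x. f x + g x) \<in> Cc" "\<And>x. 0 \<le> f x + g x"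
    using f g by (auto intro: Cc_add add_nonneg_nonneg)
  show "rk (\<lambda>x. f x + g x) \<le> rk f + rk g"
  proof (rule rk_least[OF fg])
    fix h assume "h \<in> below (\<lambda>x. f x + g x)"
    then have h: "h \<in> Cc" "\<And>x. 0 \<le> h x" "\<And>x. h x \<le> f x + g x" by (auto simp: below_def)
    let ?a = "\<lambda>x. min (h x) (f x)" and ?b = "\<lambda>x. h x - min (h x) (f x)"
    have ab: "?a \<in> Cc" "?b \<in> Cc" using h f by (auto intro!: Cc_intros)
    have a: "?a \<in> below f" using ab(1) h(2) f(2) by (auto simp: below_def)
    have "?b x \<le> g x" for x using h(3)[of x] g(2)[of x] by auto
    then have b: "?b \<in> below g" using ab(2) by (auto simp: below_def)
    have "\<phi> h = \<phi> ?a + \<phi> ?b" using functional_add[OF \<phi> ab] by simp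
    then show "\<phi> h \<le> rk f + rk g"
      using rk_upper[OF f a] rk_upper[OF g b] by simp
  qed
  have *: "\<phi> a + \<phi> b \<le> rk (\<lambda>x. f x + g x)" if a: "a \<in> below f" and b: "b \<in> below g" for a b
  proof -
    have ab: "a \<in> Cc" "b \<in> Cc" using a b by (auto simp: below_def)
    have "(\<lambda>x. a x + b x) \<in> below (\<lambda>x. f x + g x)"
      using a b Cc_add[OF ab] by (auto simp: below_def intro: add_mono add_nonneg_nonneg)
    from rk_upper[OF fg this] show ?thesis using functional_add[OF \<phi> ab] by simp
  qed
  have "rk f \<le> rk (\<lambda>x. f x + g x) - \<phi> b" if "b \<in> below g" for b
    by (rule rk_least[OF f]) (use *[OF _ that] in \<open>simp add: algebra_simps\<close>)
  then have "rk g \<le> rk (\<lambda>x. f x + g x) - rk f"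
    by (intro rk_least[OF g]) (simp add: algebra_simps)
  then show "rk f + rk g \<le> rk (\<lambda>x. f x + g x)" by simp
qed

text \<open>One inequality holds for all positive factors; using it for \<open>inverse c\<close> as
  well gives the reverse one.\<close>

lemma rk_scale:
  assumes f: "f \<in> Cc" "\<And>x. 0 \<le> f x" and c: "0 < c"
  shows "rk (\<lambda>x. c * f x) = c * rk f"
proof -
  have le: "rk (\<lambda>x. c * f x) \<le> c * rk f"
    if f: "f \<in> Cc" "\<And>x. 0 \<le> f x" and c: "0 < c" for c f
  proof (rule rk_least)
    fix h assume h: "h \<in> below (\<lambda>x. c * f x)"
    then have hc: "h \<in> Cc" by (simp add: below_def)
    have "(\<lambda>x. inverse c * h x) \<in> below f"
      using h c Cc_scale[OF hc, of "inverse c"] by (auto simp: below_def field_simps)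
    from rk_upper[OF f this] have "inverse c * \<phi> h \<le> rk f"
      using functional_scale[OF \<phi> hc, of "inverse c"] by simp
    then show "\<phi> h \<le> c * rk f" using c by (simp add: field_simps)
  qed (use that Cc_scale in auto)
  have "rk (\<lambda>x. inverse c * (c * f x)) \<le> inverse c * rk (\<lambda>x. c * f x)"
    using f c by (intro le Cc_scale) auto
  then have "c * rk f \<le> rk (\<lambda>x. c * f x)"
    using c by (simp add: field_simps)
  with le[OF f c] show ?thesis by simp
qed

text \<open>The value is independent of the way a function is written as a difference of nonnegative
  ones: with \<open>?p\<close> and \<open>?n\<close> the positive and negative parts of
  \<open>a - b\<close>, one has \<open>?p + b = a + ?n\<close>, and \<open>rk\<close> is additive.
  Linearity is deduced from this.\<close>

lemma positive_part_eq:
  assumes a: "a \<in> Cc" "\<And>x. 0 \<le> a x" and b: "b \<in> Cc" "\<And>x. 0 \<le> b x"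
  shows "positive_part (\<lambda>x. a x - b x) = rk a - rk b"
proof -
  let ?p = "\<lambda>x. max 0 (a x - b x)" and ?n = "\<lambda>x. max 0 (- (a x - b x))"
  have "?p \<in> Cc" "?n = (\<lambda>x. max 0 (b x - a x))" using a b by (auto intro!: Cc_intros)
  moreover have "(\<lambda>x. max 0 (b x - a x)) \<in> Cc" using a b by (intro Cc_intros)
  ultimately have "rk (\<lambda>x. ?p x + b x) = rk ?p + rk b" "rk (\<lambda>x. a x + ?n x) = rk a + rk ?n"
    using a b by (intro rk_add; simp)+
  moreover have "(\<lambda>x. ?p x + b x) = (\<lambda>x. a x + ?n x)" by (auto simp: fun_eq_iff)
  ultimately show ?thesis using a b Cc_diff[of a b] by (simp add: positive_part_def)
qed

lemma positive_part_nonneg: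
  assumes f: "f \<in> Cc" "\<And>x. 0 \<le> f x" shows "positive_part f = rk f"
  using positive_part_eq[OF f f] positive_part_eq[OF f Cc_zero] rk_add[OF Cc_zero _ Cc_zero] by simp

lemma positive_part_in: "positive_part \<in> order_bounded_functionals"
proof (rule order_bounded_functionalsI)
  let ?p = "\<lambda>f x. max 0 (f x)" and ?n = "\<lambda>f x. max 0 (- f x)"
  have pn: "?p f \<in> Cc" "?n f \<in> Cc" if "f \<in> Cc" for f :: "'a \<Rightarrow> real"
    using that Cc_max[OF Cc_zero that] Cc_max[OF Cc_zero Cc_scale[OF that, of "-1"]] by auto
  show "positive_part f = 0" if "f \<notin> Cc" for f using that by (simp add: positive_part_def)
  show "positive_part (\<lambda>x. f x + g x) = positive_part f + positive_part g"
    if "f \<in> Cc" "g \<in> Cc" for f g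
  proof -
    have eq: "(\<lambda>x. f x + g x) = (\<lambda>x. (?p f x + ?p g x) - (?n f x + ?n g x))" by (auto simp: fun_eq_iff)
    have "positive_part (\<lambda>x. f x + g x) = rk (\<lambda>x. ?p f x + ?p g x) - rk (\<lambda>x. ?n f x + ?n g x)"
      unfolding eq
      by (intro positive_part_eq Cc_add pn that) auto
    also have "\<dots> = positive_part f + positive_part g"
      using rk_add[OF pn(1)[OF that(1)] _ pn(1)[OF that(2)]]
        rk_add[OF pn(2)[OF that(1)] _ pn(2)[OF that(2)]] that
      by (simp add: positive_part_def)
    finally show ?thesis .
  qed
  show "positive_part (\<lambda>x. c * f x) = c * positive_part f" if "f \<in> Cc" for c f
  proof -
    note p = pn(1)[OF that] and n = pn(2)[OF that]
    consider "c = 0" | "c > 0" | "c < 0" by linarith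
    then show ?thesis
    proof cases
      case 1
      then show ?thesis
        using positive_part_eq[OF Cc_zero _ Cc_zero] by simp
    next
      case 2
      have eq: "(\<lambda>x. c * f x) = (\<lambda>x. c * ?p f x - c * ?n f x)"
        by (auto simp: fun_eq_iff max_def)
      have "positive_part (\<lambda>x. c * f x) = rk (\<lambda>x. c * ?p f x) - rk (\<lambda>x. c * ?n f x)"
        unfolding eq
        using 2 by (intro positive_part_eq Cc_scale p n) auto
      also have "\<dots> = c * positive_part f"
        using 2 rk_scale[OF p _ 2] rk_scale[OF n _ 2] that
        by (simp add: positive_part_def right_diff_distrib)
      finally show ?thesis .
    next
      \<comment> \<open>A negative factor exchanges the positive and the negative part of
        \<open>f\<close>.\<close>
      case 3
      then have c: "- c > 0" by simp
      have eq: "(\<lambda>x. c * f x) = (\<lambda>x. (- c) * ?n f x - (- c) * ?p f x)"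
        by (auto simp: fun_eq_iff max_def)
      have "positive_part (\<lambda>x. c * f x) = rk (\<lambda>x. (- c) * ?n f x) - rk (\<lambda>x. (- c) * ?p f x)"
        unfolding eq
        using c by (intro positive_part_eq Cc_scale p n) (auto intro: mult_nonneg_nonneg mult_nonpos_nonneg)
      also have "\<dots> = (- c) * rk (?n f) - (- c) * rk (?p f)"
        using rk_scale[OF p _ c] rk_scale[OF n _ c] by simp
      also have "\<dots> = c * positive_part f"
        using that by (simp add: positive_part_def algebra_simps)
      finally show ?thesis .
    qed
  qed
  fix f :: "'a \<Rightarrow> real" assume f: "f \<in> Cc" "\<And>x. 0 \<le> f x"
  have "\<bar>positive_part g\<bar> \<le> rk f" if g: "g \<in> Cc" "\<And>x. \<bar>g x\<bar> \<le> f x" for g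
  proof -
    have "?p g x \<le> f x" "?n g x \<le> f x" for x using g(2)[of x] f(2)[of x] by auto
    then have "rk (?p g) \<le> rk f" "rk (?n g) \<le> rk f"
      using pn[OF g(1)] f by (intro rk_mono; simp)+
    moreover have "0 \<le> rk (?p g)" "0 \<le> rk (?n g)" using pn[OF g(1)] by (intro rk_nonneg; simp)+
    ultimately show ?thesis using g(1) by (simp add: positive_part_def abs_le_iff)
  qed
  then show "\<exists>B. \<forall>g\<in>Cc. (\<forall>x. \<bar>g x\<bar> \<le> f x) \<longrightarrow> \<bar>positive_part g\<bar> \<le> B" by blast
qed

end

lemma order_dual_simps [simp]:
  "carrier order_dual = order_bounded_functionals"
  "(.=\<^bsub>order_dual\<^esub>) = (=)"
  by (simp_all add: order_dual_def)

lemma order_dual_le: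
  "\<phi> \<sqsubseteq>\<^bsub>order_dual\<^esub> \<psi> \<longleftrightarrow> (\<forall>f\<in>Cc. (\<forall>x. 0 \<le> f x) \<longrightarrow> \<phi> f \<le> \<psi> f)"
  by (simp add: order_dual_def le_fun_def)

lemma subspace_functionals: "subspace (order_bounded_functionals :: (('a::t2_space \<Rightarrow> real) \<Rightarrow> real) set)"
  unfolding subspace_def
proof (intro conjI ballI allI)
  show "0 \<in> (order_bounded_functionals :: (('a \<Rightarrow> real) \<Rightarrow> real) set)"
    by (rule order_bounded_functionalsI) auto
next
  fix \<phi> \<psi> :: "('a \<Rightarrow> real) \<Rightarrow> real"
  assume \<phi>: "\<phi> \<in> order_bounded_functionals" and \<psi>: "\<psi> \<in> order_bounded_functionals"
  show "\<phi> + \<psi> \<in> order_bounded_functionals"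
  proof (rule order_bounded_functionalsI)
    fix f :: "'a \<Rightarrow> real" assume f: "f \<in> Cc"
    obtain B C where "\<forall>g\<in>Cc. (\<forall>x. \<bar>g x\<bar> \<le> f x) \<longrightarrow> \<bar>\<phi> g\<bar> \<le> B"
      "\<forall>g\<in>Cc. (\<forall>x. \<bar>g x\<bar> \<le> f x) \<longrightarrow> \<bar>\<psi> g\<bar> \<le> C"
      using functional_bounded[OF \<phi> f] functional_bounded[OF \<psi> f] by blast
    then show "\<exists>B. \<forall>g\<in>Cc. (\<forall>x. \<bar>g x\<bar> \<le> f x) \<longrightarrow> \<bar>(\<phi> + \<psi>) g\<bar> \<le> B"
      by (intro exI[of _ "B + C"]) (auto intro: abs_triangle_ineq[THEN order_trans] add_mono)
  qed (use \<phi> \<psi> in \<open>auto simp: functional_off functional_add functional_scale algebra_simps\<close>)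
next
  fix \<phi> :: "('a \<Rightarrow> real) \<Rightarrow> real" and c :: real
  assume \<phi>: "\<phi> \<in> order_bounded_functionals"
  show "c *\<^sub>R \<phi> \<in> order_bounded_functionals"
  proof (rule order_bounded_functionalsI)
    fix f :: "'a \<Rightarrow> real" assume f: "f \<in> Cc"
    obtain B where "\<forall>g\<in>Cc. (\<forall>x. \<bar>g x\<bar> \<le> f x) \<longrightarrow> \<bar>\<phi> g\<bar> \<le> B"
      using functional_bounded[OF \<phi> f] by blast
    then show "\<exists>B. \<forall>g\<in>Cc. (\<forall>x. \<bar>g x\<bar> \<le> f x) \<longrightarrow> \<bar>(c *\<^sub>R \<phi>) g\<bar> \<le> B"
      by (intro exI[of _ "\<bar>c\<bar> * B"]) (auto simp: scaleR_fun_def abs_mult intro: mult_left_mono)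
  qed (use \<phi> in \<open>auto simp: functional_off functional_add functional_scale scaleR_fun_def algebra_simps\<close>)
qed

text \<open>For antisymmetry, functionals that agree on the positive cone agree on \<open>Cc\<close>
  by taking differences, and elsewhere both are zero by the convention of extension.\<close>

lemma ordered_subspace_order_dual:
  "ordered_subspace (order_dual :: (('a::t2_space \<Rightarrow> real) \<Rightarrow> real) gorder)"
proof
  fix \<phi> \<psi> :: "('a \<Rightarrow> real) \<Rightarrow> real"
  assume "\<phi> \<in> carrier order_dual" "\<psi> \<in> carrier order_dual"
  then have m: "\<phi> \<in> order_bounded_functionals" "\<psi> \<in> order_bounded_functionals" by simp_all
  assume "\<phi> \<sqsubseteq>\<^bsub>order_dual\<^esub> \<psi>" "\<psi> \<sqsubseteq>\<^bsub>order_dual\<^esub> \<phi>"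
  then have eq: "\<phi> f = \<psi> f" if "f \<in> Cc" "\<And>x. 0 \<le> f x" for f
    using that by (force simp: order_dual_le intro: order.antisym)
  have "\<phi> f = \<psi> f" for f
  proof (cases "f \<in> Cc")
    case True
    let ?p = "\<lambda>x. max 0 (f x)" and ?n = "\<lambda>x. max 0 (- f x)"
    have pn: "?p \<in> Cc" "?n \<in> Cc"
      using Cc_max[OF Cc_zero True] Cc_max[OF Cc_zero Cc_scale[OF True, of "-1"]] by auto
    have "f = (\<lambda>x. ?p x - ?n x)" by (auto simp: fun_eq_iff)
    then have "\<phi> f = \<phi> ?p - \<phi> ?n" "\<psi> f = \<psi> ?p - \<psi> ?n"
      using functional_diff[OF m(1) pn] functional_diff[OF m(2) pn] by simp_all
    then show ?thesis using eq[OF pn(1)] eq[OF pn(2)] by simp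
  qed (simp add: m functional_off)
  then show "\<phi> = \<psi>" by blast
qed (auto simp: order_dual_le subspace_functionals scaleR_fun_def intro: mult_left_mono order_trans)

text \<open>If \<open>\<psi>\<close> is above \<open>\<phi>\<close> and 0, then
  \<open>\<phi> g \<le> \<psi> g \<le> \<psi> f\<close> whenever \<open>g\<close> lies between 0 and
  \<open>f\<close>; the supremum over \<open>g\<close> gives leastness of the Riesz-Kantorovich
  functional.\<close>

lemma vector_lattice_order_dual:
  "vector_lattice (order_dual :: (('a::t2_space \<Rightarrow> real) \<Rightarrow> real) gorder)"
proof -
  interpret ordered_subspace "order_dual :: (('a \<Rightarrow> real) \<Rightarrow> real) gorder"
    by (rule ordered_subspace_order_dual)
  show ?thesis
  proof (rule vector_latticeI)
    fix \<phi> :: "('a \<Rightarrow> real) \<Rightarrow> real" assume \<phi>: "\<phi> \<in> carrier order_dual"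
    interpret order_bounded_functional \<phi> by unfold_locales (use \<phi> in simp)
    have self: "f \<in> below f" if "f \<in> Cc" "\<And>x. 0 \<le> f x" for f
      using that by (simp add: below_def)
    have "rk f \<le> \<psi> f" if f: "f \<in> Cc" "\<And>x. 0 \<le> f x"
      and \<psi>: "\<psi> \<in> order_bounded_functionals" "\<phi> \<sqsubseteq>\<^bsub>order_dual\<^esub> \<psi>" "0 \<sqsubseteq>\<^bsub>order_dual\<^esub> \<psi>" for f \<psi>
    proof (rule rk_least[OF f])
      fix g assume "g \<in> below f"
      then have g: "g \<in> Cc" "\<And>x. 0 \<le> g x" "\<And>x. 0 \<le> f x - g x" by (simp_all add: below_def)
      have "\<phi> g \<le> \<psi> g" "0 \<le> \<psi> (\<lambda>x. f x - g x)"
        using \<psi>(2,3) g f Cc_diff[of f g] by (simp_all add: order_dual_le)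
      then show "\<phi> g \<le> \<psi> f" using functional_diff[OF \<psi>(1) f(1) g(1)] by simp
    qed
    then have "is_lub order_dual positive_part {\<phi>, 0}"
      using positive_part_in \<phi> closed(5) rk_upper[OF _ _ self] rk_nonneg
      by (subst is_lub_pair_iff) (auto simp: order_dual_le positive_part_nonneg)
    then show "\<exists>s. is_lub order_dual s {\<phi>, 0}" by blast
  qed
qed

subsection \<open>The embedding of measures into the order dual\<close>

abbreviation signed_measures :: "('a::t2_space set \<Rightarrow> real) set"
  where "signed_measures \<equiv> signed_regular_measures UNIV"

lemma signed_regular_UNIV: "\<mu> \<in> signed_measures \<Longrightarrow> signed_regular UNIV \<mu>"
  by unfold_locales simp_all

lemma fin_regular_signed:
  fixes S :: "'a::t2_space set"
  assumes S: "open S" and M: "fin_regular S M" shows "measure M \<in> signed_regular_measures S"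
  using M by (auto simp: signed_regular_measures_def fin_regular_def intro: span_base)

lemma signed_integral_measure:
  fixes S :: "'a::t2_space set"
  assumes S: "open S" and M: "fin_regular S M" and f: "bounded_borel f"
  shows "signed_integral S (measure M) f = (LINT x|M. f x)"
proof -
  have "measure M = measure M - measure (null_measure (restrict_space borel S))"
    by (simp add: fun_eq_iff)
  from signed_integral_eq[OF S M fin_regular_null[OF S] this f] show ?thesis
    by (simp add: integral_eq_zero_AE ae_filter_eq_bot_iff)
qed

lemma measure_lattice_simps [simp]:
  "carrier measure_lattice = signed_measures"
  "(.=\<^bsub>measure_lattice\<^esub>) = (=)"
  "\<mu> \<sqsubseteq>\<^bsub>measure_lattice\<^esub> \<nu> \<longleftrightarrow> (\<forall>A \<in> sets borel. \<mu> A \<le> \<nu> A)"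
  by (simp_all add: measure_lattice_def)

lemma signed_measures_eqI:
  assumes "\<mu> \<in> signed_measures" "\<nu> \<in> signed_measures"
    and "\<And>A. A \<in> sets borel \<Longrightarrow> \<mu> A = \<nu> A"
  shows "\<mu> = \<nu>"
proof (rule ext)
  fix A show "\<mu> A = \<nu> A"
    using assms(3) signed_regular.zero_off[OF signed_regular_UNIV[OF assms(1)], of A]
      signed_regular.zero_off[OF signed_regular_UNIV[OF assms(2)], of A]
    by (cases "A \<in> sets borel") auto
qed

lemma ordered_subspace_measure_lattice:
  "ordered_subspace (measure_lattice :: ('a::t2_space set \<Rightarrow> real) gorder)"
proof
  fix \<mu> \<nu> :: "'a set \<Rightarrow> real"
  assume "\<mu> \<in> carrier measure_lattice" "\<nu> \<in> carrier measure_lattice"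
    "\<mu> \<sqsubseteq>\<^bsub>measure_lattice\<^esub> \<nu>" "\<nu> \<sqsubseteq>\<^bsub>measure_lattice\<^esub> \<mu>"
  then show "\<mu> = \<nu>"
    by (intro signed_measures_eqI) (simp_all add: order.antisym)
qed (auto simp: subspace_signed_regular scaleR_fun_def intro: mult_left_mono order_trans)

text \<open>An upper bound \<open>\<nu>\<close> of \<open>\<mu>\<close> and 0 satisfies \<open>\<mu>
  (A \<inter> Y) \<le> \<nu> (A \<inter> Y) \<le> \<nu> A\<close> for a Hahn set \<open>Y\<close>,
  and the first term is the positive part at \<open>A\<close>.\<close>

lemma measure_lattice_lub_pos:
  assumes \<mu>: "\<mu> \<in> signed_measures"
  shows "is_lub measure_lattice (measure (jordan_pos UNIV \<mu>)) {\<mu>, 0}"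
proof -
  interpret ordered_subspace "measure_lattice :: ('a::t2_space set \<Rightarrow> real) gorder"
    by (rule ordered_subspace_measure_lattice)
  interpret signed_regular UNIV \<mu> by (rule signed_regular_UNIV[OF \<mu>])
  obtain Y where Y: "Y \<in> sets borel" "\<And>A. A \<in> sets borel \<Longrightarrow> mpos A = \<mu> (A \<inter> Y)"
    by (rule Hahn_parts) simp
  have "mpos A \<le> \<nu> A"
    if \<nu>: "\<nu> \<in> signed_measures" "\<And>A. A \<in> sets borel \<Longrightarrow> \<mu> A \<le> \<nu> A" "\<And>A. A \<in> sets borel \<Longrightarrow> 0 \<le> \<nu> A"
      and A: "A \<in> sets borel" for \<nu> A
  proof -
    interpret \<nu>: signed_regular UNIV \<nu> by (rule signed_regular_UNIV[OF \<nu>(1)])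
    have "mpos A \<le> \<nu> (A \<inter> Y) + \<nu> (A - Y)"
      using \<nu>(2)[of "A \<inter> Y"] \<nu>(3)[of "A - Y"] A Y by simp
    then show ?thesis using \<nu>.split[of A Y] A Y by simp
  qed
  then show ?thesis
    using \<mu> fin_regular_signed[OF _ fin_regular_pos] subspace_0[OF subspace_signed_regular] fun_cong[OF Jordan]
    by (subst is_lub_pair_iff) auto
qed

lemma vector_lattice_measure_lattice:
  "vector_lattice (measure_lattice :: ('a::t2_space set \<Rightarrow> real) gorder)"
  using measure_lattice_lub_pos
  by (intro ordered_subspace.vector_latticeI ordered_subspace_measure_lattice) auto

lemma Phi_add:
  assumes "\<mu> \<in> signed_measures" "\<nu> \<in> signed_measures" shows "Phi (\<mu> + \<nu>) = Phi \<mu> + Phi \<nu>"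
  using assms by (auto simp: Phi_def fun_eq_iff signed_integral_add_measure Cc_bounded_borel)

lemma Phi_scale:
  assumes "\<mu> \<in> signed_measures" shows "Phi (c *\<^sub>R \<mu>) = c *\<^sub>R Phi \<mu>"
proof (rule ext)
  fix f show "Phi (c *\<^sub>R \<mu>) f = (c *\<^sub>R Phi \<mu>) f"
    using signed_integral_scale_measure[OF open_UNIV assms, of f c]
    by (simp add: Phi_def scaleR_fun_def[of c "Phi \<mu>"] Cc_bounded_borel)
qed

lemma Phi_diff:
  assumes "\<mu> \<in> signed_measures" "\<nu> \<in> signed_measures" shows "Phi (\<mu> - \<nu>) = Phi \<mu> - Phi \<nu>"
  using Phi_add[of "\<mu> - \<nu>" \<nu>] assms subspace_diff[OF subspace_signed_regular assms]
  by (simp add: algebra_simps)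

lemma Phi_zero: "Phi (0 :: 'a::t2_space set \<Rightarrow> real) = 0"
  using Phi_scale[OF subspace_0[OF subspace_signed_regular], of 0, where 'a='a] by simp

lemma Phi_functional:
  fixes \<mu> :: "'a::t2_space set \<Rightarrow> real"
  assumes \<mu>: "\<mu> \<in> signed_measures" shows "Phi \<mu> \<in> order_bounded_functionals"
proof (rule order_bounded_functionalsI)
  interpret signed_regular UNIV \<mu> by (rule signed_regular_UNIV[OF \<mu>])
  fix f :: "'a \<Rightarrow> real" assume f: "f \<in> Cc"
  note i = fin_regular_integrable[OF fin_regular_pos] fin_regular_integrable[OF fin_regular_neg]
  have "\<bar>Phi \<mu> g\<bar> \<le> (LINT x|jordan_pos UNIV \<mu>. f x) + (LINT x|jordan_neg UNIV \<mu>. f x)"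
    if g: "g \<in> Cc" "\<And>x. \<bar>g x\<bar> \<le> f x" for g
  proof -
    have "\<bar>Phi \<mu> g\<bar> \<le> (LINT x|jordan_pos UNIV \<mu>. \<bar>g x\<bar>) + (LINT x|jordan_neg UNIV \<mu>. \<bar>g x\<bar>)"
      using abs_signed_integral_le[OF Cc_bounded_borel[OF g(1)]] g(1) by (simp add: Phi_def)
    also have "\<dots> \<le> (LINT x|jordan_pos UNIV \<mu>. f x) + (LINT x|jordan_neg UNIV \<mu>. f x)"
      by (intro add_mono integral_mono i bounded_borel_abs Cc_bounded_borel f g)
    finally show ?thesis .
  qed
  then show "\<exists>B. \<forall>g\<in>Cc. (\<forall>x. \<bar>g x\<bar> \<le> f x) \<longrightarrow> \<bar>Phi \<mu> g\<bar> \<le> B" by blast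
qed (use \<mu> in \<open>auto simp: Phi_def signed_integral_add signed_integral_scale Cc_bounded_borel Cc_add Cc_scale\<close>)

text \<open>Both directions concern the sign of the single measure \<open>\<nu> - \<mu>\<close>.
  Besides injectivity, this is what transfers suprema between measures and functionals.\<close>

lemma Phi_le_iff:
  fixes \<mu> :: "'a::t2_space set \<Rightarrow> real"
  assumes lc: "locally_compact_space (euclidean :: 'a topology)"
    and \<mu>: "\<mu> \<in> signed_measures" and \<nu>: "\<nu> \<in> signed_measures"
  shows "Phi \<mu> \<sqsubseteq>\<^bsub>order_dual\<^esub> Phi \<nu> \<longleftrightarrow> \<mu> \<sqsubseteq>\<^bsub>measure_lattice\<^esub> \<nu>"
proof -
  have d: "\<nu> - \<mu> \<in> signed_measures" by (intro subspace_diff[OF subspace_signed_regular] \<mu> \<nu>)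
  interpret signed_regular UNIV "\<nu> - \<mu>" by (rule signed_regular_UNIV[OF d])
  have P: "signed_integral UNIV (\<nu> - \<mu>) f = Phi \<nu> f - Phi \<mu> f" if "f \<in> Cc" for f
    using that fun_cong[OF Phi_diff[OF \<nu> \<mu>], of f] by (simp add: Phi_def)
  show ?thesis
  proof
    assume "Phi \<mu> \<sqsubseteq>\<^bsub>order_dual\<^esub> Phi \<nu>"
    then have "0 \<le> (\<nu> - \<mu>) A" if "A \<in> sets borel" for A
      using that by (intro nonneg[OF lc]) (simp_all add: P order_dual_le)
    then show "\<mu> \<sqsubseteq>\<^bsub>measure_lattice\<^esub> \<nu>" by simp
  next
    assume "\<mu> \<sqsubseteq>\<^bsub>measure_lattice\<^esub> \<nu>"
    then have "Phi \<mu> f \<le> Phi \<nu> f" if "f \<in> Cc" "\<And>x. 0 \<le> f x" for f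
      using P[OF that(1)] signed_integral_nonneg[where f=f, OF _ that(2)] by simp
    then show "Phi \<mu> \<sqsubseteq>\<^bsub>order_dual\<^esub> Phi \<nu>" by (simp add: order_dual_le)
  qed
qed

lemma inj_on_Phi:
  assumes lc: "locally_compact_space (euclidean :: 'a::t2_space topology)"
  shows "inj_on Phi (signed_measures :: ('a set \<Rightarrow> real) set)"
proof (rule inj_onI)
  interpret ordered_subspace "measure_lattice :: ('a set \<Rightarrow> real) gorder"
    by (rule ordered_subspace_measure_lattice)
  interpret od: ordered_subspace "order_dual :: (('a \<Rightarrow> real) \<Rightarrow> real) gorder"
    by (rule ordered_subspace_order_dual)
  fix \<mu> \<nu> :: "'a set \<Rightarrow> real"
  assume \<mu>: "\<mu> \<in> signed_measures" and \<nu>: "\<nu> \<in> signed_measures" and "Phi \<mu> = Phi \<nu>"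
  then have "Phi \<mu> \<sqsubseteq>\<^bsub>order_dual\<^esub> Phi \<nu>" "Phi \<nu> \<sqsubseteq>\<^bsub>order_dual\<^esub> Phi \<mu>"
    by (simp_all add: order_dual_le)
  then have "\<mu> \<sqsubseteq>\<^bsub>measure_lattice\<^esub> \<nu>" "\<nu> \<sqsubseteq>\<^bsub>measure_lattice\<^esub> \<mu>"
    unfolding Phi_le_iff[OF lc \<mu> \<nu>] Phi_le_iff[OF lc \<nu> \<mu>] by simp_all
  then show "\<mu> = \<nu>" using \<mu> \<nu> by (intro antisym) simp_all
qed

text \<open>For a functional \<open>\<psi>\<close> above \<open>Phi \<mu>\<close> and \<open>0\<close>, a Hahn set \<open>Y\<close> of \<open>\<mu>\<close>, and \<open>u\<close> in \<^term>\<open>Cc\<close>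
  close to the indicator function of \<open>Y\<close>, one has \<open>\<psi> f \<ge> \<psi> (f u) \<ge> Phi \<mu> (f u)\<close>, and the right hand
  side is close to the integral of \<open>f\<close> against the positive part of \<open>\<mu>\<close>.\<close>

lemma Phi_lub_pos:
  fixes \<mu> :: "'a::t2_space set \<Rightarrow> real"
  assumes lc: "locally_compact_space (euclidean :: 'a topology)"
    and \<mu>: "\<mu> \<in> signed_measures"
  shows "is_lub order_dual (Phi (measure (jordan_pos UNIV \<mu>))) {Phi \<mu>, 0}"
proof -
  interpret od: ordered_subspace "order_dual :: (('a \<Rightarrow> real) \<Rightarrow> real) gorder"
    by (rule ordered_subspace_order_dual)
  interpret ml: ordered_subspace "measure_lattice :: ('a::t2_space set \<Rightarrow> real) gorder"
    by (rule ordered_subspace_measure_lattice)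
  interpret signed_regular UNIV \<mu> by (rule signed_regular_UNIV[OF \<mu>])
  have z: "0 \<in> signed_measures" by (rule subspace_0[OF subspace_signed_regular])
  have m: "mpos \<in> signed_measures" "\<mu> \<sqsubseteq>\<^bsub>measure_lattice\<^esub> mpos" "0 \<sqsubseteq>\<^bsub>measure_lattice\<^esub> mpos"
    using measure_lattice_lub_pos[OF \<mu>] \<mu> z
    unfolding ml.is_lub_pair_iff[OF \<mu>[folded measure_lattice_simps(1)]
        z[folded measure_lattice_simps(1)]]
    by simp_all
  have "Phi mpos f \<le> \<psi> f"
    if f: "f \<in> Cc" "\<And>x. 0 \<le> f x" and \<psi>: "\<psi> \<in> order_bounded_functionals"
      and ge: "Phi \<mu> \<sqsubseteq>\<^bsub>order_dual\<^esub> \<psi>" "0 \<sqsubseteq>\<^bsub>order_dual\<^esub> \<psi>" for f \<psi>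
  proof (rule field_le_epsilon)
    fix e :: real assume e: "e > 0"
    obtain Y where Y: "Y \<in> borel_on UNIV" "mpos (UNIV - Y) = 0" "mneg Y = 0"
      by (rule Hahn_parts) simp
    have Yb: "Y \<in> sets borel" using Y by simp
    note fb = Cc_bounded_borel[OF f(1)] and Ybb = bounded_borel_indicator[OF Yb]
    obtain C0 where C0: "C0 \<ge> 0" "\<And>x. \<bar>f x\<bar> \<le> C0" using bounded_borelE[OF fb] by blast
    \<comment> \<open>The extra 1 makes \<open>e / C\<close> a legitimate tolerance even for
      \<open>f = 0\<close>; multiplication by \<open>f\<close> enlarges the error of the
      approximation at most by the factor \<open>C\<close>.\<close>
    define C where "C = C0 + 1"
    have C: "C > 0" "\<And>x. \<bar>f x\<bar> \<le> C" using C0 by (auto simp: C_def intro: add_increasing2)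
    obtain u where u: "u \<in> Cc" "\<And>x. 0 \<le> u x" "\<And>x. u x \<le> 1"
      "(LINT x|jordan_pos UNIV \<mu>. \<bar>indicator Y x - u x\<bar>)
        + (LINT x|jordan_neg UNIV \<mu>. \<bar>indicator Y x - u x\<bar>) < e / C"
      by (rule Cc_approx[OF lc Y(1), of "e / C"]) (use e C in auto)
    note ub = Cc_bounded_borel[OF u(1)]
    have fu: "(\<lambda>x. f x * u x) \<in> Cc" by (intro Cc_mult f u)
    have "Phi mpos f = (LINT x|jordan_pos UNIV \<mu>. f x)"
      using f(1) signed_integral_measure[OF _ fin_regular_pos fb] by (simp add: Phi_def)
    \<comment> \<open>The positive part is carried by \<open>Y\<close> and the negative part by its
      complement, so the factor \<open>indicator Y\<close> keeps the first integral and removes the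
      second.\<close>
    also have "\<dots> = signed_integral UNIV \<mu> (\<lambda>x. f x * indicator Y x)"
    proof -
      have "AE x in jordan_pos UNIV \<mu>. x \<notin> UNIV - Y"
        using Y by (intro AE_not_in)
          (simp add: null_sets_def fin_regular_sets[OF fin_regular_pos] finite_measure.emeasure_eq_measure[OF fin_regular_finite[OF fin_regular_pos]])
      then have "(LINT x|jordan_pos UNIV \<mu>. f x) = (LINT x|jordan_pos UNIV \<mu>. f x * indicator Y x)"
        by (intro integral_cong_AE fin_regular_measurable[OF fin_regular_pos] bounded_borel_measurable
          bounded_borel_mult fb Ybb) auto
      moreover have "AE x in jordan_neg UNIV \<mu>. x \<notin> Y"
        using Y by (intro AE_not_in)
          (simp add: null_sets_def fin_regular_sets[OF fin_regular_neg] finite_measure.emeasure_eq_measure[OF fin_regular_finite[OF fin_regular_neg]])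
      then have "(LINT x|jordan_neg UNIV \<mu>. f x * indicator Y x) = 0"
        by (intro integral_eq_zero_AE) auto
      ultimately show ?thesis by (simp add: signed_integral_def)
    qed
    also have "\<dots> = signed_integral UNIV \<mu> (\<lambda>x. f x * u x)
        + signed_integral UNIV \<mu> (\<lambda>x. f x * (indicator Y x - u x))"
      by (subst signed_integral_add[symmetric])
        (auto simp: \<mu> algebra_simps intro!: bounded_borel_intros fb ub Ybb)
    also have "signed_integral UNIV \<mu> (\<lambda>x. f x * (indicator Y x - u x)) \<le>
      (LINT x|jordan_pos UNIV \<mu>. \<bar>f x * (indicator Y x - u x)\<bar>)
        + (LINT x|jordan_neg UNIV \<mu>. \<bar>f x * (indicator Y x - u x)\<bar>)"
      by (rule order_trans[OF abs_ge_self abs_signed_integral_le])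
        (intro bounded_borel_intros fb ub Ybb)
    also have "\<dots> \<le> (LINT x|jordan_pos UNIV \<mu>. C * \<bar>indicator Y x - u x\<bar>)
        + (LINT x|jordan_neg UNIV \<mu>. C * \<bar>indicator Y x - u x\<bar>)"
      by (intro add_mono integral_mono fin_regular_integrable[OF fin_regular_pos] fin_regular_integrable[OF fin_regular_neg]
          bounded_borel_intros fb ub Ybb) (simp_all add: abs_mult mult_right_mono C)
    also have "\<dots> = C * ((LINT x|jordan_pos UNIV \<mu>. \<bar>indicator Y x - u x\<bar>)
        + (LINT x|jordan_neg UNIV \<mu>. \<bar>indicator Y x - u x\<bar>))"
      by (simp add: distrib_left)
    also have "\<dots> \<le> e" using u(4) C by (simp add: field_simps)
    also have "signed_integral UNIV \<mu> (\<lambda>x. f x * u x) = Phi \<mu> (\<lambda>x. f x * u x)"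
      using fu by (simp add: Phi_def)
    also have "\<dots> \<le> \<psi> (\<lambda>x. f x * u x)" using ge(1) fu f(2) u(2) by (simp add: order_dual_le)
    also have "\<dots> \<le> \<psi> f"
    proof -
      have "0 \<le> f x - f x * u x" for x using mult_left_le[OF u(3) f(2)] by simp
      then have "0 \<le> \<psi> (\<lambda>x. f x - f x * u x)"
        using ge(2) Cc_diff[OF f(1) fu] by (simp add: order_dual_le)
      then show ?thesis using functional_diff[OF \<psi> f(1) fu] by simp
    qed
    finally show "Phi mpos f \<le> \<psi> f + e" by simp
  qed
  then have least: "Phi mpos \<sqsubseteq>\<^bsub>order_dual\<^esub> \<psi>" if "\<psi> \<in> order_bounded_functionals"
    "Phi \<mu> \<sqsubseteq>\<^bsub>order_dual\<^esub> \<psi>" "0 \<sqsubseteq>\<^bsub>order_dual\<^esub> \<psi>" for \<psi>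
    using that by (simp add: order_dual_le[of "Phi mpos"])
  have "Phi \<mu> \<sqsubseteq>\<^bsub>order_dual\<^esub> Phi mpos" "0 \<sqsubseteq>\<^bsub>order_dual\<^esub> Phi mpos"
    using Phi_le_iff[OF lc \<mu> m(1)] Phi_le_iff[OF lc z m(1)] m(2,3) Phi_zero[where 'a='a] by simp_all
  then show ?thesis
    using Phi_functional[OF \<mu>] Phi_functional[OF m(1)] least od.closed(5)
    by (subst od.is_lub_pair_iff) auto
qed

text \<open>The total variation measure, written so that \<open>is_lub_abs\<close> applies to it
  directly; \<open>abs_measure_eq\<close> gives the usual form.\<close>

definition abs_measure :: "('a::t2_space set \<Rightarrow> real) \<Rightarrow> 'a set \<Rightarrow> real"
  where "abs_measure \<mu> = 2 *\<^sub>R measure (jordan_pos UNIV \<mu>) - \<mu>"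

lemma abs_measure_signed: "\<mu> \<in> signed_measures \<Longrightarrow> abs_measure \<mu> \<in> signed_measures"
  unfolding abs_measure_def
  by (intro subspace_diff subspace_scale subspace_signed_regular fin_regular_signed
      signed_regular.fin_regular_pos signed_regular_UNIV) auto

lemma abs_measure_eq:
  assumes "\<mu> \<in> signed_measures"
  shows "abs_measure \<mu> A = measure (jordan_pos UNIV \<mu>) A + measure (jordan_neg UNIV \<mu>) A"
  using fun_cong[OF signed_regular.Jordan[OF signed_regular_UNIV[OF assms]], of A]
  by (simp add: abs_measure_def scaleR_fun_def)

lemma vl_abs_measure_lattice: "\<mu> \<in> signed_measures \<Longrightarrow> vl_abs measure_lattice \<mu> = abs_measure \<mu>"
  unfolding vl_abs_def abs_measure_def
  by (intro ordered_subspace.join_eq ordered_subspace.is_lub_abs ordered_subspace_measure_lattice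
      measure_lattice_lub_pos) auto

text \<open>Linearity of \<open>Phi\<close> turns the formula for the modulus in terms of the
  positive part into the same formula for functionals, so preserving positive parts is
  enough.\<close>

lemma Phi_abs_lub:
  fixes \<mu> :: "'a::t2_space set \<Rightarrow> real"
  assumes lc: "locally_compact_space (euclidean :: 'a topology)"
    and \<mu>: "\<mu> \<in> signed_measures"
  shows "is_lub order_dual (Phi (abs_measure \<mu>)) {Phi \<mu>, - Phi \<mu>}"
proof -
  interpret signed_regular UNIV \<mu> by (rule signed_regular_UNIV[OF \<mu>])
  have p: "mpos \<in> signed_measures" by (intro fin_regular_signed fin_regular_pos) simp
  have "Phi (abs_measure \<mu>) = 2 *\<^sub>R Phi mpos - Phi \<mu>"
    unfolding abs_measure_def
    by (subst Phi_diff) (auto simp: Phi_scale p \<mu> intro: subspace_scale[OF subspace_signed_regular])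
  then show ?thesis
    using ordered_subspace.is_lub_abs[OF ordered_subspace_order_dual _ Phi_lub_pos[OF lc \<mu>]]
      Phi_functional[OF \<mu>] by simp
qed

lemma lattice_homomorphism_Phi:
  assumes lc: "locally_compact_space (euclidean :: 'a::t2_space topology)"
  shows "lattice_homomorphism (measure_lattice :: ('a set \<Rightarrow> real) gorder) order_dual Phi"
  unfolding lattice_homomorphism_def
proof (intro conjI ballI allI)
  fix \<mu> :: "'a set \<Rightarrow> real" assume "\<mu> \<in> carrier measure_lattice"
  then have \<mu>: "\<mu> \<in> signed_measures" by simp
  show "vl_abs order_dual (Phi \<mu>) = Phi (vl_abs measure_lattice \<mu>)"
    unfolding vl_abs_measure_lattice[OF \<mu>] unfolding vl_abs_def
    by (rule ordered_subspace.join_eq[OF ordered_subspace_order_dual Phi_abs_lub[OF lc \<mu>]])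
qed (auto simp: vector_lattice_measure_lattice vector_lattice_order_dual Phi_functional Phi_add Phi_scale)

section \<open>Restrictions, densities and products with bounded Borel functions\<close>

lemma fin_regular_restrict_space:
  fixes U :: "'a::t2_space set"
  assumes U: "open U" and M: "fin_regular UNIV M"
  shows "fin_regular U (restrict_space M U)"
proof (rule rfmI[OF U])
  interpret finite_measure M by (rule fin_regular_finite[OF M])
  have UM: "U \<in> sets M" using U by (simp add: fin_regular_sets[OF M])
  show s: "sets (restrict_space M U) = borel_on U"
    by (rule sets_restrict_space_cong) (simp add: fin_regular_sets[OF M])
  show "finite_measure (restrict_space M U)"
    using UM by (intro finite_measure_restrict_space) (simp_all add: finite_measure_axioms)
  have m: "measure (restrict_space M U) A = measure M A" if "A \<subseteq> U" for A
    using UM that by (intro measure_restrict_space) (auto simp: fin_regular_space[OF M])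
  show "\<exists>V. open V \<and> A \<subseteq> V \<and> V \<subseteq> U \<and> measure (restrict_space M U) (V - A) < e"
    if A: "A \<in> borel_on U" and e: "e > 0" for A e
  proof -
    have A': "A \<in> borel_on UNIV" "A \<subseteq> U" using A U by (simp_all add: borel_on_iff)
    obtain V where V: "open V" "A \<subseteq> V" "measure M (V - A) < e"
      by (rule fin_regular_outer[OF M open_UNIV A'(1) e]) simp
    have "measure M (V \<inter> U - A) \<le> measure M (V - A)"
      using V A' by (intro finite_measure_mono) (auto simp: fin_regular_sets[OF M])
    moreover have "V \<inter> U - A \<subseteq> U" by blast
    ultimately show ?thesis
      using V A' U by (intro exI[of _ "V \<inter> U"]) (auto simp: m)
  qed
  show "\<exists>K. compact K \<and> K \<subseteq> V \<and> measure (restrict_space M U) (V - K) < e"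
    if V: "open V" "V \<subseteq> U" and e: "e > 0" for V e
  proof -
    obtain K where "compact K" "K \<subseteq> V" "measure M (V - K) < e"
      by (rule fin_regular_inner_open[OF M open_UNIV V(1) _ e]) auto
    moreover have "V - K \<subseteq> U" using V by blast
    ultimately show ?thesis by (intro exI[of _ K]) (simp add: m)
  qed
qed

text \<open>With \<open>C\<close> a bound for \<open>h\<close>, the density is dominated by
  \<open>C\<close> times \<open>M\<close>, hence regular.\<close>

lemma fin_regular_density:
  fixes S :: "'a::t2_space set"
  assumes S: "open S" and M: "fin_regular S M" and h: "bounded_borel h" "\<And>x. 0 \<le> h x"
  shows "fin_regular S (density M h)"
    and "A \<in> borel_on S \<Longrightarrow> measure (density M h) A = (LINT x|M. indicator A x * h x)"
    and "bounded_borel f \<Longrightarrow> (LINT x|density M h. f x) = (LINT x|M. f x * h x)"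
proof -
  interpret finite_measure M by (rule fin_regular_finite[OF M])
  note hm = fin_regular_measurable[OF M bounded_borel_measurable[OF h(1)]]
  have em: "emeasure (density M h) A = ennreal (LINT x|M. indicator A x * h x)"
    and lint: "(LINT x|M. indicator A x * h x) \<ge> 0" and bA: "bounded_borel (\<lambda>x. indicator A x * h x)"
    if A: "A \<in> borel_on S" for A
  proof -
    have Ab: "A \<in> sets borel" using A S by (simp add: borel_on_iff)
    show bb: "bounded_borel (\<lambda>x. indicator A x * h x)"
      by (intro bounded_borel_mult bounded_borel_indicator Ab h)
    have "emeasure (density M h) A = (\<integral>\<^sup>+x. ennreal (indicator A x * h x) \<partial>M)"
      using A hm by (subst emeasure_density)
        (auto simp: fin_regular_sets[OF M] ac_simps intro!: nn_integral_cong split: split_indicator)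
    also have "\<dots> = ennreal (LINT x|M. indicator A x * h x)"
      using h by (intro nn_integral_eq_integral fin_regular_integrable[OF M bb]) auto
    finally show "emeasure (density M h) A = ennreal (LINT x|M. indicator A x * h x)" .
    show "(LINT x|M. indicator A x * h x) \<ge> 0" using h by (intro integral_nonneg_AE) auto
  qed
  show meas: "measure (density M h) A = (LINT x|M. indicator A x * h x)" if "A \<in> borel_on S" for A
    using em[OF that] lint[OF that] by (simp add: measure_def)
  obtain C where C: "C \<ge> 0" "\<And>x. \<bar>h x\<bar> \<le> C" using bounded_borelE[OF h(1)] by blast
  show "fin_regular S (density M h)"
  proof (rule fin_regular_dominated[OF S _ _ M])
    show "sets (density M h) = borel_on S" by (simp add: fin_regular_sets[OF M])
    show "finite_measure (density M h)"
      by (rule finite_measureI) (simp add: fin_regular_space[OF M] em)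
    fix A assume A: "A \<in> borel_on S"
    then have Ab: "A \<in> sets borel" and AS: "A \<subseteq> S" using S by (simp_all add: borel_on_iff)
    have "measure (density M h) A \<le> (LINT x|M. C * indicator A x)"
      unfolding meas[OF A] using C
      by (intro integral_mono fin_regular_integrable[OF M] bA[OF A] bounded_borel_scale bounded_borel_indicator Ab)
        (auto split: split_indicator simp: abs_le_iff)
    also have "\<dots> = C * measure M A"
      using AS by (simp add: fin_regular_space[OF M] Int_absorb2)
    finally show "measure (density M h) A \<le> C * measure M A" .
  qed
  show "(LINT x|density M h. f x) = (LINT x|M. f x * h x)" if f: "bounded_borel f"
    using integral_density[OF fin_regular_measurable[OF M bounded_borel_measurable[OF f]] hm] h(2)
    by (simp add: ac_simps)
qed

text \<open>Cutting a measure down to \<open>K\<close> while keeping it a measure on all of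
  \<open>S\<close> is taking the density \<open>indicator K\<close>. In the density argument
  \<open>K\<close> will be compact.\<close>

lemma fin_regular_trace:
  fixes S :: "'a::t2_space set"
  assumes S: "open S" and M: "fin_regular S M" and K: "K \<in> borel_on S"
  obtains P where "fin_regular S P" "\<And>A. A \<in> borel_on S \<Longrightarrow> measure P A = measure M (A \<inter> K)"
proof (rule that)
  have Kb: "bounded_borel (indicator K)" "K \<subseteq> S"
    using K S by (simp_all add: borel_on_iff bounded_borel_indicator)
  note P = fin_regular_density[OF S M Kb(1)]
  show "fin_regular S (density M (\<lambda>x. ennreal (indicator K x)))" using P(1) by simp
  show "measure (density M (\<lambda>x. ennreal (indicator K x))) A = measure M (A \<inter> K)" if "A \<in> borel_on S" for A
    using P(2)[OF _ that] Kb(2)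
    by (simp add: fin_regular_space[OF M] Int_absorb2 le_infI2 flip: indicator_inter_arith)
qed

text \<open>Multiplying out the positive and negative parts of \<open>h\<close> and
  \<open>\<mu>\<close>, the two products of equal sign make up \<open>P\<close> and the two mixed
  ones make up \<open>N\<close>. The integral may be computed from this pair by
  \<open>signed_integral_eq\<close>.\<close>

lemma density_measure_signed:
  fixes \<mu> :: "'a::t2_space set \<Rightarrow> real"
  assumes \<mu>: "\<mu> \<in> signed_measures" and h: "bounded_borel h"
  shows "density_measure h \<mu> \<in> signed_measures"
    and "bounded_borel f \<Longrightarrow>
      signed_integral UNIV (density_measure h \<mu>) f = signed_integral UNIV \<mu> (\<lambda>x. f x * h x)"
proof -
  interpret signed_regular UNIV \<mu> by (rule signed_regular_UNIV[OF \<mu>])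
  let ?p = "\<lambda>x. max 0 (h x)" and ?n = "\<lambda>x. max 0 (- h x)"
  have "bounded_borel (\<lambda>x. - h x)" using bounded_borel_scale[OF h, of "-1"] by simp
  then have pn: "bounded_borel ?p" "\<And>x. 0 \<le> ?p x" "bounded_borel ?n" "\<And>x. 0 \<le> ?n x"
    using h by (simp_all add: bounded_borel_max)
  note pp = fin_regular_density[OF open_UNIV fin_regular_pos pn(1,2)] and pm = fin_regular_density[OF open_UNIV fin_regular_pos pn(3,4)]
  note mp = fin_regular_density[OF open_UNIV fin_regular_neg pn(1,2)] and mm = fin_regular_density[OF open_UNIV fin_regular_neg pn(3,4)]
  obtain P where P: "fin_regular UNIV P" "\<And>A. measure P A =
      measure (density (jordan_pos UNIV \<mu>) ?p) A + measure (density (jordan_neg UNIV \<mu>) ?n) A"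
    by (rule fin_regular_sum[OF open_UNIV pp(1) mm(1)]) blast
  obtain N where N: "fin_regular UNIV N" "\<And>A. measure N A =
      measure (density (jordan_pos UNIV \<mu>) ?n) A + measure (density (jordan_neg UNIV \<mu>) ?p) A"
    by (rule fin_regular_sum[OF open_UNIV pm(1) mp(1)]) blast
  have split: "(LINT x|M. g x * ?p x) - (LINT x|M. g x * ?n x) = (LINT x|M. g x * h x)"
    if "fin_regular UNIV M" "bounded_borel g" for M g
  proof -
    have "(LINT x|M. g x * ?p x) - (LINT x|M. g x * ?n x) = (LINT x|M. g x * ?p x - g x * ?n x)"
      using that pn by (intro Bochner_Integration.integral_diff[symmetric] fin_regular_integrable[OF that(1)] bounded_borel_mult)
    also have "\<dots> = (LINT x|M. g x * h x)"
      by (rule Bochner_Integration.integral_cong) (auto simp: max_def algebra_simps)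
    finally show ?thesis .
  qed
  have "density_measure h \<mu> A = measure P A - measure N A" for A
  proof (cases "A \<in> sets borel")
    case True
    then have b: "bounded_borel (indicator A)" by (rule bounded_borel_indicator)
    from True show ?thesis
      using split[OF fin_regular_pos b] split[OF fin_regular_neg b]
      by (simp add: density_measure_def signed_integral_def P N pp(2) pm(2) mp(2) mm(2))
  next
    case False
    then show ?thesis by (simp add: density_measure_def measure_notin_sets fin_regular_sets[OF P(1)] fin_regular_sets[OF N(1)])
  qed
  then have eq: "density_measure h \<mu> = measure P - measure N" by (simp add: fun_eq_iff)
  then show "density_measure h \<mu> \<in> signed_measures"
    using signed_regularI[OF open_UNIV P(1) N(1)] by simp
  show "signed_integral UNIV (density_measure h \<mu>) f = signed_integral UNIV \<mu> (\<lambda>x. f x * h x)"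
    if f: "bounded_borel f"
    using signed_integral_eq[OF open_UNIV P(1) N(1) eq f] split[OF fin_regular_pos f] split[OF fin_regular_neg f]
      integral_sum_measure[OF pp(1) mm(1) P f] integral_sum_measure[OF pm(1) mp(1) N f]
    by (simp add: signed_integral_def pp(3)[OF f] pm(3)[OF f] mp(3)[OF f] mm(3)[OF f])
qed

text \<open>The restrictions of the Jordan parts to \<open>U\<close> represent
  \<open>Phi \<mu>\<close> on functions supported in \<open>U\<close>, and \<open>eq_zero\<close>
  makes their difference the only such measure. For functions vanishing off \<open>U\<close>,
  integrals over \<open>U\<close> and over the whole space agree.\<close>

lemma local_measure_Phi:
  fixes \<mu> :: "'a::t2_space set \<Rightarrow> real"
  assumes lc: "locally_compact_space (euclidean :: 'a topology)"
    and \<mu>: "\<mu> \<in> signed_measures" and U: "open U"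
    and f: "bounded_borel f" "\<And>x. x \<notin> U \<Longrightarrow> f x = 0"
  shows "signed_integral U (local_measure (Phi \<mu>) U) f = signed_integral UNIV \<mu> f"
proof -
  interpret signed_regular UNIV \<mu> by (rule signed_regular_UNIV[OF \<mu>])
  let ?P = "restrict_space (jordan_pos UNIV \<mu>) U" and ?N = "restrict_space (jordan_neg UNIV \<mu>) U"
  note P = fin_regular_restrict_space[OF U fin_regular_pos] and N = fin_regular_restrict_space[OF U fin_regular_neg]
  define \<nu> where "\<nu> = measure ?P - measure ?N"
  have \<nu>: "\<nu> \<in> signed_regular_measures U" unfolding \<nu>_def by (rule signed_regularI[OF U P N])
  have int: "(LINT x|restrict_space M U. g x) = (LINT x|M. g x)"
    if "fin_regular UNIV M" "\<And>x. x \<notin> U \<Longrightarrow> g x = 0" for M and g :: "'a \<Rightarrow> real"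
    using U that(2) by (subst integral_restrict_space)
      (auto simp: fin_regular_sets[OF that(1)] fin_regular_space[OF that(1)] intro!: Bochner_Integration.integral_cong split: split_indicator)
  have \<nu>int: "signed_integral U \<nu> g = signed_integral UNIV \<mu> g"
    if "bounded_borel g" "\<And>x. x \<notin> U \<Longrightarrow> g x = 0" for g
    using signed_integral_eq[OF U P N \<nu>_def that(1)] int[OF fin_regular_pos that(2)] int[OF fin_regular_neg that(2)]
    by (simp add: signed_integral_def)
  have "local_measure (Phi \<mu>) U = \<nu>"
    unfolding local_measure_def
  proof (rule the_equality)
    show ex: "\<nu> \<in> signed_regular_measures U \<and>
        (\<forall>k\<in>Cc. fsupp k \<subseteq> U \<longrightarrow> Phi \<mu> k = signed_integral U \<nu> k)"
    proof (intro conjI \<nu> ballI impI)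
      fix k :: "'a \<Rightarrow> real" assume k: "k \<in> Cc" "fsupp k \<subseteq> U"
      then have "k x = 0" if "x \<notin> U" for x using Cc_zero_off[of x k] that by blast
      then show "Phi \<mu> k = signed_integral U \<nu> k"
        using \<nu>int[OF Cc_bounded_borel[OF k(1)]] k(1) by (simp add: Phi_def)
    qed
    fix \<nu>' assume \<nu>': "\<nu>' \<in> signed_regular_measures U \<and>
        (\<forall>k\<in>Cc. fsupp k \<subseteq> U \<longrightarrow> Phi \<mu> k = signed_integral U \<nu>' k)"
    have d: "\<nu>' + - \<nu> \<in> signed_regular_measures U"
      using \<nu> \<nu>' by (intro subspace_add subspace_neg subspace_signed_regular) auto
    interpret d: signed_regular U "\<nu>' + - \<nu>" by unfold_locales fact+
    have "\<nu>' + - \<nu> = 0"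
    proof (rule d.eq_zero[OF lc])
      fix k :: "'a \<Rightarrow> real" assume k: "k \<in> Cc" "fsupp k \<subseteq> U"
      have "signed_integral U (\<nu>' + - \<nu>) k = signed_integral U \<nu>' k - signed_integral U \<nu> k"
        using \<nu> \<nu>' Cc_bounded_borel[OF k(1)]
        by (subst signed_integral_add_measure[OF U])
          (simp_all add: signed_integral_minus_measure[OF U] subspace_neg[OF subspace_signed_regular])
      then show "signed_integral U (\<nu>' + - \<nu>) k = 0" using ex \<nu>' k by simp
    qed
    then show "\<nu>' = \<nu>" by (simp add: add_eq_0_iff)
  qed
  then show ?thesis using \<nu>int[OF f] by simp
qed

lemma Phi_density_measure:
  fixes \<mu> :: "'a::t2_space set \<Rightarrow> real"
  assumes lc: "locally_compact_space (euclidean :: 'a topology)"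
    and \<mu>: "\<mu> \<in> signed_measures" and h: "bounded_borel h"
  shows "Phi (density_measure h \<mu>) = functional_mult h (Phi \<mu>)"
proof (rule ext)
  fix f :: "'a \<Rightarrow> real"
  show "Phi (density_measure h \<mu>) f = functional_mult h (Phi \<mu>) f"
  proof (cases "f \<in> Cc")
    case True
    define U where "U = (SOME U. open U \<and> U \<noteq> {} \<and> compact (closure U) \<and> fsupp f \<subseteq> U)"
    \<comment> \<open>The neighbourhood has to be nonempty even for \<open>f = 0\<close>, so a point
      is added to the support.\<close>
    obtain K :: "'a set" where K: "compact K" "fsupp f \<subseteq> K" "K \<noteq> {}"
      using Cc_compact[OF True] by (metis compact_insert insert_not_empty subset_insertI)
    obtain W L where W: "open W" "compact L" "K \<subseteq> W" "W \<subseteq> L"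
      using lc[unfolded locally_compact_space_compact_closed_compact[OF disjI1[OF Hausdorff_space_t2]]] K(1)
      by (auto simp: compactin_euclidean_iff)
    have "closure W \<subseteq> L" using W by (intro closure_minimal compact_imp_closed)
    then have "compact (closure W)"
      using compact_Int_closed[OF W(2), of "closure W"] by (simp add: Int_absorb1)
    then have ex: "\<exists>U. open U \<and> U \<noteq> {} \<and> compact (closure U) \<and> fsupp f \<subseteq> U"
      using W K by (intro exI[of _ W]) auto
    have U: "open U" "fsupp f \<subseteq> U"
      using someI_ex[OF ex] unfolding U_def by blast+
    have fb: "bounded_borel f" by (rule Cc_bounded_borel[OF True])
    have "functional_mult h (Phi \<mu>) f = signed_integral U (local_measure (Phi \<mu>) U) (\<lambda>x. f x * h x)"
      using True by (simp add: functional_mult_def U_def Let_def)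
    also have "\<dots> = signed_integral UNIV \<mu> (\<lambda>x. f x * h x)"
      using U Cc_zero_off[of _ f]
      by (intro local_measure_Phi[OF lc \<mu>] bounded_borel_mult fb h) auto
    also have "\<dots> = Phi (density_measure h \<mu>) f"
      using True density_measure_signed(2)[OF \<mu> h fb] by (simp add: Phi_def)
    finally show ?thesis ..
  qed (simp add: Phi_def functional_mult_def)
qed

subsection \<open>The total variation norm and suprema of measures\<close>

definition tv_norm :: "('a::t2_space set \<Rightarrow> real) \<Rightarrow> real"
  where "tv_norm \<mu> = total_variation UNIV \<mu> UNIV"

lemma tv_norm_eq: "\<mu> \<in> signed_measures \<Longrightarrow> tv_norm \<mu> = abs_measure \<mu> UNIV"
  by (simp add: tv_norm_def abs_measure_eq signed_regular.total_variation[OF signed_regular_UNIV])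

text \<open>Together with \<open>tv_norm_least\<close>, the first bound describes the norm as the
  supremum of \<open>\<mu> A - \<mu> (- A)\<close> over Borel sets \<open>A\<close>, attained at a
  Hahn set. These expressions are linear in \<open>\<mu>\<close>, which yields the triangle
  inequality and homogeneity and lets bounds pass to limits.\<close>

lemma tv_norm_upper:
  fixes \<mu> :: "'a::t2_space set \<Rightarrow> real"
  assumes \<mu>: "\<mu> \<in> signed_measures" and A: "A \<in> sets borel"
  shows "\<bar>\<mu> A - \<mu> (- A)\<bar> \<le> tv_norm \<mu>"
    and "\<bar>\<mu> A\<bar> \<le> tv_norm \<mu>"
    and "measure (jordan_pos UNIV \<mu>) A \<le> tv_norm \<mu>"
proof -
  interpret signed_regular UNIV \<mu> by (rule signed_regular_UNIV[OF \<mu>])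
  interpret p: signed_regular UNIV mpos by (intro signed_regular_UNIV fin_regular_signed fin_regular_pos) simp
  interpret n: signed_regular UNIV mneg by (intro signed_regular_UNIV fin_regular_signed fin_regular_neg) simp
  have eq: "tv_norm \<mu> = mpos A + mpos (- A) + (mneg A + mneg (- A))"
    using p.additive[of A "- A"] n.additive[of A "- A"] A
    by (simp add: tv_norm_eq[OF \<mu>] abs_measure_eq[OF \<mu>] Compl_partition)
  note J = fun_cong[OF Jordan, of A] fun_cong[OF Jordan, of "- A"]
  note nn = measure_nonneg[of "jordan_pos UNIV \<mu>" A] measure_nonneg[of "jordan_neg UNIV \<mu>" A]
    measure_nonneg[of "jordan_pos UNIV \<mu>" "- A"] measure_nonneg[of "jordan_neg UNIV \<mu>" "- A"]
  show "\<bar>\<mu> A - \<mu> (- A)\<bar> \<le> tv_norm \<mu>"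
    unfolding eq using J nn by (simp add: abs_le_iff del: measure_nonneg)
  show "\<bar>\<mu> A\<bar> \<le> tv_norm \<mu>"
    unfolding eq using J nn by (simp add: abs_le_iff del: measure_nonneg)
  show "mpos A \<le> tv_norm \<mu>" unfolding eq using nn by simp
qed

lemma tv_norm_least:
  fixes \<mu> :: "'a::t2_space set \<Rightarrow> real"
  assumes \<mu>: "\<mu> \<in> signed_measures" and le: "\<And>A. A \<in> sets borel \<Longrightarrow> \<mu> A - \<mu> (- A) \<le> c"
  shows "tv_norm \<mu> \<le> c"
proof -
  interpret signed_regular UNIV \<mu> by (rule signed_regular_UNIV[OF \<mu>])
  obtain Y where "Y \<in> sets borel" "mpos UNIV = \<mu> Y" "mneg UNIV = - \<mu> (- Y)"
    by (rule Hahn_parts) (simp add: Compl_eq_Diff_UNIV)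
  then show ?thesis using le[of Y] by (simp add: tv_norm_eq[OF \<mu>] abs_measure_eq[OF \<mu>])
qed

lemma tv_norm_nonneg: "\<mu> \<in> signed_measures \<Longrightarrow> 0 \<le> tv_norm \<mu>"
  by (simp add: tv_norm_eq abs_measure_eq)

lemma tv_norm_zero_iff:
  assumes \<mu>: "\<mu> \<in> signed_measures" shows "tv_norm \<mu> = 0 \<longleftrightarrow> \<mu> = 0"
proof
  assume 0: "tv_norm \<mu> = 0"
  show "\<mu> = 0"
  proof (rule signed_measures_eqI[OF \<mu>])
    show "\<mu> A = 0 A" if "A \<in> sets borel" for A using tv_norm_upper(2)[OF \<mu> that] 0 by simp
  qed (rule subspace_0[OF subspace_signed_regular])
next
  assume "\<mu> = 0"
  then have "tv_norm \<mu> \<le> 0" using \<mu> by (intro tv_norm_least) auto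
  then show "tv_norm \<mu> = 0" using tv_norm_nonneg[OF \<mu>] by simp
qed

lemma tv_norm_triangle:
  assumes \<mu>: "\<mu> \<in> signed_measures" and \<nu>: "\<nu> \<in> signed_measures"
  shows "tv_norm (\<mu> + \<nu>) \<le> tv_norm \<mu> + tv_norm \<nu>"
proof (rule tv_norm_least)
  show "\<mu> + \<nu> \<in> signed_measures" by (intro subspace_add subspace_signed_regular \<mu> \<nu>)
  show "(\<mu> + \<nu>) A - (\<mu> + \<nu>) (- A) \<le> tv_norm \<mu> + tv_norm \<nu>" if "A \<in> sets borel" for A
    using tv_norm_upper(1)[OF \<mu> that] tv_norm_upper(1)[OF \<nu> that] by simp
qed

lemma tv_norm_scale:
  fixes \<mu> :: "'a::t2_space set \<Rightarrow> real"
  assumes \<mu>: "\<mu> \<in> signed_measures" shows "tv_norm (c *\<^sub>R \<mu>) = \<bar>c\<bar> * tv_norm \<mu>"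
proof -
  have le: "tv_norm (c *\<^sub>R \<mu>) \<le> \<bar>c\<bar> * tv_norm \<mu>"
    if \<mu>: "\<mu> \<in> signed_measures" for c and \<mu> :: "'a set \<Rightarrow> real"
  proof (rule tv_norm_least)
    show "c *\<^sub>R \<mu> \<in> signed_measures" by (intro subspace_scale subspace_signed_regular \<mu>)
    fix A :: "'a set" assume A: "A \<in> sets borel"
    have "(c *\<^sub>R \<mu>) A - (c *\<^sub>R \<mu>) (- A) \<le> \<bar>c * (\<mu> A - \<mu> (- A))\<bar>"
      by (simp add: scaleR_fun_def right_diff_distrib)
    also have "\<dots> \<le> \<bar>c\<bar> * tv_norm \<mu>"
      unfolding abs_mult by (intro mult_left_mono tv_norm_upper \<mu> A) simp
    finally show "(c *\<^sub>R \<mu>) A - (c *\<^sub>R \<mu>) (- A) \<le> \<bar>c\<bar> * tv_norm \<mu>" .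
  qed
  show ?thesis
  proof (cases "c = 0")
    case True
    then show ?thesis using tv_norm_zero_iff[OF subspace_0[OF subspace_signed_regular], where 'a='a] by simp
  next
    case False
    \<comment> \<open>The inequality already shown, applied to \<open>inverse c\<close> and
      \<open>c *\<^sub>R \<mu>\<close>, is the reverse one.\<close>
    have "tv_norm (inverse c *\<^sub>R c *\<^sub>R \<mu>) \<le> \<bar>inverse c\<bar> * tv_norm (c *\<^sub>R \<mu>)"
      by (intro le subspace_scale subspace_signed_regular \<mu>)
    then have "\<bar>c\<bar> * tv_norm \<mu> \<le> tv_norm (c *\<^sub>R \<mu>)" using False by (simp add: field_simps)
    then show ?thesis using le[OF \<mu>, of c] by simp
  qed
qed

text \<open>The sum of the positive parts of \<open>\<nu>\<close> and \<open>\<mu> - \<nu>\<close>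
  is a measure above \<open>\<mu>\<close>, so it is above the positive part of \<open>\<mu>\<close>.
  Consequently the positive parts of a Cauchy sequence are Cauchy uniformly over all Borel
  sets.\<close>

lemma mpos_diff_le:
  fixes \<mu> \<nu> :: "'a::t2_space set \<Rightarrow> real"
  assumes \<mu>: "\<mu> \<in> signed_measures" and \<nu>: "\<nu> \<in> signed_measures" and A: "A \<in> sets borel"
  shows "measure (jordan_pos UNIV \<mu>) A - measure (jordan_pos UNIV \<nu>) A \<le> tv_norm (\<mu> - \<nu>)"
proof -
  have d: "\<mu> - \<nu> \<in> signed_measures" by (intro subspace_diff subspace_signed_regular \<mu> \<nu>)
  interpret \<mu>: signed_regular UNIV \<mu> by (rule signed_regular_UNIV[OF \<mu>])
  interpret \<nu>: signed_regular UNIV \<nu> by (rule signed_regular_UNIV[OF \<nu>])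
  interpret d: signed_regular UNIV "\<mu> - \<nu>" by (rule signed_regular_UNIV[OF d])
  obtain P where P: "fin_regular UNIV P" "\<And>A. measure P A = \<nu>.mpos A + d.mpos A"
    by (rule fin_regular_sum[OF open_UNIV \<nu>.fin_regular_pos d.fin_regular_pos]) blast
  have diff_le: "\<mu> A \<le> \<nu>.mpos A + d.mpos A" for A
    using fun_cong[OF \<nu>.Jordan, of A] fun_cong[OF d.Jordan, of A]
      measure_nonneg[of "jordan_neg UNIV \<nu>" A] measure_nonneg[of "jordan_neg UNIV (\<mu> - \<nu>)" A]
    by (simp del: measure_nonneg)
  have "\<mu>.mpos A \<le> measure P A"
    using A by (intro \<mu>.mpos_least fin_regular_sets[OF P(1)] fin_regular_finite[OF P(1)]) (auto simp: P(2) diff_le)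
  then show ?thesis using tv_norm_upper(3)[OF d A] by (simp add: P(2))
qed

text \<open>Additivity and positivity pass to pointwise limits. Continuity at the empty set and
  regularity pass because one measure \<open>P n\<close> is within \<open>e / 2\<close> of the limit
  on all Borel sets at once.\<close>

lemma fin_regular_uniform_limit:
  fixes P :: "nat \<Rightarrow> 'a::t2_space measure"
  assumes P: "\<And>n. fin_regular UNIV (P n)"
    and Cauchy: "\<And>e. e > 0 \<Longrightarrow> \<exists>N. \<forall>m\<ge>N. \<forall>n\<ge>N. \<forall>A\<in>sets borel. \<bar>measure (P m) A - measure (P n) A\<bar> < e"
  obtains Q where "fin_regular UNIV Q" "\<And>A. (\<lambda>n. measure (P n) A) \<longlonglongrightarrow> measure Q A"
proof -
  define q where "q A = lim (\<lambda>n. measure (P n) A)" for A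
  have lim: "(\<lambda>n. measure (P n) A) \<longlonglongrightarrow> q A" if A: "A \<in> sets borel" for A
  proof -
    have "Cauchy (\<lambda>n. measure (P n) A)"
      unfolding Cauchy_def dist_real_def using Cauchy A by meson
    then show ?thesis unfolding q_def by (simp add: Cauchy_convergent convergent_LIMSEQ_iff[symmetric])
  qed
  have unif: "\<exists>n. \<forall>A\<in>sets borel. \<bar>measure (P n) A - q A\<bar> \<le> e" if e: "e > 0" for e
  proof -
    obtain N where N: "\<And>m n A. m \<ge> N \<Longrightarrow> n \<ge> N \<Longrightarrow> A \<in> sets borel \<Longrightarrow> \<bar>measure (P m) A - measure (P n) A\<bar> < e"
      using Cauchy[OF e] by blast
    have "\<bar>measure (P N) A - q A\<bar> \<le> e" if A: "A \<in> sets borel" for A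
    proof (rule LIMSEQ_le_const2)
      show "(\<lambda>n. \<bar>measure (P N) A - measure (P n) A\<bar>) \<longlonglongrightarrow> \<bar>measure (P N) A - q A\<bar>"
        by (intro tendsto_intros lim A)
    qed (use N[OF order_refl _ A] in \<open>auto intro: less_imp_le\<close>)
    then show ?thesis by blast
  qed
  interpret continuous_setfun UNIV q
  proof
    fix A B :: "'a set" assume AB: "A \<in> borel_on UNIV" "B \<in> borel_on UNIV" "A \<inter> B = {}"
    have "measure (P n) (A \<union> B) = measure (P n) A + measure (P n) B" for n
      using AB by (intro finite_measure.finite_measure_Union fin_regular_finite[OF P]) (simp_all add: fin_regular_sets[OF P])
    then have "(\<lambda>n. measure (P n) (A \<union> B)) \<longlonglongrightarrow> q A + q B"
      using tendsto_add[OF lim[of A] lim[of B]] AB by simp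
    then show "q (A \<union> B) = q A + q B" using AB by (intro LIMSEQ_unique[OF lim[of "A \<union> B"]]) auto
  next
    fix A :: "'a set" assume A: "A \<in> borel_on UNIV"
    show "0 \<le> q A" by (rule LIMSEQ_le_const[OF lim]) (use A in auto)
  next
    fix C :: "nat \<Rightarrow> 'a set" assume C: "range C \<subseteq> borel_on UNIV" "decseq C" "(\<Inter>i. C i) = {}"
    show "(\<lambda>i. q (C i)) \<longlonglongrightarrow> 0"
    proof (rule LIMSEQ_I)
      fix e :: real assume e: "e > 0"
      obtain n where n: "\<forall>A\<in>sets borel. \<bar>measure (P n) A - q A\<bar> \<le> e / 2" using unif[of "e / 2"] e by auto
      have "(\<lambda>i. measure (P n) (C i)) \<longlonglongrightarrow> 0"
        using finite_measure.finite_Lim_measure_decseq[OF fin_regular_finite[OF P[of n]], of C] C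
        by (simp add: fin_regular_sets[OF P])
      from LIMSEQ_D[OF this, of "e / 2"] e obtain N where N: "\<And>i. i \<ge> N \<Longrightarrow> measure (P n) (C i) < e / 2"
        by auto
      have "norm (q (C i) - 0) < e" if "i \<ge> N" for i
      proof -
        have "C i \<in> sets borel" using C(1) by auto
        then have "\<bar>measure (P n) (C i) - q (C i)\<bar> \<le> e / 2" using n by blast
        then show ?thesis
          using N[OF that] measure_nonneg[of "P n" "C i"] unfolding real_norm_def by linarith
      qed
      then show "\<exists>N. \<forall>i\<ge>N. norm (q (C i) - 0) < e" by blast
    qed
  qed
  show thesis
  proof (rule that)
    show "(\<lambda>n. measure (P n) A) \<longlonglongrightarrow> measure (setfun_measure UNIV q) A" for A
      using lim[of A] by (cases "A \<in> sets borel") (simp_all add: measure_eq measure_notin_sets fin_regular_sets[OF P])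
    show "fin_regular UNIV (setfun_measure UNIV q)"
    proof (rule fin_regular_approx[OF open_UNIV sets_setfun_measure finite])
      fix e :: real assume e: "e > 0"
      obtain n where n: "\<And>A. A \<in> sets borel \<Longrightarrow> \<bar>measure (P n) A - q A\<bar> \<le> e / 2"
        using unif[of "e / 2"] e by auto
      have "measure (setfun_measure UNIV q) A < e" if "A \<in> borel_on UNIV" "measure (P n) A < e / 2" for A
      proof -
        have "\<bar>measure (P n) A - q A\<bar> \<le> e / 2" using n that(1) by simp
        then show ?thesis using that unfolding measure_eq[OF that(1)] by linarith
      qed
      then show "\<exists>M d. fin_regular UNIV M \<and> 0 < d \<and>
          (\<forall>A\<in>borel_on UNIV. measure M A < d \<longrightarrow> measure (setfun_measure UNIV q) A < e)"
        using P e by (intro exI[of _ "P n"] exI[of _ "e / 2"]) auto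
    qed
  qed
qed

text \<open>The limit is the difference of the limits of the Jordan parts. That it is a limit in
  norm follows by letting \<open>m\<close> tend to infinity in the bound for
  \<open>\<mu> n - \<mu> m\<close> at a fixed pair \<open>A\<close>, \<open>- A\<close>.\<close>

lemma tv_norm_complete:
  fixes \<mu> :: "nat \<Rightarrow> 'a::t2_space set \<Rightarrow> real"
  assumes \<mu>: "\<And>n. \<mu> n \<in> signed_measures"
    and Cauchy: "\<And>e. e > 0 \<Longrightarrow> \<exists>N. \<forall>m\<ge>N. \<forall>n\<ge>N. tv_norm (\<mu> m - \<mu> n) < e"
  obtains \<nu> where "\<nu> \<in> signed_measures" "\<And>e. e > 0 \<Longrightarrow> \<exists>N. \<forall>n\<ge>N. tv_norm (\<mu> n - \<nu>) < e"
proof -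
  let ?p = "\<lambda>n. jordan_pos UNIV (\<mu> n)" and ?q = "\<lambda>n. jordan_neg UNIV (\<mu> n)"
  note sr = signed_regular_UNIV[OF \<mu>]
  note rp = signed_regular.fin_regular_pos[OF sr] and rn = signed_regular.fin_regular_neg[OF sr]
  have d: "\<mu> m - \<mu> n \<in> signed_measures" for m n by (intro subspace_diff subspace_signed_regular \<mu>)
  have sym: "tv_norm (\<mu> m - \<mu> n) = tv_norm (\<mu> n - \<mu> m)" for m n
    using tv_norm_scale[OF d, of "-1" m n] by simp
  have p: "\<bar>measure (?p m) A - measure (?p n) A\<bar> \<le> tv_norm (\<mu> m - \<mu> n)" if "A \<in> sets borel" for m n A
    using mpos_diff_le[OF \<mu>[of m] \<mu>[of n] that] mpos_diff_le[OF \<mu>[of n] \<mu>[of m] that] sym[of m n]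
    by (simp add: abs_le_iff)
  \<comment> \<open>The negative part is the positive part minus the measure, so its change is
    bounded by two changes, each at most the norm.\<close>
  have q: "\<bar>measure (?q m) A - measure (?q n) A\<bar> \<le> 2 * tv_norm (\<mu> m - \<mu> n)" if "A \<in> sets borel" for m n A
    using p[OF that, of m n] tv_norm_upper(2)[OF d[of m n] that]
      fun_cong[OF signed_regular.Jordan[OF sr[of m]], of A]
      fun_cong[OF signed_regular.Jordan[OF sr[of n]], of A]
    by simp
  obtain P where P: "fin_regular UNIV P" "\<And>A. (\<lambda>n. measure (?p n) A) \<longlonglongrightarrow> measure P A"
  proof (rule fin_regular_uniform_limit[OF rp])
    fix e :: real assume "e > 0"
    then show "\<exists>N. \<forall>m\<ge>N. \<forall>n\<ge>N. \<forall>A\<in>sets borel. \<bar>measure (?p m) A - measure (?p n) A\<bar> < e"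
      using Cauchy[of e] p by (meson le_less_trans)
  qed blast
  obtain Q where Q: "fin_regular UNIV Q" "\<And>A. (\<lambda>n. measure (?q n) A) \<longlonglongrightarrow> measure Q A"
  proof (rule fin_regular_uniform_limit[OF rn])
    fix e :: real assume "e > 0"
    then obtain N where N: "\<forall>m\<ge>N. \<forall>n\<ge>N. tv_norm (\<mu> m - \<mu> n) < e / 2" using Cauchy[of "e / 2"] by auto
    have "\<bar>measure (?q m) A - measure (?q n) A\<bar> < e" if "m \<ge> N" "n \<ge> N" "A \<in> sets borel" for m n A
      using q[OF that(3), of m n] N that by fastforce
    then show "\<exists>N. \<forall>m\<ge>N. \<forall>n\<ge>N. \<forall>A\<in>sets borel. \<bar>measure (?q m) A - measure (?q n) A\<bar> < e" by blast
  qed blast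
  define \<nu> where "\<nu> = measure P - measure Q"
  have \<nu>: "\<nu> \<in> signed_measures" unfolding \<nu>_def by (rule signed_regularI[OF open_UNIV P(1) Q(1)])
  have lim: "(\<lambda>n. \<mu> n A) \<longlonglongrightarrow> \<nu> A" for A
  proof -
    have "\<mu> n A = measure (?p n) A - measure (?q n) A" for n
      using fun_cong[OF signed_regular.Jordan[OF sr[of n]], of A] by simp
    then show ?thesis using tendsto_diff[OF P(2)[of A] Q(2)[of A]] by (simp add: \<nu>_def)
  qed
  show thesis
  proof (rule that[OF \<nu>])
    fix e :: real assume e: "e > 0"
    obtain N where N: "\<And>m n. m \<ge> N \<Longrightarrow> n \<ge> N \<Longrightarrow> tv_norm (\<mu> m - \<mu> n) < e / 2"
      using Cauchy[of "e / 2"] e by auto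
    have "tv_norm (\<mu> n - \<nu>) \<le> e / 2" if n: "n \<ge> N" for n
    proof (rule tv_norm_least)
      show "\<mu> n - \<nu> \<in> signed_measures" by (intro subspace_diff subspace_signed_regular \<mu> \<nu>)
      fix A :: "'a set" assume A: "A \<in> sets borel"
      show "(\<mu> n - \<nu>) A - (\<mu> n - \<nu>) (- A) \<le> e / 2"
      proof (rule LIMSEQ_le_const2)
        show "(\<lambda>m. (\<mu> n - \<mu> m) A - (\<mu> n - \<mu> m) (- A)) \<longlonglongrightarrow> (\<mu> n - \<nu>) A - (\<mu> n - \<nu>) (- A)"
          by (auto intro!: tendsto_intros lim)
        show "\<exists>N. \<forall>m\<ge>N. (\<mu> n - \<mu> m) A - (\<mu> n - \<mu> m) (- A) \<le> e / 2"
          using tv_norm_upper(1)[OF d A, of n] N[OF n] by (meson abs_le_D1 less_imp_le order_trans)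
      qed
    qed
    moreover have "e / 2 < e" using e by simp
    ultimately show "\<exists>N. \<forall>n\<ge>N. tv_norm (\<mu> n - \<nu>) < e" by (meson le_less_trans)
  qed
qed

text \<open>Suprema of genuine measures are available, so the family is made positive: for a fixed
  member \<open>\<alpha>\<close>, the supremum of \<open>A\<close> is \<open>\<alpha>\<close> plus
  the supremum \<open>T\<close> of the positive parts of all \<open>\<mu> - \<alpha>\<close>. An
  upper bound \<open>\<sigma>\<close> of \<open>A\<close> gives the finite regular measure
  \<open>jordan_pos UNIV (\<sigma> - \<alpha>)\<close> above \<open>T\<close>, which makes
  \<open>T\<close> finite and regular.\<close>

lemma dedekind_complete_measure_lattice:
  "dedekind_complete (measure_lattice :: ('a::t2_space set \<Rightarrow> real) gorder)"
  unfolding dedekind_complete_def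
proof (intro allI impI)
  interpret ordered_subspace "measure_lattice :: ('a set \<Rightarrow> real) gorder"
    by (rule ordered_subspace_measure_lattice)
  fix A :: "('a set \<Rightarrow> real) set"
  assume A: "A \<subseteq> carrier measure_lattice" and ne: "A \<noteq> {} \<and> Upper measure_lattice A \<noteq> {}"
  then have AM: "\<And>\<mu>. \<mu> \<in> A \<Longrightarrow> \<mu> \<in> signed_measures" by auto
  obtain \<alpha> where \<alpha>: "\<alpha> \<in> A" using ne by blast
  define T where "T = (SUP \<mu>\<in>A. jordan_pos UNIV (\<mu> - \<alpha>))"
  have d: "\<mu> - \<alpha> \<in> signed_measures" if "\<mu> \<in> signed_measures" for \<mu>
    using that AM[OF \<alpha>] by (intro subspace_diff subspace_signed_regular)
  have rp: "fin_regular UNIV (jordan_pos UNIV (\<mu> - \<alpha>))" if "\<mu> \<in> signed_measures" for \<mu>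
    by (rule signed_regular.fin_regular_pos[OF signed_regular_UNIV[OF d[OF that]]])
  have setsT: "sets T = sets (borel :: 'a measure)"
    unfolding T_def using \<alpha> fin_regular_sets[OF rp[OF AM]] by (intro sets_SUP) auto
  have upper: "jordan_pos UNIV (\<mu> - \<alpha>) \<le> jordan_pos UNIV (\<sigma> - \<alpha>)"
    if \<mu>: "\<mu> \<in> A" and \<sigma>: "\<sigma> \<in> signed_measures" "\<And>\<mu>. \<mu> \<in> A \<Longrightarrow> \<mu> \<sqsubseteq>\<^bsub>measure_lattice\<^esub> \<sigma>" for \<mu> \<sigma>
  proof -
    interpret \<mu>: signed_regular UNIV "\<mu> - \<alpha>" by (rule signed_regular_UNIV[OF d[OF AM[OF \<mu>]]])
    interpret \<sigma>: signed_regular UNIV "\<sigma> - \<alpha>" by (rule signed_regular_UNIV[OF d[OF \<sigma>(1)]])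
    have "(\<mu> - \<alpha>) B \<le> \<sigma>.mpos B" if "B \<in> sets borel" for B
    proof -
      have "\<mu> B \<le> \<sigma> B" using \<sigma>(2)[OF \<mu>] that by simp
      then show ?thesis
        using fun_cong[OF \<sigma>.Jordan, of B] measure_nonneg[of "jordan_neg UNIV (\<sigma> - \<alpha>)" B]
        by (simp del: measure_nonneg)
    qed
    then have "\<mu>.mpos B \<le> \<sigma>.mpos B" if "B \<in> sets borel" for B
      using that by (intro \<mu>.mpos_least fin_regular_sets[OF \<sigma>.fin_regular_pos] fin_regular_finite[OF \<sigma>.fin_regular_pos]) auto
    then show ?thesis
      by (subst le_measure)
        (simp_all add: fin_regular_sets[OF \<mu>.fin_regular_pos] fin_regular_sets[OF \<sigma>.fin_regular_pos]
          finite_measure.emeasure_eq_measure[OF fin_regular_finite[OF \<mu>.fin_regular_pos]]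
          finite_measure.emeasure_eq_measure[OF fin_regular_finite[OF \<sigma>.fin_regular_pos]])
  qed
  obtain \<sigma> where \<sigma>: "\<sigma> \<in> signed_measures" "\<And>\<mu>. \<mu> \<in> A \<Longrightarrow> \<mu> \<sqsubseteq>\<^bsub>measure_lattice\<^esub> \<sigma>"
    using ne A by (auto simp: Upper_def)
  have T_le: "emeasure T B \<le> emeasure (jordan_pos UNIV (\<tau> - \<alpha>)) B"
    if \<tau>: "\<tau> \<in> signed_measures" "\<And>\<mu>. \<mu> \<in> A \<Longrightarrow> \<mu> \<sqsubseteq>\<^bsub>measure_lattice\<^esub> \<tau>" for \<tau> B
    using upper[OF _ \<tau>] fin_regular_sets[OF rp[OF \<tau>(1)]] unfolding T_def[symmetric]
    by (intro le_measureD3) (auto simp: setsT, auto simp: T_def intro: SUP_least)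
  interpret fs: finite_measure "jordan_pos UNIV (\<sigma> - \<alpha>)" by (rule fin_regular_finite[OF rp[OF \<sigma>(1)]])
  have finT: "finite_measure T"
    using T_le[OF \<sigma>, of "space T"] fs.emeasure_finite[of "space T"] by (intro finite_measureI) (auto simp: top_unique)
  then interpret T: finite_measure T .
  have T_le': "measure T B \<le> measure (jordan_pos UNIV (\<tau> - \<alpha>)) B"
    if \<tau>: "\<tau> \<in> signed_measures" "\<And>\<mu>. \<mu> \<in> A \<Longrightarrow> \<mu> \<sqsubseteq>\<^bsub>measure_lattice\<^esub> \<tau>" for \<tau> B
    using T_le[OF \<tau>, of B]
    by (simp add: T.emeasure_eq_measure finite_measure.emeasure_eq_measure[OF fin_regular_finite[OF rp[OF \<tau>(1)]]])
  have T: "fin_regular UNIV T"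
    using T_le'[OF \<sigma>] by (intro fin_regular_dominated[OF open_UNIV _ finT rp[OF \<sigma>(1)], of 1]) (simp_all add: setsT)
  have s: "\<alpha> + measure T \<in> signed_measures"
    by (intro subspace_add subspace_signed_regular AM \<alpha> fin_regular_signed T open_UNIV)
  have above: "\<mu> B \<le> (\<alpha> + measure T) B" if \<mu>: "\<mu> \<in> A" and B: "B \<in> sets borel" for \<mu> B
  proof -
    interpret \<mu>: signed_regular UNIV "\<mu> - \<alpha>" by (rule signed_regular_UNIV[OF d[OF AM[OF \<mu>]]])
    have "jordan_pos UNIV (\<mu> - \<alpha>) \<le> T" unfolding T_def using \<mu> by (rule SUP_upper)
    then have "emeasure (jordan_pos UNIV (\<mu> - \<alpha>)) B \<le> emeasure T B"
      by (rule le_measureD3) (simp add: setsT fin_regular_sets[OF \<mu>.fin_regular_pos])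
    then have "\<mu>.mpos B \<le> measure T B"
      by (simp add: T.emeasure_eq_measure finite_measure.emeasure_eq_measure[OF fin_regular_finite[OF \<mu>.fin_regular_pos]])
    then show ?thesis
      using fun_cong[OF \<mu>.Jordan, of B] measure_nonneg[of "jordan_neg UNIV (\<mu> - \<alpha>)" B]
      by (simp del: measure_nonneg)
  qed
  have least: "(\<alpha> + measure T) B \<le> \<tau> B"
    if \<tau>: "\<tau> \<in> signed_measures" "\<And>\<mu>. \<mu> \<in> A \<Longrightarrow> \<mu> \<sqsubseteq>\<^bsub>measure_lattice\<^esub> \<tau>" and B: "B \<in> sets borel" for \<tau> B
  proof -
    \<comment> \<open>As \<open>\<alpha>\<close> belongs to \<open>A\<close>, the difference
      \<open>\<tau> - \<alpha>\<close> is positive and so dominates its own positive part.\<close>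
    have "measure (jordan_pos UNIV (\<tau> - \<alpha>)) \<sqsubseteq>\<^bsub>measure_lattice\<^esub> \<tau> - \<alpha>"
      using measure_lattice_lub_pos[OF d[OF \<tau>(1)]] d[OF \<tau>(1)] \<tau>(2)[OF \<alpha>] closed(5)
      by (subst (asm) is_lub_pair_iff) auto
    then show ?thesis using T_le'[OF \<tau>, of B] B by fastforce
  qed
  have "is_lub measure_lattice (\<alpha> + measure T) A"
    unfolding is_lub_iff[OF A] using s above least by simp
  then show "\<exists>s. is_lub measure_lattice s A" by blast
qed

subsection \<open>The image of the embedding\<close>

lemma Metric_space_norm_metric:
  assumes V: "subspace V"
    and nonneg: "\<And>x. x \<in> V \<Longrightarrow> 0 \<le> N x" and zero: "\<And>x. x \<in> V \<Longrightarrow> N x = 0 \<longleftrightarrow> x = 0"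
    and triangle: "\<And>x y. x \<in> V \<Longrightarrow> y \<in> V \<Longrightarrow> N (x + y) \<le> N x + N y"
    and scale: "\<And>c x. x \<in> V \<Longrightarrow> N (c *\<^sub>R x) = \<bar>c\<bar> * N x"
  shows "Metric_space V (norm_metric V N)"
proof
  note d = subspace_diff[OF V]
  show "0 \<le> norm_metric V N x y" for x y by (simp add: norm_metric_def nonneg d)
  show "norm_metric V N x y = norm_metric V N y x" for x y
    using scale[of "x - y" "-1"] d[of x y] by (simp add: norm_metric_def)
  show "norm_metric V N x y = 0 \<longleftrightarrow> x = y" if "x \<in> V" "y \<in> V" for x y
    using that by (simp add: norm_metric_def zero d)
  show "norm_metric V N x z \<le> norm_metric V N x y + norm_metric V N y z"
    if "x \<in> V" "y \<in> V" "z \<in> V" for x y z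
    using triangle[of "x - y" "y - z"] that by (simp add: norm_metric_def d)
qed

context
  assumes lc: "locally_compact_space (euclidean :: 'a::t2_space topology)"
begin

abbreviation range_Phi :: "(('a \<Rightarrow> real) \<Rightarrow> real) set"
  where "range_Phi \<equiv> Phi ` signed_measures"

abbreviation Phi_lat :: "(('a \<Rightarrow> real) \<Rightarrow> real) gorder"
  where "Phi_lat \<equiv> Phi_lattice"

lemma subspace_range_Phi: "subspace range_Phi"
  unfolding subspace_def
proof (intro conjI ballI allI)
  note S = subspace_signed_regular[of "UNIV :: 'a set"]
  show "0 \<in> range_Phi" using subspace_0[OF S] by (auto simp: Phi_zero[symmetric])
  show "\<phi> + \<psi> \<in> range_Phi" if "\<phi> \<in> range_Phi" "\<psi> \<in> range_Phi" for \<phi> \<psi>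
    using that subspace_add[OF S] by (auto simp: Phi_add[symmetric])
  show "c *\<^sub>R \<phi> \<in> range_Phi" if "\<phi> \<in> range_Phi" for c \<phi>
    using that subspace_scale[OF S] by (auto simp: Phi_scale[symmetric])
qed

lemma range_Phi_subset: "range_Phi \<subseteq> order_bounded_functionals"
  using Phi_functional by blast

lemma carrier_Phi_lattice: "carrier Phi_lat = range_Phi"
  by (simp add: Phi_lattice_def)

lemma ordered_subspace_Phi_lattice: "ordered_subspace Phi_lat"
  unfolding Phi_lattice_def
  using range_Phi_subset subspace_range_Phi
  by (intro ordered_subspace.ordered_subspace_restrict ordered_subspace_order_dual) simp_all

lemma is_lub_Phi_lattice:
  assumes "is_lub order_dual s A" "A \<subseteq> range_Phi" "s \<in> range_Phi" shows "is_lub Phi_lat s A"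
  unfolding Phi_lattice_def
  using assms range_Phi_subset
  by (intro ordered_subspace.is_lub_restrict ordered_subspace_order_dual) simp_all

lemma Phi_lattice_le:
  "\<mu> \<in> signed_measures \<Longrightarrow> \<nu> \<in> signed_measures \<Longrightarrow>
    Phi \<mu> \<sqsubseteq>\<^bsub>Phi_lat\<^esub> Phi \<nu> \<longleftrightarrow> \<mu> \<sqsubseteq>\<^bsub>measure_lattice\<^esub> \<nu>"
  using Phi_le_iff[OF lc] by (simp add: Phi_lattice_def)

lemma vl_abs_Phi_lattice:
  fixes \<mu> :: "'a set \<Rightarrow> real"
  assumes \<mu>: "\<mu> \<in> signed_measures" shows "vl_abs Phi_lat (Phi \<mu>) = Phi (abs_measure \<mu>)"
  unfolding vl_abs_def
  using \<mu> subspace_neg[OF subspace_range_Phi, of "Phi \<mu>"]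
  by (intro ordered_subspace.join_eq[OF ordered_subspace_Phi_lattice] is_lub_Phi_lattice
      Phi_abs_lub[OF lc]) (auto intro: abs_measure_signed)

text \<open>Injectivity makes the chosen preimage in \<open>Phi_norm\<close> the original measure,
  so \<open>Phi\<close> is an isometry by construction.\<close>

lemma Phi_norm_eq: "\<mu> \<in> signed_measures \<Longrightarrow> Phi_norm (Phi \<mu>) = tv_norm (\<mu> :: 'a set \<Rightarrow> real)"
  by (simp add: Phi_norm_def tv_norm_def inv_into_f_f[OF inj_on_Phi[OF lc]])

lemma Phi_norm:
  assumes \<phi>: "\<phi> \<in> range_Phi"
  shows "0 \<le> Phi_norm \<phi>" "Phi_norm \<phi> = 0 \<longleftrightarrow> \<phi> = 0"
    and "\<psi> \<in> range_Phi \<Longrightarrow> Phi_norm (\<phi> + \<psi>) \<le> Phi_norm \<phi> + Phi_norm \<psi>"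
    and "Phi_norm (c *\<^sub>R \<phi>) = \<bar>c\<bar> * Phi_norm \<phi>"
proof -
  note S = subspace_signed_regular[of "UNIV :: 'a set"]
  obtain \<mu> where \<mu>: "\<mu> \<in> signed_measures" "\<phi> = Phi \<mu>" using \<phi> by blast
  show "0 \<le> Phi_norm \<phi>" using \<mu> by (simp add: Phi_norm_eq tv_norm_nonneg)
  have "Phi \<mu> = 0 \<longleftrightarrow> \<mu> = 0"
    using inj_on_eq_iff[OF inj_on_Phi[OF lc] \<mu>(1) subspace_0[OF S]] by (simp add: Phi_zero)
  then show "Phi_norm \<phi> = 0 \<longleftrightarrow> \<phi> = 0" using \<mu> by (simp add: Phi_norm_eq tv_norm_zero_iff)
  show "Phi_norm (c *\<^sub>R \<phi>) = \<bar>c\<bar> * Phi_norm \<phi>"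
    using \<mu> subspace_scale[OF S \<mu>(1)] by (simp add: Phi_norm_eq tv_norm_scale flip: Phi_scale)
  show "Phi_norm (\<phi> + \<psi>) \<le> Phi_norm \<phi> + Phi_norm \<psi>" if \<psi>: "\<psi> \<in> range_Phi"
  proof -
    obtain \<nu> where "\<nu> \<in> signed_measures" "\<psi> = Phi \<nu>" using \<psi> by blast
    then show ?thesis
      using \<mu> subspace_add[OF S \<mu>(1)] by (simp add: Phi_norm_eq tv_norm_triangle flip: Phi_add)
  qed
qed

lemma Metric_space_Phi: "Metric_space range_Phi (norm_metric range_Phi Phi_norm)"
  by (intro Metric_space_norm_metric subspace_range_Phi Phi_norm)

lemma norm_metric_Phi:
  fixes \<mu> \<nu> :: "'a set \<Rightarrow> real"
  assumes "\<mu> \<in> signed_measures" "\<nu> \<in> signed_measures"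
  shows "norm_metric range_Phi Phi_norm (Phi \<mu>) (Phi \<nu>) = tv_norm (\<mu> - \<nu>)"
  using assms subspace_diff[OF subspace_signed_regular assms]
  by (simp add: norm_metric_def Phi_norm_eq flip: Phi_diff)

text \<open>Positive parts formed in the whole order dual lie in the image by
  \<open>Phi_lub_pos\<close>, so they serve as positive parts there. Completeness and monotonicity
  of the norm are pulled back to measures, where the norm is the mass of the modulus.\<close>

lemma banach_lattice_Phi: "banach_lattice Phi_lat Phi_norm"
proof -
  interpret Metric_space range_Phi "norm_metric range_Phi Phi_norm" by (rule Metric_space_Phi)
  have "vector_lattice Phi_lat"
  proof (rule ordered_subspace.vector_latticeI[OF ordered_subspace_Phi_lattice])
    fix \<phi> assume "\<phi> \<in> carrier Phi_lat"
    then obtain \<mu> :: "'a set \<Rightarrow> real" where \<mu>: "\<mu> \<in> signed_measures" "\<phi> = Phi \<mu>"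
      by (auto simp: carrier_Phi_lattice)
    have "measure (jordan_pos UNIV \<mu>) \<in> signed_measures"
      by (intro fin_regular_signed signed_regular.fin_regular_pos signed_regular_UNIV \<mu>) simp
    then have "is_lub Phi_lat (Phi (measure (jordan_pos UNIV \<mu>))) {\<phi>, 0}"
      using \<mu> subspace_0[OF subspace_range_Phi]
      by (intro is_lub_Phi_lattice) (auto intro: Phi_lub_pos[OF lc])
    then show "\<exists>s. is_lub Phi_lat s {\<phi>, 0}" by blast
  qed
  then interpret vector_lattice Phi_lat .
  have complete: "mcomplete"
    unfolding mcomplete_def MCauchy_def
  proof (intro allI impI)
    fix \<sigma> :: "nat \<Rightarrow> ('a \<Rightarrow> real) \<Rightarrow> real"
    assume \<sigma>: "range \<sigma> \<subseteq> range_Phi \<and> (\<forall>\<epsilon>>0. \<exists>N. \<forall>n n'. N \<le> n \<longrightarrow> N \<le> n' \<longrightarrow>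
      norm_metric range_Phi Phi_norm (\<sigma> n) (\<sigma> n') < \<epsilon>)"
    then have "\<forall>n. \<exists>\<mu>. \<mu> \<in> signed_measures \<and> \<sigma> n = Phi \<mu>" by blast
    then obtain \<mu> where \<mu>: "\<And>n. \<mu> n \<in> signed_measures" "\<And>n. \<sigma> n = Phi (\<mu> n)" by metis
    obtain \<nu> where \<nu>: "\<nu> \<in> signed_measures" "\<And>e. e > 0 \<Longrightarrow> \<exists>N. \<forall>n\<ge>N. tv_norm (\<mu> n - \<nu>) < e"
    proof (rule tv_norm_complete[OF \<mu>(1)])
      show "\<exists>N. \<forall>m\<ge>N. \<forall>n\<ge>N. tv_norm (\<mu> m - \<mu> n) < e" if "e > 0" for e :: real
        using conjunct2[OF \<sigma>] that by (fastforce simp: \<mu>(2) norm_metric_Phi[OF \<mu>(1) \<mu>(1)])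
    qed blast
    then have "limitin mtopology \<sigma> (Phi \<nu>) sequentially"
      unfolding limit_metric_sequentially using \<mu> by (simp add: norm_metric_Phi)
    then show "\<exists>x. limitin mtopology \<sigma> x sequentially" by blast
  qed
  show ?thesis
  proof
    fix \<phi> \<psi> assume \<phi>: "\<phi> \<in> carrier Phi_lat" and \<psi>: "\<psi> \<in> carrier Phi_lat"
      and le: "vl_abs Phi_lat \<phi> \<sqsubseteq>\<^bsub>Phi_lat\<^esub> vl_abs Phi_lat \<psi>"
    obtain \<mu> \<nu> :: "'a set \<Rightarrow> real" where \<mu>: "\<mu> \<in> signed_measures" "\<phi> = Phi \<mu>"
      and \<nu>: "\<nu> \<in> signed_measures" "\<psi> = Phi \<nu>"
      using \<phi> \<psi> by (auto simp: carrier_Phi_lattice)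
    have "abs_measure \<mu> \<sqsubseteq>\<^bsub>measure_lattice\<^esub> abs_measure \<nu>"
      using le \<mu> \<nu> by (simp only: vl_abs_Phi_lattice Phi_lattice_le abs_measure_signed)
    then show "Phi_norm \<phi> \<le> Phi_norm \<psi>" using \<mu> \<nu> by (simp add: Phi_norm_eq tv_norm_eq)
  qed (use complete in \<open>simp_all add: carrier_Phi_lattice Phi_norm\<close>)
qed

text \<open>Boundedness and suprema are understood inside the image, whose elements all come from
  measures; there \<open>Phi\<close> is an order isomorphism, and the supremum is the image of the
  one for measures.\<close>

lemma dedekind_complete_Phi: "dedekind_complete Phi_lat"
  unfolding dedekind_complete_def carrier_Phi_lattice
proof (intro allI impI)
  interpret ml: ordered_subspace "measure_lattice :: ('a set \<Rightarrow> real) gorder"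
    by (rule ordered_subspace_measure_lattice)
  interpret pl: ordered_subspace Phi_lat by (rule ordered_subspace_Phi_lattice)
  fix A assume A: "A \<subseteq> range_Phi" and ne: "A \<noteq> {} \<and> Upper Phi_lat A \<noteq> {}"
  define B where "B = {\<mu> \<in> signed_measures. Phi \<mu> \<in> A}"
  have AB: "A = Phi ` B" and BM: "B \<subseteq> signed_measures" using A by (auto simp: B_def)
  obtain \<sigma> where "\<sigma> \<in> signed_measures" "\<forall>\<mu>\<in>B. Phi \<mu> \<sqsubseteq>\<^bsub>Phi_lat\<^esub> Phi \<sigma>"
    using ne A unfolding AB by (auto simp: Upper_def carrier_Phi_lattice)
  then have "\<sigma> \<in> Upper measure_lattice B"
    using BM Phi_lattice_le by (auto simp: Upper_def)
  moreover have "B \<noteq> {}" using ne AB by blast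
  ultimately obtain s where s: "is_lub measure_lattice s B"
    using dedekind_complete_measure_lattice[unfolded dedekind_complete_def, THEN spec, of B] BM
    by auto
  then have s: "s \<in> signed_measures" "\<forall>\<mu>\<in>B. \<mu> \<sqsubseteq>\<^bsub>measure_lattice\<^esub> s"
    "\<And>\<tau>. \<tau> \<in> signed_measures \<Longrightarrow> \<forall>\<mu>\<in>B. \<mu> \<sqsubseteq>\<^bsub>measure_lattice\<^esub> \<tau> \<Longrightarrow> s \<sqsubseteq>\<^bsub>measure_lattice\<^esub> \<tau>"
    using BM by (auto simp: ml.is_lub_iff simp del: measure_lattice_simps(3))
  have "is_lub Phi_lat (Phi s) A"
    unfolding pl.is_lub_iff[OF A[folded carrier_Phi_lattice]] unfolding AB carrier_Phi_lattice
  proof (intro conjI ballI impI)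
    show "Phi s \<in> range_Phi" using s(1) by blast
    show "\<phi> \<sqsubseteq>\<^bsub>Phi_lat\<^esub> Phi s" if "\<phi> \<in> Phi ` B" for \<phi>
      using that s(1,2) BM Phi_lattice_le by blast
    fix \<psi> assume "\<psi> \<in> range_Phi" and le: "\<forall>\<phi>\<in>Phi ` B. \<phi> \<sqsubseteq>\<^bsub>Phi_lat\<^esub> \<psi>"
    then obtain \<tau> where \<tau>: "\<tau> \<in> signed_measures" "\<psi> = Phi \<tau>" by blast
    then have "\<forall>\<mu>\<in>B. \<mu> \<sqsubseteq>\<^bsub>measure_lattice\<^esub> \<tau>" using le BM Phi_lattice_le by blast
    then show "Phi s \<sqsubseteq>\<^bsub>Phi_lat\<^esub> \<psi>" using s(1,3) \<tau> Phi_lattice_le by blast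
  qed
  then show "\<exists>s. is_lub Phi_lat s A" by blast
qed

text \<open>A function supported off \<open>K\<close> is zero on the set that carries both measures,
  so the functional vanishes on the open set \<open>- K\<close>.\<close>

lemma supp_subset:
  fixes P N :: "'a measure"
  assumes P: "fin_regular UNIV P" and N: "fin_regular UNIV N" and K: "closed K"
    and 0: "measure P (- K) = 0" "measure N (- K) = 0"
  shows "supp (Phi (measure P - measure N)) \<subseteq> K"
proof -
  have int0: "(LINT x|M. f x) = 0"
    if M: "fin_regular UNIV M" "measure M (- K) = 0" and f: "\<And>x. x \<in> K \<Longrightarrow> f x = 0" for M and f :: "'a \<Rightarrow> real"
  proof -
    have "AE x in M. x \<notin> - K"
      using M K by (intro AE_not_in)
        (simp add: null_sets_def fin_regular_sets finite_measure.emeasure_eq_measure[OF fin_regular_finite])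
    then show ?thesis by (intro integral_eq_zero_AE) (auto simp: f)
  qed
  have "vanishes_on (Phi (measure P - measure N)) (- K)"
    unfolding vanishes_on_def
  proof (intro ballI impI)
    fix f :: "'a \<Rightarrow> real" assume f: "f \<in> Cc" "fsupp f \<subseteq> - K"
    then have z: "f x = 0" if "x \<in> K" for x using that Cc_zero_off[of x f] by blast
    show "Phi (measure P - measure N) f = 0"
      using f(1) signed_integral_eq[OF open_UNIV P N refl Cc_bounded_borel[OF f(1)]]
        int0[OF P 0(1) z] int0[OF N 0(2) z] by (simp add: Phi_def)
  qed
  then show ?thesis using K by (auto simp: supp_def)
qed

text \<open>Measures carried by disjoint sets are already the Jordan parts of their difference. With
  the roles exchanged, this also yields the negative part.\<close>

lemma positive_part_disjoint:
  fixes P N :: "'a measure"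
  assumes P: "fin_regular UNIV P" and N: "fin_regular UNIV N" and K: "K \<in> sets borel"
    and 0: "measure P (- K) = 0" "measure N K = 0"
  shows "Phi (measure P - measure N) \<squnion>\<^bsub>order_dual\<^esub> 0 = Phi (measure P)"
proof -
  interpret ml: ordered_subspace "measure_lattice :: ('a set \<Rightarrow> real) gorder"
    by (rule ordered_subspace_measure_lattice)
  interpret P: finite_measure P by (rule fin_regular_finite[OF P])
  interpret N: finite_measure N by (rule fin_regular_finite[OF N])
  let ?\<nu> = "measure P - measure N"
  have \<nu>: "?\<nu> \<in> signed_measures" by (rule signed_regularI[OF open_UNIV P N])
  have PM: "measure P \<in> signed_measures" by (rule fin_regular_signed[OF open_UNIV P])
  have le: "measure P A \<le> \<tau> A"
    if \<tau>: "\<tau> \<in> signed_measures" "\<And>A. A \<in> sets borel \<Longrightarrow> ?\<nu> A \<le> \<tau> A" "\<And>A. A \<in> sets borel \<Longrightarrow> 0 \<le> \<tau> A"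
      and A: "A \<in> sets borel" for \<tau> A
  proof -
    interpret \<tau>: signed_regular UNIV \<tau> by (rule signed_regular_UNIV[OF \<tau>(1)])
    have "measure P (A - K) \<le> measure P (- K)" "measure N (A \<inter> K) \<le> measure N K"
      using A K by (auto intro!: P.finite_measure_mono N.finite_measure_mono simp: fin_regular_sets[OF P] fin_regular_sets[OF N])
    then have "measure P (A - K) = 0" "measure N (A \<inter> K) = 0"
      using 0 measure_nonneg[of P "A - K"] measure_nonneg[of N "A \<inter> K"] by linarith+
    moreover have "measure P A = measure P (A \<inter> K) + measure P (A - K)"
      using A K by (subst P.finite_measure_Union[symmetric]) (auto simp: fin_regular_sets[OF P] Int_Diff_Un)
    ultimately have "measure P A = ?\<nu> (A \<inter> K)" by simp
    also have "\<dots> \<le> \<tau> (A \<inter> K) + \<tau> (A - K)" using \<tau>(2)[of "A \<inter> K"] \<tau>(3)[of "A - K"] A K by simp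
    finally show ?thesis using \<tau>.split[of A K] A K by simp
  qed
  have "is_lub measure_lattice (measure P) {?\<nu>, 0}"
    using \<nu> PM ml.closed(5) le by (subst ml.is_lub_pair_iff) auto
  then have "measure (jordan_pos UNIV ?\<nu>) = measure P"
    using ml.is_lub_unique measure_lattice_lub_pos[OF \<nu>] by blast
  then show ?thesis
    using ordered_subspace.join_eq[OF ordered_subspace_order_dual Phi_lub_pos[OF lc \<nu>]] by simp
qed

lemma dense_disjoint_supports:
  "Metric_space.mtopology range_Phi (norm_metric range_Phi Phi_norm) closure_of
     {\<phi> \<in> range_Phi. compact (supp \<phi>) \<and>
        supp (vl_pos order_dual \<phi>) \<inter> supp (vl_neg order_dual \<phi>) = {}} = range_Phi"
  (is "_ closure_of ?D = _")
proof -
  interpret Metric_space range_Phi "norm_metric range_Phi Phi_norm" by (rule Metric_space_Phi)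
  have "\<exists>\<psi>\<in>?D. \<psi> \<in> mball \<phi> r" if \<phi>: "\<phi> \<in> range_Phi" and r: "r > 0" for \<phi> r
  proof -
    obtain \<mu> :: "'a set \<Rightarrow> real" where \<mu>: "\<mu> \<in> signed_measures" "\<phi> = Phi \<mu>" using \<phi> by blast
    interpret signed_regular UNIV \<mu> by (rule signed_regular_UNIV[OF \<mu>(1)])
    interpret p: signed_regular UNIV mpos
      by (intro signed_regular_UNIV fin_regular_signed fin_regular_pos) simp
    interpret n: signed_regular UNIV mneg
      by (intro signed_regular_UNIV fin_regular_signed fin_regular_neg) simp
    interpret pos: finite_measure "jordan_pos UNIV \<mu>" by (rule fin_regular_finite[OF fin_regular_pos])
    interpret neg: finite_measure "jordan_neg UNIV \<mu>" by (rule fin_regular_finite[OF fin_regular_neg])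
    note [simp] = fin_regular_sets[OF fin_regular_pos] fin_regular_sets[OF fin_regular_neg]
    obtain Y where Y: "Y \<in> sets borel" "mpos (- Y) = 0" "mneg Y = 0"
      by (rule Hahn_parts) (simp add: Compl_eq_Diff_UNIV)
    have b: "Y \<in> borel_on UNIV" "- Y \<in> borel_on UNIV" "r / 2 > 0" using Y r by auto
    obtain K where K: "compact K" "K \<subseteq> Y" "mpos (Y - K) < r / 2"
      by (rule fin_regular_inner[OF fin_regular_pos open_UNIV b(1,3)])
    obtain L where L: "compact L" "L \<subseteq> - Y" "mneg (- Y - L) < r / 2"
      by (rule fin_regular_inner[OF fin_regular_neg open_UNIV b(2,3)])
    have Kb: "K \<in> sets borel" and Lb: "L \<in> sets borel" and KL: "K \<inter> L = {}"
      using K L by (auto simp: compact_imp_closed)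
    obtain P where P: "fin_regular UNIV P" "\<And>A. A \<in> sets borel \<Longrightarrow> measure P A = mpos (A \<inter> K)"
      by (rule fin_regular_trace[OF open_UNIV fin_regular_pos, of K]) (use Kb in auto)
    obtain N where N: "fin_regular UNIV N" "\<And>A. A \<in> sets borel \<Longrightarrow> measure N A = mneg (A \<inter> L)"
      by (rule fin_regular_trace[OF open_UNIV fin_regular_neg, of L]) (use Lb in auto)
    let ?\<nu> = "measure P - measure N"
    have \<nu>: "?\<nu> \<in> signed_measures" by (rule signed_regularI[OF open_UNIV P(1) N(1)])
    \<comment> \<open>Subtracting the zero measure makes \<open>supp_subset\<close>, which is about
      differences, applicable to \<open>P\<close> and to \<open>N\<close> alone.\<close>
    let ?O = "null_measure (restrict_space borel UNIV) :: 'a measure"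
    have null: "fin_regular UNIV ?O" by (rule fin_regular_null) simp
    have PK: "measure P (- K) = 0" "measure P L = 0" and NL: "measure N (- L) = 0" "measure N K = 0"
      using Kb Lb KL by (simp_all add: P N Int_commute)
    have PKL: "measure P (- (K \<union> L)) = 0" "measure N (- (K \<union> L)) = 0"
      using Kb Lb by (simp_all add: P N Int_ac)
    have D: "Phi ?\<nu> \<in> ?D"
    proof (intro CollectI conjI)
      show "Phi ?\<nu> \<in> range_Phi" using \<nu> by blast
      have "supp (Phi ?\<nu>) \<subseteq> K \<union> L"
        using K L PKL by (intro supp_subset P N) (auto simp: compact_imp_closed)
      moreover have "closed (supp (Phi ?\<nu>))" by (auto simp: supp_def)
      ultimately show "compact (supp (Phi ?\<nu>))"
        using compact_Int_closed[OF compact_Un[OF K(1) L(1)], of "supp (Phi ?\<nu>)"] by (simp add: Int_absorb1)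
      have m0: "measure M - measure ?O = measure M" for M :: "'a measure"
        by (simp add: fun_eq_iff)
      \<comment> \<open>The negative part is the positive part of the negated functional, for which
        \<open>L\<close> and \<open>N\<close> play the roles of \<open>K\<close> and
        \<open>P\<close>.\<close>
      have "- Phi ?\<nu> = Phi (measure N - measure P)"
        using Phi_diff[of "measure P" "measure N"] Phi_diff[of "measure N" "measure P"]
          fin_regular_signed[OF open_UNIV P(1)] fin_regular_signed[OF open_UNIV N(1)] by simp
      then have "vl_pos order_dual (Phi ?\<nu>) = Phi (measure P)" "vl_neg order_dual (Phi ?\<nu>) = Phi (measure N)"
        using positive_part_disjoint[OF P(1) N(1) Kb PK(1) NL(2)]
          positive_part_disjoint[OF N(1) P(1) Lb NL(1) PK(2)]
        by (simp_all add: vl_pos_def vl_neg_def)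
      moreover have "supp (Phi (measure P)) \<subseteq> K" "supp (Phi (measure N)) \<subseteq> L"
        using supp_subset[OF P(1) null compact_imp_closed[OF K(1)]] PK
          supp_subset[OF N(1) null compact_imp_closed[OF L(1)]] NL by (simp_all add: m0)
      ultimately show "supp (vl_pos order_dual (Phi ?\<nu>)) \<inter> supp (vl_neg order_dual (Phi ?\<nu>)) = {}"
        using KL by auto
    qed
    have d: "\<mu> - ?\<nu> \<in> signed_measures" by (intro subspace_diff subspace_signed_regular \<mu>(1) \<nu>)
    \<comment> \<open>The error is what the Jordan parts lose off \<open>K\<close> and off
      \<open>L\<close>. Up to the null sets of the Hahn decomposition these are \<open>Y - K\<close>
      and \<open>- Y - L\<close>, each of measure below \<open>r / 2\<close>.\<close>
    have "tv_norm (\<mu> - ?\<nu>) \<le> mpos (- K) + mneg (- L)"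
    proof (rule tv_norm_least[OF d])
      fix A :: "'a set" assume A: "A \<in> sets borel"
      have eq: "(\<mu> - ?\<nu>) B = mpos (B - K) - mneg (B - L)" if B: "B \<in> sets borel" for B
      proof -
        have "mpos B = mpos (B \<inter> K) + mpos (B - K)" "mneg B = mneg (B \<inter> L) + mneg (B - L)"
          using B Kb Lb p.split[of B K] n.split[of B L] by simp_all
        then show ?thesis using fun_cong[OF Jordan, of B] B by (simp add: P N)
      qed
      have "mpos (A - K) \<le> mpos (- K)" "mneg (- A - L) \<le> mneg (- L)"
        using A Kb Lb by (auto intro!: pos.finite_measure_mono neg.finite_measure_mono)
      then show "(\<mu> - ?\<nu>) A - (\<mu> - ?\<nu>) (- A) \<le> mpos (- K) + mneg (- L)"
        using A eq[of A] eq[of "- A"] measure_nonneg[of "jordan_neg UNIV \<mu>" "A - L"]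
          measure_nonneg[of "jordan_pos UNIV \<mu>" "- A - K"] by (simp del: measure_nonneg)
    qed
    also have "\<dots> < r"
    proof -
      have "mpos (- K) \<le> mpos ((Y - K) \<union> - Y)" "mneg (- L) \<le> mneg ((- Y - L) \<union> Y)"
        using Y Kb Lb by (auto intro!: pos.finite_measure_mono neg.finite_measure_mono)
      moreover have "mpos ((Y - K) \<union> - Y) \<le> mpos (Y - K) + mpos (- Y)"
        "mneg ((- Y - L) \<union> Y) \<le> mneg (- Y - L) + mneg Y"
        using Y Kb Lb by (intro measure_Un_le; simp)+
      ultimately show ?thesis using Y K L by linarith
    qed
    finally have "tv_norm (\<mu> - ?\<nu>) < r" .
    then have "Phi ?\<nu> \<in> mball \<phi> r"
      using \<mu> \<nu> by (simp add: norm_metric_Phi)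
    then show ?thesis using D by blast
  qed
  then show ?thesis unfolding metric_closure_of by blast
qed

end

theorem theorem7p9:
  assumes "locally_compact_space (euclidean :: 'a::t2_space topology)"
  shows
    "(\<forall>\<mu> \<in> signed_regular_measures (UNIV :: 'a set). Phi \<mu> \<in> order_bounded_functionals) \<and>
     lattice_homomorphism (measure_lattice :: ('a set \<Rightarrow> real) gorder) order_dual Phi \<and>
     inj_on Phi (signed_regular_measures (UNIV :: 'a set)) \<and>
     (\<forall>\<mu> \<in> signed_regular_measures (UNIV :: 'a set). \<forall>h.
        h \<in> borel_measurable borel \<and> bounded (range h) \<longrightarrow>
        density_measure h \<mu> \<in> signed_regular_measures UNIV \<and>
        Phi (density_measure h \<mu>) = functional_mult h (Phi \<mu>)) \<and>
     banach_lattice (Phi_lattice :: (('a \<Rightarrow> real) \<Rightarrow> real) gorder) Phi_norm \<and>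
     dedekind_complete (Phi_lattice :: (('a \<Rightarrow> real) \<Rightarrow> real) gorder) \<and>
     Metric_space.mtopology (Phi ` signed_regular_measures (UNIV :: 'a set))
         (norm_metric (Phi ` signed_regular_measures UNIV) Phi_norm)
       closure_of
         {\<phi> \<in> Phi ` signed_regular_measures UNIV.
            compact (supp \<phi>) \<and> supp (vl_pos order_dual \<phi>) \<inter> supp (vl_neg order_dual \<phi>) = {}}
       = Phi ` signed_regular_measures UNIV"
proof (intro conjI ballI allI impI)
  fix \<mu> :: "'a set \<Rightarrow> real" and h :: "'a \<Rightarrow> real"
  assume \<mu>: "\<mu> \<in> signed_regular_measures UNIV" and "h \<in> borel_measurable borel \<and> bounded (range h)"
  then have h: "bounded_borel h" by (simp add: bounded_borel_def)
  show "density_measure h \<mu> \<in> signed_regular_measures UNIV"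
    by (rule density_measure_signed(1)[OF \<mu> h])
  show "Phi (density_measure h \<mu>) = functional_mult h (Phi \<mu>)"
    by (rule Phi_density_measure[OF assms \<mu> h])
qed (use assms in \<open>simp_all add: Phi_functional lattice_homomorphism_Phi inj_on_Phi
  banach_lattice_Phi dedekind_complete_Phi dense_disjoint_supports\<close>)

end
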